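(* Let $X\subset[-1,1]$ be a Lebesgue-measurable set. Then $$2E(X)\;\ge\;J(\sigma(X))\;=\;2E\big([-1,\alpha(\sigma(X))]\big).$$
   Context: $\sigma$ is the semicircle law, i.e. the probability measure on $[-1,1]$ given by $\sigma(dx)=\frac{2}{\pi}1_{[-1,1]}(x)\sqrt{1-x^2}\,dx$. The inverse quantile map $\alpha:[0,1]\to[-1,1]$ is determined by $\int_{-1}^{\alpha(u)}d\sigma(t)=u$ for $u\in[0,1]$. The free profile map $J:[0,1]\to\mathbb{R}$ is $J(u)=\frac{8}{3\pi}\left(1-\alpha(u)^2\right)^{3/2}$. For a Lebesgue-measurable set $X\subset[-1,1]$, $$E(X)=\int_{x\in X}\int_{y\in[-1,1]\setminus X}\frac{1}{|x-y|}\,d\sigma(x)\,d\sigma(y)\in[0,+\infty].$$ *)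

theory Defs
  imports "HOL-Analysis.Analysis"
begin

text \<open>The semicircle law is taken as a measure on the Lebesgue (not merely Borel) sets of the
  line, so that it measures every Lebesgue-measurable set; the indicator confines it to
  \<open>[-1,1]\<close>.\<close>

definition semicircle :: "real measure" where
  "semicircle =
     density lebesgue (\<lambda>x. ennreal (2 / pi * indicator {-1..1} x * sqrt (1 - x\<^sup>2)))"

text \<open>Meaningful only for \<open>u \<in> [0,1]\<close>, where the distribution function of the semicircle law
  is a strictly increasing bijection from \<open>[-1,1]\<close> onto \<open>[0,1]\<close>.\<close>

definition semicircle_quantile :: "real \<Rightarrow> real" where
  "semicircle_quantile u = (THE a. a \<in> {-1..1} \<and> measure semicircle {-1..a} = u)"

definition free_profile :: "real \<Rightarrow> real" where
  "free_profile u = 8 / (3 * pi) * (1 - (semicircle_quantile u)\<^sup>2) powr (3 / 2)"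

text \<open>The value is in \<open>[0,\<infinity>]\<close>. The convention \<open>1 / 0 = 0\<close> plays no role, because the two
  domains of integration are disjoint.\<close>

definition cut_energy :: "real set \<Rightarrow> ennreal" where
  "cut_energy X =
     (\<integral>\<^sup>+x\<in>X. (\<integral>\<^sup>+y\<in>{-1..1} - X. ennreal (1 / \<bar>x - y\<bar>) \<partial>semicircle) \<partial>semicircle)"

end

theory Submission
  imports Defs
begin

text \<open>In the coordinate \<open>x = sin p\<close> the semicircle law has density \<open>(2 / \<pi>) cos\<^sup>2 p\<close>, and the
  interaction of \<open>[-1, sin p]\<close> with \<open>[sin q, 1]\<close> is elementary; letting \<open>q\<close> tend to \<open>p\<close> gives the
  equality for half-lines.

  For a finite union of intervals, move the leftmost interval while keeping its mass, as
  far as the left end of \<open>[-1,1]\<close> or the next interval. The energy has no interior minimum along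
  this motion: at a critical position its second derivative is negative, because the unknown
  contribution of the other intervals to the second derivative is controlled by their contribution
  to the first, which criticality determines. At either extreme position the set has fewer boundary
  points, so by induction (and passing to complements) half-lines are optimal.

  Since the energy of a function is the integral of the energies of its level sets, the inequality
  passes from finite unions of intervals to polynomials, and from there to an arbitrary set by
  averaging its indicator over the maps \<open>x \<mapsto> (1 - r) x + r s\<close> with \<open>\<bar>s\<bar> \<le> 1\<close>, which increases the
  energy at most by the factor \<open>(1 - r) ^ (- 3)\<close>.\<close>

section \<open>The semicircle law in angular coordinates\<close>

text \<open>The unknown intervals are controlled by convexity. To the left of a set
  \<open>R\<close>, the integral of \<open>1 / (y - x)\<close> over \<open>R\<close> is a convex
  function of \<open>x\<close>, so its slope at the left end of the arc is at most its difference
  quotient across the arc. Criticality equates this difference with an explicit function of the two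
  end points, and what remains is a strict inequality between elementary functions of two angles,
  \<open>stiffness_gt_drift\<close>.

  The obstacle in the approximation is that closeness in L1 gives no upper bound on the energy. The
  inequality is therefore carried by functions, with an L1 error term that absorbs the change of
  mass, and every approximation has to keep the energy from growing. A polynomial does so when its
  derivative is uniformly close to that of the function, which asks for a continuous derivative. One
  average makes a bounded function continuous, a second one makes it continuously differentiable;
  this is why averages are taken twice.\<close>

definition angle_cdf :: "real \<Rightarrow> real" where
  "angle_cdf p = 1 / 2 + (p + sin p * cos p) / pi"

lemma DERIV_angle_cdf: "(angle_cdf has_real_derivative 2 / pi * (cos p)\<^sup>2) (at p within A)"
proof -
  have "(angle_cdf has_real_derivative (1 + (cos p * cos p - sin p * sin p)) / pi) (at p within A)"
    unfolding angle_cdf_def by (auto intro!: derivative_eq_intros)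
  moreover have "(1 + (cos p * cos p - sin p * sin p)) / pi = 2 / pi * (cos p)\<^sup>2"
    using sin_cos_squared_add[of p] by (simp add: power2_eq_square field_simps)
  ultimately show ?thesis by simp
qed

lemma continuous_angle_cdf: "continuous_on A angle_cdf"
  unfolding angle_cdf_def by (intro continuous_intros) auto

lemma angle_cdf_ends [simp]: "angle_cdf (-(pi/2)) = 0" "angle_cdf (pi/2) = 1"
  by (simp_all add: angle_cdf_def)

lemma angle_cdf_strict_mono:
  assumes "-(pi/2) \<le> p" "p < q" "q \<le> pi/2"
  shows "angle_cdf p < angle_cdf q"
proof (rule DERIV_pos_imp_increasing_open[OF assms(2)])
  fix x assume "p < x" "x < q"
  then have "cos x > 0" using assms by (intro cos_gt_zero_pi) auto
  then show "\<exists>y. (angle_cdf has_real_derivative y) (at x) \<and> y > 0"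
    by (intro exI[of _ "2 / pi * (cos x)\<^sup>2"] conjI DERIV_angle_cdf) auto
qed (rule continuous_angle_cdf)

lemma angle_cdf_mono:
  assumes "-(pi/2) \<le> p" "p \<le> q" "q \<le> pi/2"
  shows "angle_cdf p \<le> angle_cdf q"
  using angle_cdf_strict_mono[of p q] assms by (cases "p = q") auto

lemma inj_angle_cdf: "inj_on angle_cdf {-(pi/2)..pi/2}"
  by (rule linorder_inj_onI) (auto dest: angle_cdf_strict_mono)

lemma image_angle_cdf: "angle_cdf ` {-(pi/2)..pi/2} = {0..1}"
proof
  show "angle_cdf ` {-(pi/2)..pi/2} \<subseteq> {0..1}"
    using angle_cdf_mono[of "-(pi/2)"] angle_cdf_mono[of _ "pi/2"] by auto
  show "{0..1} \<subseteq> angle_cdf ` {-(pi/2)..pi/2}"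
  proof
    fix u :: real assume "u \<in> {0..1}"
    then obtain p where "-(pi/2) \<le> p" "p \<le> pi/2" "angle_cdf p = u"
      using IVT'[OF _ _ _ continuous_angle_cdf, of "-(pi/2)" u "pi/2"] by fastforce
    then show "u \<in> angle_cdf ` {-(pi/2)..pi/2}" by (intro image_eqI[of _ _ p]) auto
  qed
qed

definition angle_quantile :: "real \<Rightarrow> real" where
  "angle_quantile = inv_into {-(pi/2)..pi/2} angle_cdf"

lemma angle_quantile_range:
  "u \<in> {0..1} \<Longrightarrow> angle_quantile u \<in> {-(pi/2)..pi/2}"
  unfolding angle_quantile_def by (rule inv_into_into) (simp add: image_angle_cdf)

lemma angle_cdf_quantile: "u \<in> {0..1} \<Longrightarrow> angle_cdf (angle_quantile u) = u"
  unfolding angle_quantile_def by (rule f_inv_into_f) (simp add: image_angle_cdf)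

lemma angle_quantile_cdf: "p \<in> {-(pi/2)..pi/2} \<Longrightarrow> angle_quantile (angle_cdf p) = p"
  unfolding angle_quantile_def by (rule inv_into_f_f[OF inj_angle_cdf])

lemma angle_quantile_ends [simp]:
  "angle_quantile 0 = -(pi/2)" "angle_quantile 1 = pi/2"
  using angle_quantile_cdf[of "-(pi/2)"] angle_quantile_cdf[of "pi/2"] by simp_all

lemma angle_quantile_strict_mono:
  assumes "0 \<le> u" "u < v" "v \<le> 1"
  shows "angle_quantile u < angle_quantile v"
proof (rule ccontr)
  assume "\<not> ?thesis"
  then have "angle_cdf (angle_quantile v) \<le> angle_cdf (angle_quantile u)"
    using angle_quantile_range[of u] angle_quantile_range[of v] assms by (intro angle_cdf_mono) auto
  then show False using angle_cdf_quantile[of u] angle_cdf_quantile[of v] assms by auto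
qed

lemma continuous_angle_quantile: "continuous_on {0..1} angle_quantile"
proof -
  have "continuous_on (angle_cdf ` {-(pi/2)..pi/2}) angle_quantile"
    by (intro continuous_on_inv continuous_angle_cdf) (auto simp: angle_quantile_cdf)
  then show ?thesis by (simp add: image_angle_cdf)
qed

lemma angle_quantile_interior:
  assumes "0 < u" "u < 1"
  shows "-(pi/2) < angle_quantile u" "angle_quantile u < pi/2"
  using angle_quantile_strict_mono[of 0 u] angle_quantile_strict_mono[of u 1] assms by simp_all

text \<open>The end points are excluded because the density vanishes there, so that the inverse
  function has infinite slope. At the ends only continuity of the quantile is available, and all
  differentiation along the motion takes place in the interior.\<close>

lemma DERIV_angle_quantile:
  assumes "0 < u" "u < 1"
  shows "(angle_quantile has_real_derivative pi / (2 * (cos (angle_quantile u))\<^sup>2)) (at u)"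
proof -
  have c: "cos (angle_quantile u) > 0"
    using angle_quantile_interior[OF assms] by (intro cos_gt_zero_pi) auto
  have "isCont angle_quantile u"
    by (rule continuous_on_interior[OF continuous_angle_quantile]) (use assms in auto)
  then have "(angle_quantile has_real_derivative inverse (2 / pi * (cos (angle_quantile u))\<^sup>2)) (at u)"
    using assms c by (intro DERIV_inverse_function[OF DERIV_angle_cdf]) (auto intro: angle_cdf_quantile)
  then show ?thesis by (simp add: field_simps)
qed

text \<open>The free profile at mass \<open>angle_cdf p\<close>: the quantile of that mass is
  \<open>sin p\<close>, and \<open>(1 - (sin p)\<^sup>2) powr (3 / 2)\<close> is
  \<open>cos p ^ 3\<close>.\<close>

definition angle_profile :: "real \<Rightarrow> real" where
  "angle_profile p = 8 / (3 * pi) * (cos p) ^ 3"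

lemma DERIV_angle_profile:
  "(angle_profile has_real_derivative - (8 / pi * (cos p)\<^sup>2 * sin p)) (at p within A)"
  unfolding angle_profile_def
  by (auto intro!: derivative_eq_intros simp: field_simps power2_eq_square)

text \<open>As a function of the mass the profile has slope \<open>- 4 * sin p\<close>, so adding it
  to, or subtracting it from, four times the mass gives a nondecreasing function. This 4 is the
  constant in front of the L1 error in \<open>near_isoperimetric\<close>.\<close>

lemma angle_profile_lipschitz_aux:
  assumes "-(pi/2) \<le> p" "p \<le> q" "q \<le> pi/2"
  shows "\<bar>angle_profile q - angle_profile p\<bar> \<le> 4 * (angle_cdf q - angle_cdf p)"
proof -
  have D: "((\<lambda>p. 4 * angle_cdf p + s * angle_profile p) has_real_derivative
      4 * (2 / pi * (cos x)\<^sup>2) + s * (- (8 / pi * (cos x)\<^sup>2 * sin x))) (at x)" for s x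
    by (rule DERIV_add[OF DERIV_cmult[OF DERIV_angle_cdf] DERIV_cmult[OF DERIV_angle_profile]])
  have "4 * (2 / pi * (cos x)\<^sup>2) + s * (- (8 / pi * (cos x)\<^sup>2 * sin x)) \<ge> 0" if "\<bar>s\<bar> \<le> 1" for s x
  proof -
    have "\<bar>s * sin x\<bar> \<le> 1 * 1" unfolding abs_mult using that by (intro mult_mono) auto
    then have "0 \<le> (8 / pi * (cos x)\<^sup>2) * (1 - s * sin x)" by (intro mult_nonneg_nonneg) auto
    also have "\<dots> = 4 * (2 / pi * (cos x)\<^sup>2) + s * (- (8 / pi * (cos x)\<^sup>2 * sin x))"
      by (simp add: field_simps)
    finally show ?thesis .
  qed
  note nonneg = this
  have "4 * angle_cdf p + s * angle_profile p \<le> 4 * angle_cdf q + s * angle_profile q"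
    if "\<bar>s\<bar> \<le> 1" for s
    using D nonneg[OF that] by (intro DERIV_nonneg_imp_nondecreasing[OF assms(2)]) meson
  from this[of 1] this[of "-1"] show ?thesis by (simp add: abs_if)
qed

lemma angle_profile_lipschitz:
  assumes "u \<in> {0..1}" "v \<in> {0..1}"
  shows "\<bar>angle_profile (angle_quantile u) - angle_profile (angle_quantile v)\<bar> \<le> 4 * \<bar>u - v\<bar>"
proof -
  have *: "\<bar>angle_profile (angle_quantile v) - angle_profile (angle_quantile u)\<bar> \<le> 4 * (v - u)"
    if "u \<le> v" "u \<in> {0..1}" "v \<in> {0..1}" for u v
  proof -
    have "angle_quantile u \<le> angle_quantile v"
      using angle_quantile_strict_mono[of u v] that by (cases "u = v") auto
    then have "\<bar>angle_profile (angle_quantile v) - angle_profile (angle_quantile u)\<bar>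
        \<le> 4 * (angle_cdf (angle_quantile v) - angle_cdf (angle_quantile u))"
      using angle_quantile_range[OF that(2)] angle_quantile_range[OF that(3)]
      by (intro angle_profile_lipschitz_aux) simp_all
    then show ?thesis by (simp only: angle_cdf_quantile[OF that(2)] angle_cdf_quantile[OF that(3)])
  qed
  show ?thesis using *[of u v] *[of v u] assms by (cases "u \<le> v") auto
qed

text \<open>A joint primitive of the Riesz kernel in both angles: the partial derivatives are
  \<open>cos q / (sin q - sin p)\<close> in \<open>p\<close> and
  \<open>- cos p / (sin q - sin p)\<close> in \<open>q\<close>. The half angles come from factoring
  \<open>sin q - sin p\<close>, and the normalisation makes it vanish when
  \<open>p = -(pi/2)\<close> or \<open>q = pi/2\<close>.\<close>

definition log_kernel :: "real \<Rightarrow> real \<Rightarrow> real" where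
  "log_kernel p q = ln (cos ((p + q) / 2) / sin ((q - p) / 2))"

lemma half_angle_pos:
  assumes "-(pi/2) \<le> p" "p < q" "q \<le> pi/2"
  shows "cos ((p + q) / 2) > 0" "sin ((q - p) / 2) > 0"
  using assms by (auto intro!: cos_gt_zero_pi sin_gt_zero)

lemma sin_diff_half: "sin q - sin p = 2 * sin ((q - p) / 2) * cos ((p + q) / 2)" for p q :: real
  by (simp add: sin_diff_sin add.commute)

lemma cos_diff_half: "cos p - cos q = 2 * sin ((q - p) / 2) * sin ((p + q) / 2)" for p q :: real
  by (simp add: cos_diff_cos)

lemma sin_less: "-(pi/2) \<le> p \<Longrightarrow> p < q \<Longrightarrow> q \<le> pi/2 \<Longrightarrow> sin p < sin q" for p q :: real
  by (simp add: sin_monotone_2pi)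

text \<open>The squares of numerator and denominator differ by \<open>cos p * cos q\<close>, which
  is positive.\<close>

lemma log_kernel_pos:
  assumes "-(pi/2) < p" "p < q" "q < pi/2"
  shows "log_kernel p q > 0"
proof -
  have "(cos ((p + q) / 2))\<^sup>2 - (sin ((q - p) / 2))\<^sup>2 = cos p * cos q"
  proof -
    have e: "p + q = 2 * ((p + q) / 2)" "q - p = 2 * ((q - p) / 2)" by simp_all
    have "cos p * cos q = (cos (p+q) + cos (q-p)) / 2" by (simp add: cos_add cos_diff)
    also have "cos (p+q) = 2 * (cos ((p+q)/2))\<^sup>2 - 1" by (subst e(1), rule cos_double_cos)
    also have "cos (q-p) = 1 - 2 * (sin ((q-p)/2))\<^sup>2" by (subst e(2), rule cos_double_sin)
    finally show ?thesis by simp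
  qed
  moreover have "cos p * cos q > 0" using assms by (intro mult_pos_pos cos_gt_zero_pi) auto
  ultimately have "(sin ((q - p) / 2))\<^sup>2 < (cos ((p + q) / 2))\<^sup>2" by simp
  then have "sin ((q - p) / 2) < cos ((p + q) / 2)"
    using half_angle_pos[of p q] assms power2_less_imp_less by force
  then show ?thesis unfolding log_kernel_def using half_angle_pos[of p q] assms by simp
qed

lemma DERIV_log_kernel:
  assumes "-(pi/2) \<le> p0" "p0 < q0" "q0 \<le> pi/2"
    and P: "(p has_real_derivative p') (at t within A)"
    and Q: "(q has_real_derivative q') (at t within A)"
    and [simp]: "p t = p0" "q t = q0"
  shows "((\<lambda>t. log_kernel (p t) (q t)) has_real_derivative
           (cos q0 * p' - cos p0 * q') / (sin q0 - sin p0)) (at t within A)"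
proof -
  let ?m = "(p0 + q0) / 2" and ?d = "(q0 - p0) / 2"
  note pos = half_angle_pos[OF assms(1-3)]
  define M D where "M = (\<lambda>t. (p t + q t) / 2)" and "D = (\<lambda>t. (q t - p t) / 2)"
  have M: "(M has_real_derivative (p' + q') / 2) (at t within A)" "M t = ?m"
    unfolding M_def using DERIV_cdivide[OF DERIV_add[OF P Q], of 2] by simp_all
  have D: "(D has_real_derivative (q' - p') / 2) (at t within A)" "D t = ?d"
    unfolding D_def using DERIV_cdivide[OF DERIV_diff[OF Q P], of 2] by simp_all
  have "((\<lambda>t. cos (M t) / sin (D t)) has_real_derivative
     (- sin ?m * ((p' + q') / 2) * sin ?d - cos ?m * (cos ?d * ((q' - p') / 2))) / (sin ?d * sin ?d)) (at t within A)"
    by (rule derivative_eq_intros M(1) D(1) refl | simp add: M(2) D(2) order_less_imp_not_eq2[OF pos(2)])+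
  from DERIV_chain2[OF DERIV_ln this, unfolded M(2) D(2)]
  have "((\<lambda>t. log_kernel (p t) (q t)) has_real_derivative
     inverse (cos ?m / sin ?d) * ((- sin ?m * ((p' + q') / 2) * sin ?d - cos ?m * (cos ?d * ((q' - p') / 2))) / (sin ?d * sin ?d)))
     (at t within A)"
    unfolding log_kernel_def M_def D_def using pos by simp
  also have "inverse (cos ?m / sin ?d) * ((- sin ?m * ((p' + q') / 2) * sin ?d - cos ?m * (cos ?d * ((q' - p') / 2))) / (sin ?d * sin ?d)) =
     ((cos ?m * cos ?d - sin ?m * sin ?d) * p' - (cos ?m * cos ?d + sin ?m * sin ?d) * q') 
       / (2 * sin ?d * cos ?m)"
  proof -
    have "inverse (C / s) * ((- S * ((p' + q') / 2) * s - C * (c * ((q' - p') / 2))) / (s * s)) =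
      ((C * c - S * s) * p' - (C * c + S * s) * q') / (2 * s * C)" if "C > 0" "s > 0" for S C s c
      using that by (simp add: divide_simps) (algebra)
    then show ?thesis using pos by blast
  qed
  also have "cos ?m * cos ?d - sin ?m * sin ?d = cos (?m + ?d)" by (rule cos_add[symmetric])
  also have "cos ?m * cos ?d + sin ?m * sin ?d = cos (?m - ?d)" by (rule cos_diff[symmetric])
  also have "?m + ?d = q0" by argo
  also have "?m - ?d = p0" by argo
  finally show ?thesis by (simp add: sin_diff_half)
qed

section \<open>Trigonometric inequalities\<close>

text \<open>The difference of the two sides vanishes at 1 and has derivative
  \<open>(x - 1)\<^sup>2 / (x * (x + 1)\<^sup>2)\<close>. This rational bound suits a quotient of
  sines of a sum and a difference, where \<open>(z - 1) / (z + 1)\<close> collapses to a quotient of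
  tangents.\<close>

lemma ln_ge_rational:
  fixes z :: real assumes "z \<ge> 1"
  shows "ln z \<ge> 2 * (z - 1) / (z + 1)"
proof -
  have "(\<lambda>z. ln z - 2 * (z - 1) / (z + 1)) 1 \<le> (\<lambda>z. ln z - 2 * (z - 1) / (z + 1)) z"
  proof (rule DERIV_nonneg_imp_nondecreasing[OF assms])
    fix x :: real assume x: "1 \<le> x" "x \<le> z"
    have "((\<lambda>z. ln z - 2 * (z - 1) / (z + 1)) has_real_derivative
       1 / x - (2 * (x + 1) - 2 * (x - 1)) / ((x + 1) * (x + 1))) (at x)"
      using x by (auto intro!: derivative_eq_intros)
    moreover have "1 / x - (2 * (x + 1) - 2 * (x - 1)) / ((x + 1) * (x + 1)) = (x - 1)\<^sup>2 / (x * (x + 1)\<^sup>2)"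
      using x by (simp add: divide_simps power2_eq_square) (simp add: algebra_simps)
    moreover have "(x - 1)\<^sup>2 / (x * (x + 1)\<^sup>2) \<ge> 0" using x by simp
    ultimately show "\<exists>y. ((\<lambda>z. ln z - 2 * (z - 1) / (z + 1)) has_real_derivative y) (at x) \<and> y \<ge> 0"
      by metis
  qed
  then show ?thesis by simp
qed

lemma tan_ge_self:
  fixes x :: real assumes "0 \<le> x" "x < pi / 2"
  shows "x \<le> tan x"
proof -
  have "(\<lambda>x. tan x - x) 0 \<le> (\<lambda>x. tan x - x) x"
  proof (rule DERIV_nonneg_imp_nondecreasing[OF assms(1)])
    fix y :: real assume y: "0 \<le> y" "y \<le> x"
    then have c: "cos y > 0" using assms by (intro cos_gt_zero_pi) auto
    have "((\<lambda>x. tan x - x) has_real_derivative inverse ((cos y)\<^sup>2) - 1) (at y)"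
      using c by (auto intro!: derivative_eq_intros)
    moreover have "inverse ((cos y)\<^sup>2) \<ge> 1"
      using c by (intro one_le_inverse) (auto simp: power_le_one)
    ultimately show "\<exists>d. ((\<lambda>x. tan x - x) has_real_derivative d) (at y) \<and> d \<ge> 0"
      by (intro exI[of _ "inverse ((cos y)\<^sup>2) - 1"]) auto
  qed
  then show ?thesis by simp
qed

text \<open>Up to normalisation, \<open>drift\<close> is the derivative of the energy of the arc \<open>[sin p, sin q]\<close> under
  a displacement that preserves its mass, and \<open>stiffness\<close> is minus the derivative of \<open>drift\<close>.\<close>

definition drift :: "real \<Rightarrow> real \<Rightarrow> real" where
  "drift p q = sin q * p - sin p * q + (1 + log_kernel p q) * (cos q - cos p)"

definition stiffness :: "real \<Rightarrow> real \<Rightarrow> real" where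
  "stiffness p q = (cos q - cos p)\<^sup>2 / (cos p * cos q * (sin q - sin p)) + q / cos p - p / cos q
     + log_kernel p q * (sin q / (cos q)\<^sup>2 - sin p / (cos p)\<^sup>2)"

text \<open>With \<open>m\<close> the midpoint of the two angles, the first summand is
  \<open>tan m * (1 / cos q - 1 / cos p)\<close>. The bracket has the sign of \<open>m\<close>, so
  replacing \<open>tan m\<close> by \<open>m\<close> only decreases the product, and together with
  the next two summands it becomes \<open>(q - p) / 2 * (1 / cos p + 1 / cos q)\<close>. The
  logarithmic summand is nonnegative because \<open>sin / cos\<^sup>2\<close> increases.\<close>

lemma stiffness_pos:
  assumes "-(pi/2) < p" "p < q" "q < pi/2"
  shows "stiffness p q > 0"
proof -
  define m where "m = (p + q) / 2"
  define cp cq where "cp = cos p" and "cq = cos q"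
  have c: "cp > 0" "cq > 0" using assms by (auto simp: cp_def cq_def intro!: cos_gt_zero_pi)
  have s: "sin p < sin q" using assms by (intro sin_less) auto
  note pos = half_angle_pos[of p q]
  have t: "(cp - cq) / (sin q - sin p) = tan m"
    using pos assms unfolding cp_def cq_def sin_diff_half cos_diff_half m_def tan_def by (simp add: field_simps)
  have 1: "(cq - cp)\<^sup>2 / (cp * cq * (sin q - sin p)) = tan m * (1 / cq - 1 / cp)"
    unfolding t[symmetric] using c s by (simp add: field_simps power2_eq_square)
  have "m * (1 / cq - 1 / cp) \<le> tan m * (1 / cq - 1 / cp)"
  proof (cases "m \<ge> 0")
    case True
    then have "cq \<le> cp" unfolding cp_def cq_def using assms cos_mono_le_eq[of "\<bar>q\<bar>" "\<bar>p\<bar>"]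
      by (auto simp: m_def)
    then have "1 / cp \<le> 1 / cq" using c by (simp add: frac_le)
    moreover have "m \<le> tan m" using True assms by (intro tan_ge_self) (auto simp: m_def)
    ultimately show ?thesis by (intro mult_right_mono) auto
  next
    case False
    then have "cp \<le> cq" unfolding cp_def cq_def using assms cos_mono_le_eq[of "\<bar>p\<bar>" "\<bar>q\<bar>"]
      by (auto simp: m_def)
    then have "1 / cq \<le> 1 / cp" using c by (simp add: frac_le)
    moreover have "- m < pi / 2" using assms(1,2) unfolding m_def by argo
    then have "-m \<le> tan (-m)" using False by (intro tan_ge_self) auto
    then have "tan m \<le> m" by simp
    ultimately show ?thesis by (intro mult_right_mono_neg) auto
  qed
  moreover have "m * (1 / cq - 1 / cp) + q / cp - p / cq = (q - p) / 2 * (1 / cp + 1 / cq)"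
    unfolding m_def using c by (simp add: field_simps)
  moreover have "(q - p) / 2 * (1 / cp + 1 / cq) > 0"
    using c assms by (intro mult_pos_pos add_pos_pos) auto
  moreover have "log_kernel p q * (sin q / cq\<^sup>2 - sin p / cp\<^sup>2) \<ge> 0"
  proof (intro mult_nonneg_nonneg)
    show "0 \<le> log_kernel p q" using log_kernel_pos[OF assms] by simp
    have sq: "cp\<^sup>2 = 1 - (sin p)\<^sup>2" "cq\<^sup>2 = 1 - (sin q)\<^sup>2" by (simp_all add: cp_def cq_def cos_squared_eq)
    have "sin q * cp\<^sup>2 - sin p * cq\<^sup>2 = (sin q - sin p) * (1 + sin p * sin q)"
      unfolding sq by (simp add: algebra_simps power2_eq_square)
    moreover have "\<bar>sin p * sin q\<bar> \<le> 1 * 1" unfolding abs_mult by (intro mult_mono) auto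
    then have "(sin q - sin p) * (1 + sin p * sin q) \<ge> 0" using s by (intro mult_nonneg_nonneg) auto
    ultimately show "0 \<le> sin q / cq\<^sup>2 - sin p / cp\<^sup>2" using c by (simp add: field_simps)
  qed
  ultimately show ?thesis unfolding stiffness_def cp_def[symmetric] cq_def[symmetric] 1 by linarith
qed

text \<open>This is the part of \<open>stiffness_gt_drift\<close> that involves the logarithm. It
  has content only if \<open>cos (p + q) < 0\<close>; then \<open>cos p < cos q\<close> forces
  \<open>p + q < -(pi/2)\<close>, that is, an arc towards the left end of
  \<open>[-1,1]\<close>.\<close>

lemma log_kernel_lower_bound:
  assumes "-(pi/2) < p" "p < q" "q < pi/2" "cos p < cos q"
  shows "log_kernel p q * (cos p / cos q + cos q / cos p) / 2 > - cos (p + q)"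
    (is "?L * ?r / 2 > _")
proof (cases "cos (p + q) \<ge> 0")
  case True
  have "cos p > 0" "cos q > 0" using assms by (simp_all add: cos_gt_zero_pi)
  then have "?L * ?r / 2 > 0" using log_kernel_pos[OF assms(1-3)]
    by (simp add: add_pos_pos)
  then show ?thesis using True by linarith
next
  case False
  \<comment> \<open>Half angles measured from \<open>-(pi/2)\<close>: the cosines of
    \<open>p\<close> and \<open>q\<close> become the sines of \<open>2 * x\<close> and
    \<open>2 * y\<close>, and the kernel becomes the logarithm of
    \<open>sin (x + y) / sin (y - x)\<close>.\<close>
  define x y where "x = (p + pi/2) / 2" and "y = (q + pi/2) / 2"
  have pq: "p = 2 * x - pi/2" "q = 2 * y - pi/2" unfolding x_def y_def by argo+
  have xy: "0 < x" "x < y" "y < pi/2" using assms by (auto simp: x_def y_def)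
  have "\<bar>q\<bar> < \<bar>p\<bar>" using assms cos_mono_less_eq[of "\<bar>p\<bar>" "\<bar>q\<bar>"] by auto
  then have pn: "p + q < 0" using assms by auto
  have pn': "p + q < -(pi/2)"
  proof (rule ccontr)
    assume "\<not> ?thesis"
    then have "cos (p + q) \<ge> 0" using pn by (intro cos_ge_zero) auto
    with False show False by simp
  qed
  have pos: "sin x > 0" "sin y > 0" "cos x > 0" "cos y > 0"
    using xy by (auto intro!: sin_gt_zero cos_gt_zero_pi)
  have c: "cos p = 2 * sin x * cos x" "cos q = 2 * sin y * cos y"
    unfolding pq by (simp_all add: cos_diff sin_double)
  define z where "z = sin (x + y) / sin (y - x)"
  have s: "sin (y - x) > 0" using xy by (intro sin_gt_zero) auto
  have L: "?L = ln z"
  proof -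
    have "(p + q) / 2 = (x + y) - pi / 2" "(q - p) / 2 = y - x" unfolding pq by argo+
    then show ?thesis unfolding log_kernel_def z_def by (simp only: cos_diff) simp
  qed
  have d: "sin (x + y) - sin (y - x) = 2 * cos y * sin x" "sin (x + y) + sin (y - x) = 2 * sin y * cos x"
    by (simp_all add: sin_add sin_diff)
  have z1: "z \<ge> 1" 
  proof -
    have "2 * cos y * sin x > 0" using pos by simp
    then have "sin (y - x) \<le> sin (x + y)" using d(1) by linarith
    then show ?thesis unfolding z_def using s by simp
  qed
  \<comment> \<open>By the two formulas in \<open>d\<close> this is twice
    \<open>tan x / tan y\<close>; multiplied by the quotients of cosines it turns into a sum of two
    squares.\<close>
  have "2 * (z - 1) / (z + 1) = 2 * ((sin (x + y) - sin (y - x)) / (sin (x + y) + sin (y - x)))"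
    using s pos unfolding z_def by (auto simp: divide_simps)
  also have "\<dots> = 2 * (cos y * sin x) / (sin y * cos x)" unfolding d by simp
  finally have "?L \<ge> 2 * (cos y * sin x) / (sin y * cos x)" using ln_ge_rational[OF z1] L by simp
  then have "?L * ?r / 2 \<ge> (2 * (cos y * sin x) / (sin y * cos x)) * ?r / 2"
    using pos unfolding c by (intro divide_right_mono mult_right_mono add_nonneg_nonneg divide_nonneg_nonneg) auto
  also have "(2 * (cos y * sin x) / (sin y * cos x)) * ?r / 2 = (sin x / sin y)\<^sup>2 + (cos y / cos x)\<^sup>2"
    using pos unfolding c by (simp add: divide_simps power2_eq_square)
  finally have A: "?L * ?r / 2 \<ge> (sin x / sin y)\<^sup>2 + (cos y / cos x)\<^sup>2" .
  have B: "(sin x / sin y)\<^sup>2 > 0" using pos by simp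
  \<comment> \<open>The second square already reaches the goal, through
    \<open>(cos y)\<^sup>2\<close>, \<open>cos (2 * y)\<close> and \<open>cos (2 * (x + y))\<close>;
    the first square, being positive, makes the inequality strict.\<close>
  have "cos y \<le> cos y / cos x" using pos by (simp add: field_simps)
  then have "(cos y)\<^sup>2 \<le> (cos y / cos x)\<^sup>2" using pos by (intro power_mono) auto
  moreover have "- cos (p + q) = cos (2 * (x + y))" 
  proof -
    have "p + q = 2 * (x + y) - pi" by (simp add: pq)
    then show ?thesis by (simp add: cos_diff)
  qed
  moreover have "cos (2 * (x + y)) \<le> cos (2 * y)"
    using xy pn' by (intro cos_monotone_0_pi_le) (auto simp: pq)
  moreover have "cos (2 * y) \<le> (cos y)\<^sup>2"
    using cos_double[of y] by simp
  ultimately show ?thesis using A B by linarith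
qed

lemma one_minus_cos_ge:
  fixes d :: real assumes "0 < d" "d < pi"
  shows "d * sin d \<le> 2 * (1 - cos d)"
proof -
  have "d / 2 \<le> tan (d / 2)" using assms by (intro tan_ge_self) auto
  moreover have "sin (d/2) > 0" "cos (d/2) > 0" using assms by (auto intro!: sin_gt_zero cos_gt_zero_pi)
  ultimately have "d / 2 * cos (d / 2) \<le> sin (d / 2)" by (simp add: tan_def field_simps)
  then have "4 * sin (d / 2) * (d / 2 * cos (d / 2)) \<le> 4 * sin (d / 2) * sin (d / 2)"
    using \<open>sin (d/2) > 0\<close> by (intro mult_left_mono) auto
  moreover have "sin d = 2 * sin (d/2) * cos (d/2)" using sin_double[of "d/2"] by simp
  moreover have "1 - cos d = 2 * sin (d/2) * sin (d/2)" using cos_double_sin[of "d/2"] by (simp add: power2_eq_square)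
  ultimately show ?thesis by (simp add: algebra_simps)
qed

text \<open>The factor of \<open>drift\<close> is exactly what convexity of the Cauchy transform
  produces in \<open>moving_drift'_neg\<close>. After clearing denominators, with
  \<open>d = q - p\<close>, the difference of the sides is \<open>d * sin d * cos (p + q) + L * (cp
  / cq + cq / cp) * (1 - cos d)\<close>. The only possibly negative term is the first, and it is
  beaten by combining \<open>log_kernel_lower_bound\<close> with
  \<open>d * sin d \<le> 2 * (1 - cos d)\<close>.\<close>

lemma stiffness_gt_drift:
  assumes "-(pi/2) < p" "p < q" "q < pi/2" "cos p < cos q"
  shows "stiffness p q > (1 / cos p - 1 / cos q) / (sin q - sin p) * drift p q"
proof -
  define cp cq a b L where "cp = cos p" and "cq = cos q" and "a = sin p" and "b = sin q" and "L = log_kernel p q"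
  note defs = cp_def[symmetric] cq_def[symmetric] a_def[symmetric] b_def[symmetric] L_def[symmetric]
  have c: "cp > 0" "cq > 0" using assms by (auto simp: cp_def cq_def intro!: cos_gt_zero_pi)
  have s: "b - a > 0" using assms sin_less[of p q] by (auto simp: a_def b_def)
  have L: "L > 0" unfolding L_def using log_kernel_pos[OF assms(1-3)] .
  have sq: "a\<^sup>2 = 1 - cp\<^sup>2" "b\<^sup>2 = 1 - cq\<^sup>2" by (simp_all add: cp_def cq_def a_def b_def sin_squared_eq)
  define C where "C = 1 - (cp * cq + a * b)"
  have C: "C = 1 - cos (q - p)" by (simp add: C_def cp_def cq_def a_def b_def cos_diff algebra_simps)
  have "cos (q - p) < 1" using assms cos_monotone_0_pi[of 0 "q - p"] by auto
  then have Cpos: "C > 0" unfolding C by simp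
  define R where "R = (q - p) * (b * cq - a * cp) + L * (cp\<^sup>2 + cq\<^sup>2) / (cp * cq) * C"
  have "cp * cq * X * (Y\<^sup>2 / (cp * cq * X) + q / cp - p / cq + L * (b / cq\<^sup>2 - a / cp\<^sup>2)) =
     Y\<^sup>2 + X * (q * cq - p * cp) + L * (X * (b * cp / cq - a * cq / cp))" if "X > 0" for X Y
    using c that by (simp add: divide_simps power2_eq_square) (simp add: algebra_simps)
  from this[OF s, of "cq - cp"]
  have "cp * cq * (b - a) * stiffness p q = 
     (cq - cp)\<^sup>2 + (b - a) * (q * cq - p * cp) + L * ((b - a) * (b * cp / cq - a * cq / cp))"
    unfolding stiffness_def defs .
  \<comment> \<open>The square \<open>(cq - cp)\<^sup>2\<close> cancels against the summand 1 in the
    factor \<open>1 + log_kernel p q\<close> of \<open>drift\<close>, and the terms linear in the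
    angles combine into a multiple of \<open>q - p\<close>.\<close>
  then have "cp * cq * (b - a) * stiffness p q - (cq - cp) * drift p q = 
      (q - p) * (b * cq - a * cp) + L * ((b - a) * (b * cp / cq - a * cq / cp) - (cq - cp)\<^sup>2)"
    unfolding drift_def defs by (simp add: algebra_simps power2_eq_square)
  also have "(b - a) * (b * cp / cq - a * cq / cp) - (cq - cp)\<^sup>2 = 
     (b\<^sup>2 * cp\<^sup>2 + a\<^sup>2 * cq\<^sup>2 - a * b * (cp\<^sup>2 + cq\<^sup>2) - (cq - cp)\<^sup>2 * cp * cq) / (cp * cq)"
    using c by (simp add: divide_simps power2_eq_square) (simp add: algebra_simps)
  also have "b\<^sup>2 * cp\<^sup>2 + a\<^sup>2 * cq\<^sup>2 - a * b * (cp\<^sup>2 + cq\<^sup>2) - (cq - cp)\<^sup>2 * cp * cq = (cp\<^sup>2 + cq\<^sup>2) * C"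
    unfolding sq C_def by (simp add: algebra_simps power2_eq_square)
  finally have E: "cp * cq * (b - a) * stiffness p q - (cq - cp) * drift p q = R"
    by (simp add: R_def)
  have "R > 0"
  proof -
    define d where "d = q - p"
    have d: "0 < d" "d < pi" using assms by (auto simp: d_def)
    have sd: "sin d > 0" using d by (rule sin_gt_zero)
    have "b * cq - a * cp = cos (p + q) * sin d"
    proof -
      have "cos (p + q) * sin d = b * cq * (cp\<^sup>2 + a\<^sup>2) - a * cp * (cq\<^sup>2 + b\<^sup>2)"
        unfolding d_def cos_add sin_diff defs by (simp add: algebra_simps power2_eq_square)
      then show ?thesis unfolding sq by simp
    qed
    then have R: "R = d * sin d * cos (p + q) + L * (cp / cq + cq / cp) * C"
      unfolding R_def d_def using c by (simp add: field_simps power2_eq_square)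
    define r where "r = L * (cp / cq + cq / cp)"
    have r: "r / 2 > - cos (p + q)" using log_kernel_lower_bound[OF assms] by (simp add: r_def defs)
    have rp: "r > 0" unfolding r_def using L c by (intro mult_pos_pos add_pos_pos) auto
    have "d * sin d * (- cos (p + q)) < d * sin d * (r / 2)"
      using r d sd by (intro mult_strict_left_mono) auto
    also have "\<dots> \<le> 2 * C * (r / 2)"
      unfolding C using one_minus_cos_ge[OF d] rp by (intro mult_right_mono) (auto simp: d_def)
    finally show ?thesis unfolding R r_def by (simp add: mult.commute)
  qed
  then have "cp * cq * (b - a) * stiffness p q > (cq - cp) * drift p q" using E by simp
  moreover have "1 / cp - 1 / cq = (cq - cp) / (cp * cq)" using c by (simp add: field_simps)
  ultimately show ?thesis unfolding defs using c s by (simp add: field_simps)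
qed

section \<open>The interaction of arcs\<close>

text \<open>The potential at \<open>sin p\<close> of the semicircle law restricted to
  \<open>[sin q, 1]\<close>, as \<open>nn_integral_riesz_right\<close> confirms. By reflection,
  \<open>arc_potential (- q) (- p)\<close> is the potential at \<open>sin q\<close> of
  \<open>[-1, sin p]\<close>.\<close>

definition arc_potential :: "real \<Rightarrow> real \<Rightarrow> real" where
  "arc_potential p q = 2 / pi * (cos p * log_kernel p q - cos q - sin p * (pi / 2 - q))"

definition sin_primitive :: "real \<Rightarrow> real" where
  "sin_primitive p = sin p - (sin p) ^ 3 / 3"

text \<open>The antiderivative of \<open>(2 / \<pi>) cos\<^sup>2 p\<close> times \<open>arc_potential p q\<close> that vanishes at
  \<open>p = - \<pi> / 2\<close>.\<close>

definition arc_interaction :: "real \<Rightarrow> real \<Rightarrow> real" where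
  "arc_interaction p q = 4 / pi\<^sup>2 * ((sin_primitive p - sin_primitive q) * log_kernel p q
     + ((pi / 2 - q) * cos p ^ 3 + (pi / 2 + p) * cos q ^ 3) / 3
     + cos p * cos q * (sin q - sin p) / 3)"

lemma log_kernel_minus: "log_kernel (- q) (- p) = log_kernel p q"
proof -
  have "(- q + - p) / 2 = - ((p + q) / 2)" "(- p - - q) / 2 = (q - p) / 2" by argo+
  then show ?thesis unfolding log_kernel_def by (simp only: cos_minus)
qed

lemma log_kernel_right: 
  assumes "-(pi/2) \<le> p" "p < pi/2"
  shows "log_kernel p (pi/2) = 0"
proof -
  have e: "(p + pi/2) / 2 = pi/2 - (pi/2 - p) / 2" by argo
  have "cos ((p + pi/2) / 2) = sin ((pi/2 - p) / 2)" unfolding e by (simp only: cos_diff) simp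
  then show ?thesis unfolding log_kernel_def using half_angle_pos[of p "pi/2"] assms by simp
qed

lemma arc_potential_right: 
  "-(pi/2) \<le> p \<Longrightarrow> p < pi/2 \<Longrightarrow> arc_potential p (pi/2) = 0"
  by (simp add: arc_potential_def log_kernel_right)

lemma DERIV_arc_potential_right:
  assumes "-(pi/2) \<le> p" "p < q" "q \<le> pi/2"
  shows "((\<lambda>q. - arc_potential p q) has_real_derivative
           2 / pi * (cos q)\<^sup>2 / (sin q - sin p)) (at q within A)"
proof -
  have s: "sin p < sin q" using assms by (intro sin_less) auto
  have L: "((\<lambda>q. log_kernel p q) has_real_derivative (cos q * 0 - cos p * 1) / (sin q - sin p)) (at q within A)"
    by (rule DERIV_log_kernel[OF assms, of "\<lambda>_. p" _ _ _ "\<lambda>q. q"]) auto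
  have "((\<lambda>q. - arc_potential p q) has_real_derivative
           - (2 / pi * (cos p * ((cos q * 0 - cos p * 1) / (sin q - sin p)) - (- sin q) - sin p * (0 - 1)))) (at q within A)"
    unfolding arc_potential_def by (intro derivative_intros L) (auto intro!: derivative_eq_intros L)
  also have "cos p * ((cos q * 0 - cos p * 1) / (sin q - sin p)) - (- sin q) - sin p * (0 - 1)
     = ((sin q)\<^sup>2 - (sin p)\<^sup>2 - (cos p)\<^sup>2) / (sin q - sin p)"
    using s by (simp add: divide_simps power2_eq_square) (simp add: algebra_simps)
  also have "(sin q)\<^sup>2 - (sin p)\<^sup>2 - (cos p)\<^sup>2 = - ((cos q)\<^sup>2)"
    by (simp add: sin_squared_eq)
  finally show ?thesis by simp
qed

lemma arc_potential_nonneg: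
  assumes "-(pi/2) \<le> p" "p < q" "q \<le> pi/2"
  shows "arc_potential p q \<ge> 0"
proof -
  have "- arc_potential p q \<le> - arc_potential p (pi/2)"
  proof (rule DERIV_nonneg_imp_nondecreasing[OF assms(3)])
    fix x assume x: "q \<le> x" "x \<le> pi/2"
    then have "sin p < sin x" using assms by (intro sin_less) auto
    then have "2 / pi * (cos x)\<^sup>2 / (sin x - sin p) \<ge> 0" by simp
    moreover have "((\<lambda>q. - arc_potential p q) has_real_derivative 2 / pi * (cos x)\<^sup>2 / (sin x - sin p)) (at x)"
      using x assms by (intro DERIV_arc_potential_right) simp_all
    ultimately show "\<exists>y. ((\<lambda>q. - arc_potential p q) has_real_derivative y) (at x) \<and> y \<ge> 0"
      by blast
  qed
  then show ?thesis using arc_potential_right[of p] assms by simp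
qed

text \<open>Moving \<open>p\<close> adds mass at \<open>sin p\<close>, which interacts with
  \<open>[sin q, 1]\<close>; moving \<open>q\<close> to the right removes mass at
  \<open>sin q\<close>, which interacted with \<open>[-1, sin p]\<close>. Both ends depend on
  \<open>t\<close>, so that the rule serves integration in \<open>p\<close> with \<open>q\<close>
  fixed as well as the motion of an arc.\<close>

lemma DERIV_arc_interaction:
  assumes pq: "-(pi/2) \<le> p0" "p0 < q0" "q0 \<le> pi/2"
    and P: "(p has_real_derivative p') (at t within A)"
    and Q: "(q has_real_derivative q') (at t within A)"
    and [simp]: "p t = p0" "q t = q0"
  shows "((\<lambda>t. arc_interaction (p t) (q t)) has_real_derivative
           2 / pi * (cos p0)\<^sup>2 * arc_potential p0 q0 * p'
         - 2 / pi * (cos q0)\<^sup>2 * arc_potential (- q0) (- p0) * q') (at t within A)"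
proof -
  define a b c d L where "a = sin p0" and "b = sin q0" and "c = cos p0" and "d = cos q0"
    and "L = log_kernel p0 q0"
  note defs = a_def[symmetric] b_def[symmetric] c_def[symmetric] d_def[symmetric] L_def[symmetric]
  have s: "b - a > 0" using pq sin_less[of p0 q0] by (simp add: a_def b_def)
  have sq: "a\<^sup>2 = 1 - c\<^sup>2" "b\<^sup>2 = 1 - d\<^sup>2" by (simp_all add: a_def b_def c_def d_def sin_squared_eq)
  have g0: "(sin_primitive has_real_derivative cos x ^ 3) (at x)" for x
  proof -
    have "(sin_primitive has_real_derivative cos x - (3 * (sin x)\<^sup>2 * cos x) / 3) (at x)"
      unfolding sin_primitive_def by (auto intro!: derivative_eq_intros)
    also have "cos x - (3 * (sin x)\<^sup>2 * cos x) / 3 = cos x * (1 - (sin x)\<^sup>2)"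
      by (simp add: algebra_simps)
    also have "1 - (sin x)\<^sup>2 = (cos x)\<^sup>2" by (simp add: sin_squared_eq)
    finally show ?thesis by (simp add: power2_eq_square power3_eq_cube mult.assoc)
  qed
  have cube: "((\<lambda>x. cos x ^ 3) has_real_derivative - (3 * (cos x)\<^sup>2 * sin x)) (at x)" for x :: real
    by (auto intro!: derivative_eq_intros)
  note G = DERIV_chain2[OF g0 P, unfolded \<open>p t = p0\<close> defs] DERIV_chain2[OF g0 Q, unfolded \<open>q t = q0\<close> defs]
  note L' = DERIV_log_kernel[OF pq P Q \<open>p t = p0\<close> \<open>q t = q0\<close>, unfolded defs]
  note C = DERIV_chain2[OF cube P, unfolded \<open>p t = p0\<close> defs] DERIV_chain2[OF cube Q, unfolded \<open>q t = q0\<close> defs]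
  note C' = DERIV_chain2[OF DERIV_cos P, unfolded \<open>p t = p0\<close> defs] DERIV_chain2[OF DERIV_cos Q, unfolded \<open>q t = q0\<close> defs]
     DERIV_chain2[OF DERIV_sin P, unfolded \<open>p t = p0\<close> defs] DERIV_chain2[OF DERIV_sin Q, unfolded \<open>q t = q0\<close> defs]
  define X where "X = sin_primitive p0 - sin_primitive q0"
  have X: "X = - (b - a) * (1 - (a\<^sup>2 + a * b + b\<^sup>2) / 3)"
    unfolding X_def sin_primitive_def defs by (simp add: field_simps power2_eq_square power3_eq_cube)
  have "((\<lambda>t. arc_interaction (p t) (q t)) has_real_derivative
     4 / pi\<^sup>2 * (((c ^ 3 * p' - d ^ 3 * q') * L + X * ((d * p' - c * q') / (b - a)))
     + ((- q' * c ^ 3 + (pi / 2 - q0) * (- (3 * c\<^sup>2 * a * p'))) + (p' * d ^ 3 + (pi / 2 + p0) * (- (3 * d\<^sup>2 * b * q')))) / 3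
     + ((- a * p' * d + c * (- b * q')) * (b - a) + c * d * (d * q' - c * p')) / 3)) (at t within A)"
    unfolding arc_interaction_def
    by (rule DERIV_cong, rule DERIV_cmult[OF DERIV_add[OF DERIV_add[OF DERIV_mult[OF DERIV_diff[OF G] L']
          DERIV_cdivide[OF DERIV_add[OF DERIV_mult[OF DERIV_diff[OF DERIV_const Q] C(1)]
              DERIV_mult[OF DERIV_add[OF DERIV_const P] C(2)]]]]
          DERIV_cdivide[OF DERIV_mult[OF DERIV_mult[OF C'(1,2)] DERIV_diff[OF C'(4,3)]]]]])
       (simp add: defs X_def mult.commute add.commute)
  also have "X * ((d * p' - c * q') / (b - a)) = - (1 - (a\<^sup>2 + a * b + b\<^sup>2) / 3) * (d * p' - c * q')"
    (is "_ = - ?Y * ?Z")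
  proof -
    have "(- (b - a) * Y) * (Z / (b - a)) = - Y * Z" for Y Z using s by (simp add: divide_simps) (simp add: algebra_simps)
    then show ?thesis unfolding X .
  qed
  also have "4 / pi\<^sup>2 * (((c ^ 3 * p' - d ^ 3 * q') * L + - (1 - (a\<^sup>2 + a * b + b\<^sup>2) / 3) * (d * p' - c * q'))
     + ((- q' * c ^ 3 + (pi / 2 - q0) * (- (3 * c\<^sup>2 * a * p'))) + (p' * d ^ 3 + (pi / 2 + p0) * (- (3 * d\<^sup>2 * b * q')))) / 3
     + ((- a * p' * d + c * (- b * q')) * (b - a) + c * d * (d * q' - c * p')) / 3)
     = 4 / pi\<^sup>2 * (c\<^sup>2 * (c * L - d - a * (pi/2 - q0)) * p' - d\<^sup>2 * (d * L - c + b * (pi/2 + p0)) * q')"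
    (is "_ * ?l = _ * ?r")
  proof -
    \<comment> \<open>The factor 3 clears the denominators; apart from rearrangement the identity is
      \<open>sin\<^sup>2 = 1 - cos\<^sup>2\<close> at both angles.\<close>
    have "3 * ?l = 3 * (c ^ 3 * p' - d ^ 3 * q') * L - (3 - a\<^sup>2 - a * b - b\<^sup>2) * (d * p' - c * q')
      + ((- q' * c ^ 3 + (pi / 2 - q0) * (- (3 * c\<^sup>2 * a * p'))) + (p' * d ^ 3 + (pi / 2 + p0) * (- (3 * d\<^sup>2 * b * q'))))
      + ((- a * p' * d + c * (- b * q')) * (b - a) + c * d * (d * q' - c * p'))"
      by (simp add: field_simps)
    also have "\<dots> = 3 * (c ^ 3 * p' - d ^ 3 * q') * L 
      + (pi / 2 - q0) * (- (3 * c\<^sup>2 * a * p')) + (pi / 2 + p0) * (- (3 * d\<^sup>2 * b * q'))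
      + p' * d * (- 3 + 2 * a\<^sup>2 + b\<^sup>2 + d\<^sup>2 - c\<^sup>2) + q' * c * (3 - a\<^sup>2 - 2 * b\<^sup>2 - c\<^sup>2 + d\<^sup>2)"
      by (simp add: algebra_simps power2_eq_square power3_eq_cube)
    also have "\<dots> = 3 * ?r" unfolding sq by (simp add: algebra_simps power2_eq_square power3_eq_cube)
    finally have "3 * ?l = 3 * ?r" .
    then have "?l = ?r" by (rule mult_left_cancel[THEN iffD1, rotated]) simp
    then show ?thesis by (rule arg_cong)
  qed
  also have "\<dots> = 2 / pi * c\<^sup>2 * (2 / pi * (c * L - d - a * (pi/2 - q0))) * p'
       - 2 / pi * d\<^sup>2 * (2 / pi * (d * L - c + b * (pi/2 + p0))) * q'" (is "_ = ?R")
  proof -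
    have "4 / pi\<^sup>2 * (c\<^sup>2 * V * p' - d\<^sup>2 * W * q') = 2 / pi * c\<^sup>2 * (2 / pi * V) * p' - 2 / pi * d\<^sup>2 * (2 / pi * W) * q'"
      for V W by (simp add: power2_eq_square field_simps)
    then show ?thesis .
  qed
  also have "?R = 2 / pi * c\<^sup>2 * arc_potential p0 q0 * p' - 2 / pi * d\<^sup>2 * arc_potential (- q0) (- p0) * q'"
    unfolding arc_potential_def log_kernel_minus by (simp add: defs)
  finally show ?thesis unfolding defs .
qed

lemma arc_interaction_left: "-(pi/2) < q \<Longrightarrow> q \<le> pi/2 \<Longrightarrow> arc_interaction (-(pi/2)) q = 0"
proof -
  assume q: "-(pi/2) < q" "q \<le> pi/2"
  have "log_kernel (-(pi/2)) q = 0"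
    using log_kernel_right[of "-q"] log_kernel_minus[of "pi/2" "-q"] log_kernel_minus[of "q" "-(pi/2)"] 
      log_kernel_minus[of "-(pi/2)" q] q by simp
  then show ?thesis by (simp add: arc_interaction_def)
qed

text \<open>The logarithm diverges on the diagonal, but its coefficient is at most
  \<open>4 * D\<close> with \<open>D = sin ((q - p) / 2)\<close>, and
  \<open>ln (1 / D) = 2 * ln (1 / sqrt D)\<close> is below \<open>2 / sqrt D\<close>, so the product
  is at most \<open>8 * sqrt D\<close>. Of the other terms \<open>pi * cos p ^ 3 / 3\<close>
  survives, and the prefactor turns it into half the profile.\<close>

lemma tendsto_arc_interaction_diagonal:
  assumes "-(pi/2) < p" "p < pi/2"
  shows "((\<lambda>q. arc_interaction p q) \<longlongrightarrow> angle_profile p / 2) (at_right p)"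
proof -
  have 1: "((\<lambda>q. (sin_primitive p - sin_primitive q) * log_kernel p q) \<longlongrightarrow> 0) (at_right p)"
  proof (rule Lim_null_comparison)
    have "((\<lambda>q. 8 * sqrt (sin ((q - p) / 2))) \<longlongrightarrow> 8 * sqrt (sin ((p - p) / 2))) (at_right p)"
      by (intro tendsto_intros) auto
    then show "((\<lambda>q. 8 * sqrt (sin ((q - p) / 2))) \<longlongrightarrow> 0) (at_right p)" by simp
    have "norm ((sin_primitive p - sin_primitive q) * log_kernel p q) \<le> 8 * sqrt (sin ((q - p) / 2))"
      if q: "p < q" "q < pi/2" for q
    proof -
      define C D where "C = cos ((p + q) / 2)" and "D = sin ((q - p) / 2)"
      have pos: "C > 0" "D > 0" using half_angle_pos[of p q] assms q by (auto simp: C_def D_def)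
      have C1: "C \<le> 1" by (simp add: C_def)
      have L0: "log_kernel p q > 0" using log_kernel_pos assms q by simp
      have "log_kernel p q = ln (C / D)" by (simp add: log_kernel_def C_def D_def)
      also have "\<dots> \<le> ln (1 / D)" using pos C1 by (simp add: divide_right_mono)
      also have "\<dots> = 2 * ln (1 / sqrt D)" using pos by (simp add: ln_div ln_sqrt)
      also have "\<dots> \<le> 2 * (1 / sqrt D)" using pos by (intro mult_left_mono less_imp_le[OF ln_less_self]) auto
      finally have "D * log_kernel p q \<le> D * (2 * (1 / sqrt D))" using pos by (intro mult_left_mono) auto
      also have "\<dots> = 2 * (D / sqrt D)" by simp
      also have "\<dots> = 2 * sqrt D" using pos by (simp only: real_div_sqrt less_imp_le)
      finally have DL: "D * log_kernel p q \<le> 2 * sqrt D" .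
      have "sin_primitive p - sin_primitive q 
         = - (sin q - sin p) * (1 - ((sin p)\<^sup>2 + sin p * sin q + (sin q)\<^sup>2) / 3)"
        unfolding sin_primitive_def by (simp add: field_simps power2_eq_square power3_eq_cube)
      also have "sin q - sin p = 2 * D * C" unfolding C_def D_def by (rule sin_diff_half)
      finally have "\<bar>sin_primitive p - sin_primitive q\<bar>
         = 2 * D * C * \<bar>1 - ((sin p)\<^sup>2 + sin p * sin q + (sin q)\<^sup>2) / 3\<bar>"
        using pos by (simp add: abs_mult)
      also have "\<dots> \<le> 2 * D * 1 * 2"
      proof (intro mult_mono)
        have "(sin p)\<^sup>2 \<le> 1" "(sin q)\<^sup>2 \<le> 1" by (simp_all add: abs_square_le_1)
        moreover have "\<bar>sin p * sin q\<bar> \<le> 1 * 1" unfolding abs_mult by (intro mult_mono) auto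
        moreover have "(sin p)\<^sup>2 \<ge> 0" "(sin q)\<^sup>2 \<ge> 0" by simp_all
        ultimately show "\<bar>1 - ((sin p)\<^sup>2 + sin p * sin q + (sin q)\<^sup>2) / 3\<bar> \<le> 2" unfolding abs_le_iff by argo
      qed (use pos C1 in auto)
      finally have "\<bar>sin_primitive p - sin_primitive q\<bar> * log_kernel p q \<le> 4 * D * log_kernel p q"
        using L0 by (intro mult_right_mono) auto
      also have "\<dots> \<le> 8 * sqrt D" using DL by simp
      finally show ?thesis using L0 by (simp add: abs_mult D_def)
    qed
    then show "\<forall>\<^sub>F q in at_right p. norm ((sin_primitive p - sin_primitive q) * log_kernel p q) \<le> 8 * sqrt (sin ((q - p) / 2))"
      unfolding eventually_at_right[OF assms(2)] using assms(2) by blast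
  qed
  have 2: "((\<lambda>q. ((pi / 2 - q) * cos p ^ 3 + (pi / 2 + p) * cos q ^ 3) / 3
     + cos p * cos q * (sin q - sin p) / 3) \<longlongrightarrow> 
     ((pi / 2 - p) * cos p ^ 3 + (pi / 2 + p) * cos p ^ 3) / 3
     + cos p * cos p * (sin p - sin p) / 3) (at_right p)"
    by (intro tendsto_intros) auto
  have "((\<lambda>q. arc_interaction p q) \<longlongrightarrow> 4 / pi\<^sup>2 * (0 +
     (((pi / 2 - p) * cos p ^ 3 + (pi / 2 + p) * cos p ^ 3) / 3
     + cos p * cos p * (sin p - sin p) / 3))) (at_right p)"
    unfolding arc_interaction_def add.assoc by (rule tendsto_mult_left[OF tendsto_add[OF 1 2]])
  moreover have "4 / pi\<^sup>2 * (0 + (((pi / 2 - p) * cos p ^ 3 + (pi / 2 + p) * cos p ^ 3) / 3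
     + cos p * cos p * (sin p - sin p) / 3)) = angle_profile p / 2"
    by (simp add: angle_profile_def power2_eq_square field_simps)
  ultimately show ?thesis by (simp only:)
qed

section \<open>The semicircle law and its interactions on Borel sets\<close>

definition semicircle_density :: "real \<Rightarrow> real" where
  "semicircle_density x = 2 / pi * indicator {-1..1} x * sqrt (1 - x\<^sup>2)"

lemma semicircle_density_measurable [measurable]: "semicircle_density \<in> borel_measurable borel"
  unfolding semicircle_density_def by measurable

lemma semicircle_density_nonneg: "semicircle_density x \<ge> 0"
  unfolding semicircle_density_def by (auto simp: indicator_def abs_square_le_1)

text \<open>On the Borel sets, products with itself and with \<open>lborel\<close> carry the usual
  measurability rules for kernels and Fubini's theorem. Lebesgue-measurable sets are reached at the
  end, by a change on a null set.\<close>

definition semicircle_borel :: "real measure" where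
  "semicircle_borel = density lborel (\<lambda>x. ennreal (semicircle_density x))"

lemma sets_semicircle_borel [simp, measurable_cong]: "sets semicircle_borel = sets borel"
  by (simp add: semicircle_borel_def)

lemma space_semicircle_borel [simp]: "space semicircle_borel = UNIV"
  by (simp add: semicircle_borel_def)

lemma nn_integral_semicircle_borel_density:
  assumes [measurable]: "f \<in> borel_measurable borel"
  shows "(\<integral>\<^sup>+x. f x \<partial>semicircle_borel) = (\<integral>\<^sup>+x. ennreal (semicircle_density x) * f x \<partial>lborel)"
  unfolding semicircle_borel_def by (subst nn_integral_density) auto

lemma borel_imp_lebesgue_measurable:
  "f \<in> borel_measurable borel \<Longrightarrow> f \<in> borel_measurable lebesgue" for f :: "real \<Rightarrow> 'a::topological_space"
  by (rule measurable_completion) simp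

lemma semicircle_eq_density: "semicircle = density lebesgue (\<lambda>x. ennreal (semicircle_density x))"
  by (simp add: semicircle_def semicircle_density_def)

lemma nn_integral_semicircle:
  assumes [measurable]: "f \<in> borel_measurable borel"
  shows "(\<integral>\<^sup>+x. f x \<partial>semicircle) = (\<integral>\<^sup>+x. f x \<partial>semicircle_borel)"
proof -
  have "(\<integral>\<^sup>+x. f x \<partial>semicircle) = (\<integral>\<^sup>+x. ennreal (semicircle_density x) * f x \<partial>lebesgue)"
    unfolding semicircle_eq_density
    by (intro nn_integral_density borel_imp_lebesgue_measurable) auto
  then show ?thesis by (simp add: nn_integral_completion nn_integral_semicircle_borel_density)
qed

text \<open>Under the substitution \<open>x = sin t\<close> the square root in the density
  contributes one factor \<open>cos t\<close> and the Jacobian the other.\<close>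

lemma nn_integral_semicircle_angle:
  assumes [measurable]: "f \<in> borel_measurable borel"
    and pq: "-(pi/2) \<le> p" "p \<le> q" "q \<le> pi/2"
  shows "(\<integral>\<^sup>+x. f x * indicator {sin p..sin q} x \<partial>semicircle_borel) =
         (\<integral>\<^sup>+t. f (sin t) * ennreal (2 / pi * (cos t)\<^sup>2) * indicator {p..q} t \<partial>lborel)"
\<comment> \<open>The substitution is carried out on a proper interval; in the degenerate case both
  sides are integrals over a single point.\<close>
proof (cases "p = q")
  case True
  have "AE x in lborel. ennreal (semicircle_density x) * (f x * indicator {sin p..sin q} x) = 0"
    by (rule eventually_mono[OF AE_lborel_singleton[of "sin p"]]) (auto simp: True split: split_indicator)
  moreover have "AE x in lborel. f (sin x) * ennreal (2 / pi * (cos x)\<^sup>2) * indicator {p..q} x = 0"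
    by (rule eventually_mono[OF AE_lborel_singleton[of p]]) (auto simp: True split: split_indicator)
  ultimately have "(\<integral>\<^sup>+x. ennreal (semicircle_density x) * (f x * indicator {sin p..sin q} x) \<partial>lborel) = 0"
     "(\<integral>\<^sup>+x. f (sin x) * ennreal (2 / pi * (cos x)\<^sup>2) * indicator {p..q} x \<partial>lborel) = 0"
    by (simp_all add: nn_integral_0_iff_AE)
  then show ?thesis by (subst nn_integral_semicircle_borel_density) auto
next
  case False
  then have "p < q" using pq by simp
  have "(\<integral>\<^sup>+x. f x * indicator {sin p..sin q} x \<partial>semicircle_borel) =
      (\<integral>\<^sup>+x. (f x * ennreal (semicircle_density x)) * indicator {sin p..sin q} x \<partial>lborel)"
    by (subst nn_integral_semicircle_borel_density) (auto simp: mult_ac)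
  also have "\<dots> = (\<integral>\<^sup>+x. (f (sin x) * ennreal (semicircle_density (sin x))) * ennreal (cos x) * indicator {p..q} x \<partial>lborel)"
    using pq \<open>p < q\<close>
    by (intro nn_integral_substitution_aux continuous_intros) (auto intro!: DERIV_sin cos_ge_zero)
  also have "\<dots> = (\<integral>\<^sup>+t. f (sin t) * ennreal (2 / pi * (cos t)\<^sup>2) * indicator {p..q} t \<partial>lborel)"
  proof (intro nn_integral_cong)
    fix t
    show "f (sin t) * ennreal (semicircle_density (sin t)) * ennreal (cos t) * indicator {p..q} t
        = f (sin t) * ennreal (2 / pi * (cos t)\<^sup>2) * indicator {p..q} t"
    proof (cases "t \<in> {p..q}")
      case True
      then have c: "cos t \<ge> 0" using pq by (intro cos_ge_zero) auto
      have "semicircle_density (sin t) = 2 / pi * cos t"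
      proof -
        have "1 - (sin t)\<^sup>2 = (cos t)\<^sup>2" by (simp add: cos_squared_eq)
        then show ?thesis using c unfolding semicircle_density_def by simp
      qed
      then have "ennreal (semicircle_density (sin t)) * ennreal (cos t) = ennreal (2 / pi * (cos t)\<^sup>2)"
        using c by (simp add: ennreal_mult[symmetric] power2_eq_square)
      then show ?thesis by (simp add: mult.assoc)
    qed simp
  qed
  finally show ?thesis .
qed

lemma AE_semicircle_borel:
  "AE x in semicircle_borel. -1 < x \<and> x < 1"
proof -
  have "AE x in lborel. x \<noteq> (-1::real)" "AE x in lborel. x \<noteq> (1::real)" by (rule AE_lborel_singleton)+
  then have "AE x in lborel. 0 < ennreal (semicircle_density x) \<longrightarrow> -1 < x \<and> x < 1"
    by eventually_elim (auto simp: semicircle_density_def indicator_def split: if_splits)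
  then show ?thesis unfolding semicircle_borel_def by (subst AE_density) auto
qed

lemma AE_semicircle_borel_singleton: "AE x in semicircle_borel. x \<noteq> c"
proof -
  have "AE x in lborel. x \<noteq> c" by (rule AE_lborel_singleton)
  then have "AE x in lborel. 0 < ennreal (semicircle_density x) \<longrightarrow> x \<noteq> c" by eventually_elim auto
  then show ?thesis unfolding semicircle_borel_def by (subst AE_density) auto
qed

lemma nn_integral_weight_Icc:
  assumes "p \<le> q"
  shows "(\<integral>\<^sup>+t. ennreal (2 / pi * (cos t)\<^sup>2) * indicator {p..q} t \<partial>lborel) = ennreal (angle_cdf q - angle_cdf p)"
  using assms by (intro nn_integral_FTC_Icc DERIV_angle_cdf) auto

lemma emeasure_semicircle_borel_Icc:
  assumes "-(pi/2) \<le> p" "p \<le> q" "q \<le> pi/2"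
  shows "emeasure semicircle_borel {sin p..sin q} = ennreal (angle_cdf q - angle_cdf p)"
proof -
  have "emeasure semicircle_borel {sin p..sin q} = (\<integral>\<^sup>+x. 1 * indicator {sin p..sin q} x \<partial>semicircle_borel)"
    by simp
  also have "\<dots> = (\<integral>\<^sup>+t. 1 * ennreal (2 / pi * (cos t)\<^sup>2) * indicator {p..q} t \<partial>lborel)"
    by (rule nn_integral_semicircle_angle) (use assms in auto)
  finally show ?thesis using nn_integral_weight_Icc[OF assms(2)] by simp
qed

lemma emeasure_semicircle_borel_UNIV: "emeasure semicircle_borel UNIV = 1"
proof -
  have "emeasure semicircle_borel UNIV = emeasure semicircle_borel {sin (-(pi/2))..sin (pi/2)}"
    by (intro emeasure_eq_AE eventually_mono[OF AE_semicircle_borel]) auto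
  also have "\<dots> = 1" by (subst emeasure_semicircle_borel_Icc) auto
  finally show ?thesis .
qed

interpretation semicircle_borel: finite_measure semicircle_borel
  by (rule finite_measureI) (simp add: emeasure_semicircle_borel_UNIV)

interpretation semicircle_pair: pair_sigma_finite semicircle_borel semicircle_borel
  by unfold_locales

text \<open>On the diagonal the density is \<open>1 / 0 = 0\<close>; the diagonal is a null set anyway.\<close>

definition riesz_measure :: "(real \<times> real) measure" where
  "riesz_measure = density (semicircle_borel \<Otimes>\<^sub>M semicircle_borel) (\<lambda>z. ennreal (1 / \<bar>fst z - snd z\<bar>))"

text \<open>Written as the measure of a rectangle, so that additivity and monotonicity in each
  argument, and continuity along increasing sets, are those of a measure.\<close>

definition interaction :: "real set \<Rightarrow> real set \<Rightarrow> ennreal" where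
  "interaction A B = emeasure riesz_measure (A \<times> B)"

text \<open>The complement is that of the whole line, which makes the symmetry between a set and its
  complement literal; the law gives no mass to the outside of \<open>[-1,1]\<close>.\<close>

definition perimeter :: "real set \<Rightarrow> ennreal" where
  "perimeter A = interaction A (- A)"

lemma sets_riesz_measure [simp, measurable_cong]:
  "sets riesz_measure = sets (semicircle_borel \<Otimes>\<^sub>M semicircle_borel)"
  by (simp add: riesz_measure_def)

lemma interaction_eq:
  assumes [measurable]: "A \<in> sets borel" "B \<in> sets borel"
  shows "interaction A B = 
    (\<integral>\<^sup>+x. (\<integral>\<^sup>+y. ennreal (1 / \<bar>x - y\<bar>) * indicator B y \<partial>semicircle_borel) * indicator A x \<partial>semicircle_borel)"
proof -
  have "interaction A B = (\<integral>\<^sup>+z. ennreal (1 / \<bar>fst z - snd z\<bar>) * indicator (A \<times> B) z 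
      \<partial>(semicircle_borel \<Otimes>\<^sub>M semicircle_borel))"
    unfolding interaction_def riesz_measure_def by (subst emeasure_density) auto
  also have "\<dots> = (\<integral>\<^sup>+x. (\<integral>\<^sup>+y. ennreal (1 / \<bar>x - y\<bar>) * indicator (A \<times> B) (x, y) \<partial>semicircle_borel) \<partial>semicircle_borel)"
    by (subst semicircle_borel.nn_integral_fst[symmetric]) auto
  also have "\<dots> = (\<integral>\<^sup>+x. (\<integral>\<^sup>+y. ennreal (1 / \<bar>x - y\<bar>) * indicator B y * indicator A x \<partial>semicircle_borel) \<partial>semicircle_borel)"
    by (intro nn_integral_cong) (auto split: split_indicator)
  also have "\<dots> = (\<integral>\<^sup>+x. (\<integral>\<^sup>+y. ennreal (1 / \<bar>x - y\<bar>) * indicator B y \<partial>semicircle_borel) * indicator A x \<partial>semicircle_borel)"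
    by (intro nn_integral_cong nn_integral_multc) auto
  finally show ?thesis .
qed

lemma interaction_commute:
  assumes [measurable]: "A \<in> sets borel" "B \<in> sets borel"
  shows "interaction A B = interaction B A"
proof -
  have "interaction A B = (\<integral>\<^sup>+x. (\<integral>\<^sup>+y. ennreal (1 / \<bar>x - y\<bar>) * indicator B y * indicator A x \<partial>semicircle_borel) \<partial>semicircle_borel)"
    unfolding interaction_eq[OF assms] by (intro nn_integral_cong nn_integral_multc[symmetric]) auto
  also have "\<dots> = (\<integral>\<^sup>+y. (\<integral>\<^sup>+x. ennreal (1 / \<bar>x - y\<bar>) * indicator B y * indicator A x \<partial>semicircle_borel) \<partial>semicircle_borel)"
    by (rule semicircle_pair.Fubini') simp
  also have "\<dots> = (\<integral>\<^sup>+y. (\<integral>\<^sup>+x. ennreal (1 / \<bar>y - x\<bar>) * indicator A x * indicator B y \<partial>semicircle_borel) \<partial>semicircle_borel)"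
    by (simp add: abs_minus_commute mult_ac)
  also have "\<dots> = interaction B A"
    unfolding interaction_eq[OF assms(2,1)] by (intro nn_integral_cong nn_integral_multc) auto
  finally show ?thesis .
qed

lemma interaction_Un_right:
  assumes "A \<in> sets borel" "B \<in> sets borel" "C \<in> sets borel" "B \<inter> C = {}"
  shows "interaction A (B \<union> C) = interaction A B + interaction A C"
  unfolding interaction_def Sigma_Un_distrib2 using assms
  by (intro plus_emeasure[symmetric]) auto

lemma interaction_Un_left:
  assumes "A \<in> sets borel" "B \<in> sets borel" "C \<in> sets borel" "A \<inter> B = {}"
  shows "interaction (A \<union> B) C = interaction A C + interaction B C"
  unfolding interaction_def Sigma_Un_distrib1 using assms
  by (intro plus_emeasure[symmetric]) auto

lemma interaction_mono:
  assumes "A' \<in> sets borel" "B' \<in> sets borel" "A \<subseteq> A'" "B \<subseteq> B'"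
  shows "interaction A B \<le> interaction A' B'"
  unfolding interaction_def using assms by (intro emeasure_mono) auto

lemma interaction_cong_AE:
  assumes [measurable]: "A \<in> sets borel" "A' \<in> sets borel" "B \<in> sets borel" "B' \<in> sets borel"
    and A: "AE x in semicircle_borel. x \<in> A \<longleftrightarrow> x \<in> A'" and B: "AE x in semicircle_borel. x \<in> B \<longleftrightarrow> x \<in> B'"
  shows "interaction A B = interaction A' B'"
proof -
  have "(\<integral>\<^sup>+y. ennreal (1 / \<bar>x - y\<bar>) * indicator B y \<partial>semicircle_borel) 
      = (\<integral>\<^sup>+y. ennreal (1 / \<bar>x - y\<bar>) * indicator B' y \<partial>semicircle_borel)" for x
    using B by (intro nn_integral_cong_AE) (auto elim!: eventually_mono split: split_indicator)
  then show ?thesis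
    unfolding interaction_eq[OF assms(1,3)] interaction_eq[OF assms(2,4)] using A
    by (intro nn_integral_cong_AE) (auto elim!: eventually_mono split: split_indicator)
qed

lemma perimeter_cong_AE:
  assumes "A \<in> sets borel" "A' \<in> sets borel" "AE x in semicircle_borel. x \<in> A \<longleftrightarrow> x \<in> A'"
  shows "perimeter A = perimeter A'"
  unfolding perimeter_def using assms
  by (intro interaction_cong_AE) (auto elim!: eventually_mono)

lemma perimeter_Compl: "A \<in> sets borel \<Longrightarrow> perimeter (- A) = perimeter A"
  unfolding perimeter_def by (simp add: interaction_commute)

section \<open>Explicit potentials and interactions of half-lines\<close>

lemma nn_integral_riesz_right:
  assumes "-(pi/2) \<le> s" "s < q" "q \<le> pi/2"
  shows "(\<integral>\<^sup>+y. ennreal (1 / \<bar>sin s - y\<bar>) * indicator {sin q..} y \<partial>semicircle_borel) = ennreal (arc_potential s q)"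
proof -
  have "(\<integral>\<^sup>+y. ennreal (1 / \<bar>sin s - y\<bar>) * indicator {sin q..} y \<partial>semicircle_borel)
     = (\<integral>\<^sup>+y. ennreal (1 / \<bar>sin s - y\<bar>) * indicator {sin q..sin (pi/2)} y \<partial>semicircle_borel)"
    by (intro nn_integral_cong_AE eventually_mono[OF AE_semicircle_borel]) (auto split: split_indicator)
  also have "\<dots> = (\<integral>\<^sup>+t. ennreal (1 / \<bar>sin s - sin t\<bar>) * ennreal (2 / pi * (cos t)\<^sup>2) * indicator {q..pi/2} t \<partial>lborel)"
    by (rule nn_integral_semicircle_angle) (use assms in auto)
  also have "\<dots> = (\<integral>\<^sup>+t. ennreal (2 / pi * (cos t)\<^sup>2 / (sin t - sin s)) * indicator {q..pi/2} t \<partial>lborel)"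
  proof (intro nn_integral_cong)
    fix t show "ennreal (1 / \<bar>sin s - sin t\<bar>) * ennreal (2 / pi * (cos t)\<^sup>2) * indicator {q..pi/2} t
      = ennreal (2 / pi * (cos t)\<^sup>2 / (sin t - sin s)) * indicator {q..pi/2} t"
    proof (cases "t \<in> {q..pi/2}")
      case True
      then have "sin s < sin t" using assms by (intro sin_less) auto
      then have "1 / \<bar>sin s - sin t\<bar> * (2 / pi * (cos t)\<^sup>2) = 2 / pi * (cos t)\<^sup>2 / (sin t - sin s)" by simp
      then show ?thesis by (simp only: ennreal_mult[symmetric] abs_ge_zero zero_le_divide_1_iff zero_le_power2
          mult_nonneg_nonneg pi_ge_zero zero_le_numeral divide_nonneg_nonneg)
    qed simp
  qed
  also have "\<dots> = ennreal (- arc_potential s (pi/2) - - arc_potential s q)"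
  proof (intro nn_integral_FTC_Icc)
    fix t assume t: "t \<in> {q..pi/2}"
    then have "sin s < sin t" using assms by (intro sin_less) auto
    then show "0 \<le> 2 / pi * (cos t)\<^sup>2 / (sin t - sin s)" by simp
    show "((\<lambda>q. - arc_potential s q) has_real_derivative 2 / pi * (cos t)\<^sup>2 / (sin t - sin s)) (at t)"
      using t assms by (intro DERIV_arc_potential_right) auto
  qed (use assms in auto)
  finally show ?thesis using arc_potential_right[of s] assms by simp
qed

lemma interaction_arcs:
  assumes "-(pi/2) \<le> p" "p < q" "q \<le> pi/2"
  shows "interaction {..sin p} {sin q..} = ennreal (arc_interaction p q)"
proof -
  have [measurable]: "(\<lambda>s. arc_potential s q) \<in> borel_measurable borel"
    unfolding arc_potential_def log_kernel_def by measurable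
  let ?f = "\<lambda>x. \<integral>\<^sup>+y. ennreal (1 / \<bar>x - y\<bar>) * indicator {sin q..} y \<partial>semicircle_borel"
  have "interaction {..sin p} {sin q..} = (\<integral>\<^sup>+x. ?f x * indicator {..sin p} x \<partial>semicircle_borel)"
    by (rule interaction_eq) auto
  also have "\<dots> = (\<integral>\<^sup>+x. ?f x * indicator {sin (-(pi/2))..sin p} x \<partial>semicircle_borel)"
    by (intro nn_integral_cong_AE eventually_mono[OF AE_semicircle_borel]) (auto split: split_indicator)
  also have "\<dots> = (\<integral>\<^sup>+s. ?f (sin s) * ennreal (2 / pi * (cos s)\<^sup>2) * indicator {-(pi/2)..p} s \<partial>lborel)"
    by (rule nn_integral_semicircle_angle) (use assms in auto)
  also have "\<dots> = (\<integral>\<^sup>+s. ennreal (2 / pi * (cos s)\<^sup>2 * arc_potential s q) * indicator {-(pi/2)..p} s \<partial>lborel)"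
  proof (intro nn_integral_cong)
    fix s show "?f (sin s) * ennreal (2 / pi * (cos s)\<^sup>2) * indicator {-(pi/2)..p} s
      = ennreal (2 / pi * (cos s)\<^sup>2 * arc_potential s q) * indicator {-(pi/2)..p} s"
    proof (cases "s \<in> {-(pi/2)..p}")
      case True
      then have "-(pi/2) \<le> s" "s < q" using assms by auto
      then show ?thesis using nn_integral_riesz_right[of s q] arc_potential_nonneg[of s q] assms
        by (simp add: ennreal_mult[symmetric] mult_ac)
    qed simp
  qed
  also have "\<dots> = ennreal (arc_interaction p q - arc_interaction (-(pi/2)) q)"
  proof (intro nn_integral_FTC_Icc)
    fix s assume s: "s \<in> {-(pi/2)..p}"
    then show "0 \<le> 2 / pi * (cos s)\<^sup>2 * arc_potential s q"
      using assms by (intro mult_nonneg_nonneg arc_potential_nonneg) auto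
    have "((\<lambda>s. arc_interaction s q) has_real_derivative 2 / pi * (cos s)\<^sup>2 * arc_potential s q * 1
         - 2 / pi * (cos q)\<^sup>2 * arc_potential (- q) (- s) * 0) (at s)"
      using s assms by (intro DERIV_arc_interaction DERIV_ident DERIV_const) auto
    then show "((\<lambda>s. arc_interaction s q) has_real_derivative 2 / pi * (cos s)\<^sup>2 * arc_potential s q) (at s)"
      by simp
  qed (use assms in auto)
  finally show ?thesis using arc_interaction_left[of q] assms by simp
qed

text \<open>The closed formula holds for separated half-lines only, since the logarithm is singular
  for \<open>q = p\<close>. Opening the right half-line up to \<open>sin p\<close> gives increasing
  rectangles, so the interaction is the limit on the diagonal. If \<open>p\<close> is an end point,
  one of the half-lines is a null set.\<close>

lemma interaction_half_lines:
  assumes "-(pi/2) \<le> p" "p \<le> pi/2"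
  shows "interaction {..sin p} {sin p<..} = ennreal (angle_profile p / 2)"
proof -
  consider "p = -(pi/2)" | "p = pi/2" | "-(pi/2) < p" "p < pi/2" using assms by force
  then show ?thesis
  proof cases
    case 1
    have "interaction {..sin p} {sin p<..} = interaction {} {sin p<..}"
      by (intro interaction_cong_AE eventually_mono[OF AE_semicircle_borel]) (auto simp: 1)
    then show ?thesis by (simp add: interaction_def angle_profile_def 1)
  next
    case 2
    have "interaction {..sin p} {sin p<..} = interaction {..sin p} {}"
      by (intro interaction_cong_AE eventually_mono[OF AE_semicircle_borel]) (auto simp: 2)
    then show ?thesis by (simp add: interaction_def angle_profile_def 2)
  next
    case 3
    \<comment> \<open>A sequence decreasing to \<open>p\<close> that stays above \<open>p\<close>
      and starts at \<open>pi/2\<close>; its monotonicity makes the rectangles increase.\<close>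
    define q where "q n = p + (pi/2 - p) / real (Suc n)" for n
    have q: "p < q n" "q n \<le> pi/2" for n
      using 3 mult_left_mono[of 1 "1 + real n" "pi/2 - p"] by (auto simp: q_def field_simps)
    have qdec: "q n \<le> q m" if "m \<le> n" for m n
      unfolding q_def using 3 that by (intro add_left_mono divide_left_mono) auto
    have "(\<lambda>n. p + (pi/2 - p) * inverse (real (Suc n))) \<longlonglongrightarrow> p + (pi/2 - p) * 0"
      by (intro tendsto_intros LIMSEQ_inverse_real_of_nat)
    moreover have "q = (\<lambda>n. p + (pi/2 - p) * inverse (real (Suc n)))"
      by (rule ext) (simp only: q_def divide_inverse)
    ultimately have qlim: "q \<longlonglongrightarrow> p" by simp
    have "\<forall>\<^sub>F n in sequentially. q n \<in> {p<..} \<and> q n \<noteq> p"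
      using q(1) by (intro always_eventually) (auto simp: less_imp_neq[symmetric])
    then have "filterlim q (at_right p) sequentially"
      using qlim unfolding filterlim_at by blast
    from filterlim_compose[OF tendsto_arc_interaction_diagonal[OF 3] this]
    have "(\<lambda>n. ennreal (arc_interaction p (q n))) \<longlonglongrightarrow> ennreal (angle_profile p / 2)"
      by (rule tendsto_ennrealI)
    moreover have "(\<lambda>n. emeasure riesz_measure ({..sin p} \<times> {sin (q n)..})) 
        \<longlonglongrightarrow> emeasure riesz_measure (\<Union>n. {..sin p} \<times> {sin (q n)..})"
    proof (intro Lim_emeasure_incseq)
      show "incseq (\<lambda>n. {..sin p} \<times> {sin (q n)..})"
      proof (intro incseq_SucI Sigma_mono order_refl atLeast_subset_iff[THEN iffD2] disjI2)
        show "sin (q (Suc n)) \<le> sin (q n)" for n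
          using q[of "Suc n"] q[of n] qdec[of n "Suc n"] 3 by (intro sin_monotone_2pi_le) auto
      qed
    qed auto
    moreover have "(\<Union>n. {..sin p} \<times> {sin (q n)..}) = {..sin p} \<times> {sin p<..}"
    proof -
      have "(\<Union>n. {sin (q n)..}) = {sin p<..}"
      proof (intro equalityI subsetI)
        fix x assume "x \<in> (\<Union>n. {sin (q n)..})"
        then obtain n where "sin (q n) \<le> x" by auto
        moreover have "sin p < sin (q n)" using q[of n] 3 by (intro sin_less) auto
        ultimately show "x \<in> {sin p<..}" by simp
      next
        fix x assume x: "x \<in> {sin p<..}"
        have "(\<lambda>n. sin (q n)) \<longlonglongrightarrow> sin p" by (intro tendsto_intros qlim)
        then have "\<forall>\<^sub>F n in sequentially. sin (q n) < x" using x by (intro order_tendstoD) auto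
        then show "x \<in> (\<Union>n. {sin (q n)..})" by (auto simp: eventually_sequentially intro: less_imp_le)
      qed
      then show ?thesis by auto
    qed
    ultimately show ?thesis
      using interaction_arcs[OF assms(1) q] unfolding interaction_def by (auto intro: LIMSEQ_unique)
  qed
qed

section \<open>Moving an arc of constant mass\<close>

text \<open>At an interior minimum \<open>D\<close> vanishes, so \<open>D\<close> is negative
  immediately to the right and \<open>F\<close> drops below its minimum. The sign of the second
  derivative is asked for at critical points alone, because the motion of an arc gives it only
  there.\<close>

lemma no_interior_min:
  fixes F D D' :: "real \<Rightarrow> real"
  assumes cont: "continuous_on {0..T} F"
    and F: "\<And>t. 0 < t \<Longrightarrow> t < T \<Longrightarrow> (F has_real_derivative D t) (at t)"
    and D: "\<And>t. 0 < t \<Longrightarrow> t < T \<Longrightarrow> (D has_real_derivative D' t) (at t)"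
    and neg: "\<And>t. 0 < t \<Longrightarrow> t < T \<Longrightarrow> D t = 0 \<Longrightarrow> D' t < 0"
    and t: "0 \<le> t" "t \<le> T"
  shows "min (F 0) (F T) \<le> F t"
proof -
  obtain s where s: "s \<in> {0..T}" "\<And>u. u \<in> {0..T} \<Longrightarrow> F s \<le> F u"
    using continuous_attains_inf[OF _ _ cont] t by fastforce
  have "s = 0 \<or> s = T"
  proof (rule ccontr)
    assume "\<not> ?thesis"
    then have s': "0 < s" "s < T" using s(1) by auto
    have "D s = 0"
    proof (rule DERIV_local_min[OF F[OF s']])
      show "0 < min s (T - s)" using s' by simp
      show "\<forall>y. \<bar>s - y\<bar> < min s (T - s) \<longrightarrow> F s \<le> F y"
        by (intro allI impI s(2)) auto
    qed
    then obtain d where d: "d > 0" "\<And>h. h > 0 \<Longrightarrow> h < d \<Longrightarrow> D (s + h) < 0"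
      using DERIV_neg_dec_right[OF D[OF s'] neg[OF s']] by auto
    obtain h where "0 < h" "h < d" "h < T - s"
      using field_lbound_gt_zero[of d "T - s"] d(1) s' by auto
    then have h: "0 < h" "h < d" "s + h < T" by auto
    have "F (s + h) < F s"
    proof (rule DERIV_neg_imp_decreasing_open[where f = F and a = s and b = "s + h"])
      show "s < s + h" using h by simp
      show "\<exists>y. (F has_real_derivative y) (at x) \<and> y < 0" if "s < x" "x < s + h" for x
      proof -
        have "D x < 0" using d(2)[of "x - s"] that h by simp
        then show ?thesis using F[of x] that h s' by (intro exI[of _ "D x"]) simp
      qed
      show "continuous_on {s..s + h} F" using h s' by (intro continuous_on_subset[OF cont]) auto
    qed
    moreover have "F s \<le> F (s + h)" using h s' by (intro s(2)) auto
    ultimately show False by simp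
  qed
  then show ?thesis using s(2)[of t] t by auto
qed

section \<open>Interaction with a set lying to the right, through its Cauchy transform\<close>

definition cauchy_transform :: "real set \<Rightarrow> real \<Rightarrow> real" where
  "cauchy_transform R x = (\<integral>y. indicator R y / (y - x) \<partial>semicircle_borel)"

definition cauchy_transform' :: "real set \<Rightarrow> real \<Rightarrow> real" where
  "cauchy_transform' R x = (\<integral>y. indicator R y / (y - x)\<^sup>2 \<partial>semicircle_borel)"

context
  fixes R :: "real set" and e :: real
  assumes R [measurable]: "R \<in> sets borel" and Re: "R \<subseteq> {e<..}"
begin

lemma integrable_cauchy_kernels:
  assumes "x < e"
  shows "integrable semicircle_borel (\<lambda>y. indicator R y / (y - x))"
    "integrable semicircle_borel (\<lambda>y. indicator R y / (y - x)\<^sup>2)"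
proof -
  have "norm (indicator R y / (y - x)) \<le> 1 / (e - x)" for y
    using assms Re by (auto simp: indicator_def intro!: divide_left_mono mult_pos_pos)
  then show "integrable semicircle_borel (\<lambda>y. indicator R y / (y - x))"
    by (intro semicircle_borel.integrable_const_bound[of _ "1 / (e - x)"]) auto
  have "norm (indicator R y / (y - x)\<^sup>2) \<le> 1 / (e - x)\<^sup>2" for y
    using assms Re by (auto simp: indicator_def intro!: divide_left_mono mult_pos_pos power_mono)
  then show "integrable semicircle_borel (\<lambda>y. indicator R y / (y - x)\<^sup>2)"
    by (intro semicircle_borel.integrable_const_bound[of _ "1 / (e - x)\<^sup>2"]) auto
qed

lemma cauchy_transform'_nonneg: "cauchy_transform' R x \<ge> 0"
  unfolding cauchy_transform'_def by (intro Bochner_Integration.integral_nonneg) auto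

lemma cauchy_transform_nonneg: "x \<le> e \<Longrightarrow> cauchy_transform R x \<ge> 0"
  unfolding cauchy_transform_def using Re
  by (intro Bochner_Integration.integral_nonneg) (auto simp: indicator_def)

lemma cauchy_transform'_mono:
  assumes "x \<le> z" "z < e"
  shows "cauchy_transform' R x \<le> cauchy_transform' R z"
  unfolding cauchy_transform'_def using assms Re
  by (intro integral_mono integrable_cauchy_kernels)
     (auto simp: indicator_def intro!: divide_left_mono mult_pos_pos power_mono)

text \<open>Convexity of the transform to the left of \<open>R\<close>: pointwise the difference of
  the kernels is \<open>(z - x) / ((y - z) * (y - x))\<close>, and \<open>y - z\<close> is at most
  \<open>y - x\<close>. This is the link by which the first derivative of the energy bounds the
  second.\<close>

lemma cauchy_transform_diff_ge:
  assumes "x < z" "z < e"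
  shows "(z - x) * cauchy_transform' R x \<le> cauchy_transform R z - cauchy_transform R x"
proof -
  have "(z - x) * cauchy_transform' R x = (\<integral>y. (z - x) * (indicator R y / (y - x)\<^sup>2) \<partial>semicircle_borel)"
    unfolding cauchy_transform'_def by (rule integral_mult_right_zero[symmetric])
  also have "\<dots> \<le> (\<integral>y. indicator R y / (y - z) - indicator R y / (y - x) \<partial>semicircle_borel)"
  proof (intro integral_mono Bochner_Integration.integrable_diff integrable_mult_right integrable_cauchy_kernels)
    fix y
    show "(z - x) * (indicator R y / (y - x)\<^sup>2) \<le> indicator R y / (y - z) - indicator R y / (y - x)"
    proof (cases "y \<in> R")
      case True
      then have y: "0 < y - z" "0 < y - x" "y - z \<le> y - x" using assms Re by auto
      have "(z - x) * (1 / ((y - x) * (y - x))) \<le> (z - x) * (1 / ((y - z) * (y - x)))"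
        using y assms by (intro mult_left_mono divide_left_mono mult_right_mono mult_pos_pos) auto
      also have "\<dots> = 1 / (y - z) - 1 / (y - x)" using y by (simp add: field_simps)
      finally show ?thesis using True by (simp add: power2_eq_square)
    qed simp
  qed (use assms in auto)
  also have "\<dots> = cauchy_transform R z - cauchy_transform R x"
    unfolding cauchy_transform_def using assms
    by (intro Bochner_Integration.integral_diff integrable_cauchy_kernels) auto
  finally show ?thesis .
qed

text \<open>The difference quotient of the kernel misses its derivative by
  \<open>h / ((y - (x + h)) * (y - x)\<^sup>2)\<close>. With \<open>d\<close> half the distance from
  \<open>x\<close> to \<open>e\<close> and \<open>\<bar>h\<bar> < d\<close>, every factor of the
  denominator exceeds \<open>d\<close>, and the law has total mass 1.\<close>

lemma DERIV_cauchy_transform: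
  assumes "x < e"
  shows "(cauchy_transform R has_real_derivative cauchy_transform' R x) (at x)"
proof -
  define d where "d = (e - x) / 2"
  have d: "d > 0" "x + d < e" using assms by (auto simp: d_def field_simps)
  have bound: "\<bar>(cauchy_transform R (x + h) - cauchy_transform R x) / h - cauchy_transform' R x\<bar> \<le> \<bar>h\<bar> * (1 / d ^ 3)"
    if h: "h \<noteq> 0" "\<bar>h\<bar> < d" for h
  proof -
    have xh: "x + h < e" using d h by auto
    note int = integrable_cauchy_kernels[OF assms] integrable_cauchy_kernels[OF xh]
    have "(cauchy_transform R (x + h) - cauchy_transform R x) / h - cauchy_transform' R x
       = (\<integral>y. (indicator R y / (y - (x + h)) - indicator R y / (y - x)) / h - indicator R y / (y - x)\<^sup>2 \<partial>semicircle_borel)"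
      by (simp only: cauchy_transform_def cauchy_transform'_def integral_divide_zero
          Bochner_Integration.integral_diff[OF integrable_divide[OF Bochner_Integration.integrable_diff[OF int(3,1)]] int(2)]
          Bochner_Integration.integral_diff[OF int(3,1)])
    then have "\<bar>(cauchy_transform R (x + h) - cauchy_transform R x) / h - cauchy_transform' R x\<bar> = norm (\<integral>y. (indicator R y / (y - (x + h)) - indicator R y / (y - x)) / h - indicator R y / (y - x)\<^sup>2 \<partial>semicircle_borel)"
      by simp
    also have "\<dots> \<le> (\<integral>y. \<bar>h\<bar> * (1 / d ^ 3) \<partial>semicircle_borel)"
    proof (rule Bochner_Integration.integral_norm_bound_integral)
      show "integrable semicircle_borel (\<lambda>y. (indicator R y / (y - (x + h)) - indicator R y / (y - x)) / h - indicator R y / (y - x)\<^sup>2)"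
        using int by (intro Bochner_Integration.integrable_diff integrable_divide)
      fix y
      show "norm ((indicator R y / (y - (x + h)) - indicator R y / (y - x)) / h - indicator R y / (y - x)\<^sup>2) \<le> \<bar>h\<bar> * (1 / d ^ 3)"
      proof (cases "y \<in> R")
        case True
        then have y: "d \<le> y - (x + h)" "d \<le> y - x" using Re h d by (auto simp: d_def field_simps) 
        then have y0: "0 < y - (x + h)" "0 < y - x" using d by auto
        have "(1 / A - 1 / B) / h - 1 / B\<^sup>2 = h * (1 / (A * (B * B)))" if "A > 0" "B > 0" "A = B - h" for A B
        proof -
          have "(1 / A - 1 / B) / h = 1 / (A * B)" using that h by (simp add: divide_simps)
          also have "\<dots> - 1 / B\<^sup>2 = h * (1 / (A * (B * B)))"
            using that(1,2) unfolding that(3) by (simp add: divide_simps power2_eq_square)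
          finally show ?thesis .
        qed
        from this[OF y0]
        have "(1 / (y - (x + h)) - 1 / (y - x)) / h - 1 / (y - x)\<^sup>2 = h * (1 / ((y - (x + h)) * ((y - x) * (y - x))))"
          by simp
        moreover have "\<bar>h * (1 / ((y - (x + h)) * ((y - x) * (y - x))))\<bar> \<le> \<bar>h\<bar> * (1 / d ^ 3)"
          unfolding abs_mult power3_eq_cube using y y0 d
          by (intro mult_left_mono) (auto simp: abs_mult mult.assoc intro!: divide_left_mono mult_mono mult_pos_pos)
        ultimately show ?thesis using True by simp
      qed (use d in simp)
    qed simp
    also have "\<dots> = \<bar>h\<bar> * (1 / d ^ 3)"
      using emeasure_semicircle_borel_UNIV by (simp add: measure_def)
    finally show ?thesis by simp
  qed
  have "((\<lambda>h. (cauchy_transform R (x + h) - cauchy_transform R x) / h - cauchy_transform' R x) \<longlongrightarrow> 0) (at 0)"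
  proof (rule Lim_null_comparison)
    show "\<forall>\<^sub>F h in at 0. norm ((cauchy_transform R (x + h) - cauchy_transform R x) / h - cauchy_transform' R x) \<le> \<bar>h\<bar> * (1 / d ^ 3)"
      unfolding eventually_at using bound d by (intro exI[of _ d]) (auto simp: dist_norm)
    have "((\<lambda>h. \<bar>h\<bar> * (1 / d ^ 3)) \<longlongrightarrow> \<bar>0\<bar> * (1 / d ^ 3)) (at 0)" by (intro tendsto_intros)
    then show "((\<lambda>h. \<bar>h\<bar> * (1 / d ^ 3)) \<longlongrightarrow> 0) (at 0)" by simp
  qed
  then show ?thesis unfolding DERIV_def by (rule LIM_zero_cancel)
qed

lemma nn_integral_cauchy_kernel:
  assumes "x < e"
  shows "(\<integral>\<^sup>+y. ennreal (1 / \<bar>x - y\<bar>) * indicator R y \<partial>semicircle_borel) = ennreal (cauchy_transform R x)"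
proof -
  have "(\<integral>\<^sup>+y. ennreal (1 / \<bar>x - y\<bar>) * indicator R y \<partial>semicircle_borel) 
      = (\<integral>\<^sup>+y. ennreal (indicator R y / (y - x)) \<partial>semicircle_borel)"
    using assms Re by (intro nn_integral_cong) (auto simp: indicator_def)
  also have "\<dots> = ennreal (cauchy_transform R x)"
    unfolding cauchy_transform_def using assms Re
    by (intro nn_integral_eq_integral integrable_cauchy_kernels AE_I2) (auto simp: indicator_def)
  finally show ?thesis .
qed

end

context
  fixes R :: "real set" and c :: real
  assumes R: "R \<in> sets borel" and Rc: "R \<subseteq> {sin c<..}" and c: "-(pi/2) < c" "c \<le> pi/2"
begin

text \<open>The half-line may reach up to \<open>sin c\<close> and touch \<open>R\<close>; two
  complementary half-lines still have finite interaction, and they dominate.\<close>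

lemma interaction_finite:
  assumes "p \<in> {-(pi/2)..c}"
  shows "interaction {..sin p} R < \<infinity>"
proof -
  have "sin p \<le> sin c" using assms c by (intro sin_monotone_2pi_le) auto
  then have "interaction {..sin p} R \<le> interaction {..sin c} {sin c<..}"
    using Rc by (intro interaction_mono) auto
  also have "\<dots> < \<infinity>" using interaction_half_lines[of c] c by simp
  finally show ?thesis .
qed

text \<open>The rate at which the interaction of \<open>{..sin s}\<close> with \<open>R\<close>
  grows with \<open>s\<close>.\<close>

definition "outer_density s = 2 / pi * (cos s)\<^sup>2 * cauchy_transform R (sin s)"

lemma has_integral_interaction:
  assumes p: "p \<in> {-(pi/2)..c}"
  shows "(outer_density has_integral enn2real (interaction {..sin p} R)) {-(pi/2)..p}"
proof -
  note [measurable] = R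
  have [measurable]: "cauchy_transform R \<in> borel_measurable borel"
    unfolding cauchy_transform_def[abs_def] by measurable
  have m: "outer_density \<in> borel_measurable borel" unfolding outer_density_def[abs_def] by measurable
  let ?f = "\<lambda>x. \<integral>\<^sup>+y. ennreal (1 / \<bar>x - y\<bar>) * indicator R y \<partial>semicircle_borel"
  have nonneg: "outer_density s \<ge> 0" if "s \<in> {-(pi/2)..p}" for s
  proof -
    have "sin s \<le> sin c" using that p c by (intro sin_monotone_2pi_le) auto
    then show ?thesis unfolding outer_density_def
      by (intro mult_nonneg_nonneg cauchy_transform_nonneg[OF R Rc]) auto
  qed
  have "interaction {..sin p} R = (\<integral>\<^sup>+x. ?f x * indicator {..sin p} x \<partial>semicircle_borel)"
    by (rule interaction_eq) (use R in auto)
  also have "\<dots> = (\<integral>\<^sup>+x. ?f x * indicator {sin (-(pi/2))..sin p} x \<partial>semicircle_borel)"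
    by (intro nn_integral_cong_AE eventually_mono[OF AE_semicircle_borel]) (auto split: split_indicator)
  also have "\<dots> = (\<integral>\<^sup>+s. ?f (sin s) * ennreal (2 / pi * (cos s)\<^sup>2) * indicator {-(pi/2)..p} s \<partial>lborel)"
    by (rule nn_integral_semicircle_angle) (use p c in auto)
  also have "\<dots> = (\<integral>\<^sup>+s. ennreal (outer_density s * indicator {-(pi/2)..p} s) \<partial>lborel)"
  \<comment> \<open>At \<open>s = c\<close> the point may touch \<open>R\<close>, where the kernel
    need not be integrable and \<open>cauchy_transform\<close> may take the default value 0 of a
    divergent integral. A single point is negligible.\<close>
  proof (intro nn_integral_cong_AE eventually_mono[OF AE_lborel_singleton[of c]])
    fix s assume "s \<noteq> c"
    show "?f (sin s) * ennreal (2 / pi * (cos s)\<^sup>2) * indicator {-(pi/2)..p} s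
        = ennreal (outer_density s * indicator {-(pi/2)..p} s)"
    proof (cases "s \<in> {-(pi/2)..p}")
      case True
      then have "sin s < sin c" using \<open>s \<noteq> c\<close> p c by (intro sin_less) auto
      then have "?f (sin s) = ennreal (cauchy_transform R (sin s))" "cauchy_transform R (sin s) \<ge> 0"
        using nn_integral_cauchy_kernel[OF R Rc] cauchy_transform_nonneg[OF R Rc, of "sin s"] by auto
      then show ?thesis using True by (simp add: outer_density_def ennreal_mult[symmetric] mult_ac)
    qed simp
  qed
  finally have "(\<integral>\<^sup>+s. ennreal (outer_density s * indicator {-(pi/2)..p} s) \<partial>lborel)
     = ennreal (enn2real (interaction {..sin p} R))"
    using interaction_finite[OF p] by (simp add: less_top)
  then have "((\<lambda>s. outer_density s * indicator {-(pi/2)..p} s) has_integral enn2real (interaction {..sin p} R)) UNIV"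
    using nonneg m by (intro nn_integral_has_integral) (auto simp: indicator_def)
  moreover have "(\<lambda>s. outer_density s * indicator {-(pi/2)..p} s) = (\<lambda>s. if s \<in> {-(pi/2)..p} then outer_density s else 0)"
    by (auto simp: indicator_def)
  ultimately show ?thesis by (simp only: has_integral_restrict_UNIV)
qed

text \<open>Continuity has to include \<open>p = c\<close>, where \<open>outer_density\<close> may
  be unbounded; it follows from integrability of the density up to \<open>c\<close>.\<close>

lemma continuous_interaction:
  "continuous_on {-(pi/2)..c} (\<lambda>p. enn2real (interaction {..sin p} R))"
proof -
  have "outer_density integrable_on {-(pi/2)..c}"
    using has_integral_interaction[of c] c by (auto simp: integrable_on_def)
  then have "continuous_on {-(pi/2)..c} (\<lambda>p. integral {-(pi/2)..p} outer_density)"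
    by (rule indefinite_integral_continuous_1)
  then show ?thesis
    by (rule continuous_on_eq) (use has_integral_interaction in \<open>auto intro: integral_unique\<close>)
qed

lemma DERIV_interaction:
  assumes p: "-(pi/2) < p" "p < c"
  shows "((\<lambda>p. enn2real (interaction {..sin p} R)) has_real_derivative outer_density p) (at p)"
proof -
  have "sin p < sin c" using p c by (intro sin_less) auto
  then have "isCont (cauchy_transform R) (sin p)"
    by (rule DERIV_isCont[OF DERIV_cauchy_transform[OF R Rc]])
  then have "isCont (\<lambda>s. cauchy_transform R (sin s)) p"
    by (rule isCont_o2[OF DERIV_isCont[OF DERIV_sin]])
  then have co: "isCont outer_density p"
    unfolding outer_density_def[abs_def] by (intro continuous_intros)
  have "outer_density integrable_on {-(pi/2)..c}"
    using has_integral_interaction[of c] c by (auto simp: integrable_on_def)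
  then have "((\<lambda>p. integral {-(pi/2)..p} outer_density) has_vector_derivative outer_density p) (at p within {-(pi/2)..c})"
    using integral_has_vector_derivative_continuous_at[of outer_density "-(pi/2)" c p "{}"] p co
    by (auto intro: continuous_at_imp_continuous_at_within)
  then have "((\<lambda>p. integral {-(pi/2)..p} outer_density) has_real_derivative outer_density p) (at p)"
    using p by (simp add: has_real_derivative_iff_has_vector_derivative at_within_Icc_at)
  moreover have "\<forall>\<^sub>F x in nhds p. integral {-(pi/2)..x} outer_density = enn2real (interaction {..sin x} R)"
  proof -
    have "\<forall>\<^sub>F x in nhds p. x \<in> {-(pi/2)<..<c}" using p by (intro eventually_nhds_in_open) auto
    then show ?thesis
      by eventually_elim (use has_integral_interaction in \<open>auto intro!: integral_unique\<close>)
  qed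
  ultimately show ?thesis by (subst (asm) DERIV_cong_ev[OF refl _ refl]) auto
qed

end

text \<open>All terms are moved to the side where they are positive, so that the identity holds in
  \<open>[0,\<infinity>]\<close>.\<close>

lemma perimeter_arc_Un:
  assumes R: "R \<in> sets borel" "R \<subseteq> {b<..}" and "a \<le> b"
  shows "perimeter ({a<..b} \<union> R) + 2 * interaction {..a} {b<..} + 2 * interaction {..b} R
       = interaction {..a} {a<..} + interaction {..b} {b<..} + perimeter R + 2 * interaction {..a} R"
proof -
  \<comment> \<open>With \<open>R\<close> these are four disjoint blocks covering the line, and both
    sides expand into the same combination of their six pairwise interactions.\<close>
  define L I M where "L = {..a}" and "I = {a<..b}" and "M = {b<..} - R"
  have [simp]: "L \<in> sets borel" "I \<in> sets borel" "M \<in> sets borel" "R \<in> sets borel"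
    using R by (auto simp: L_def I_def M_def)
  have disj: "L \<inter> I = {}" "L \<inter> M = {}" "L \<inter> R = {}" "I \<inter> M = {}" "I \<inter> R = {}" "M \<inter> R = {}"
    "R \<inter> L = {}" "L \<inter> (I \<union> M) = {}" "I \<inter> (M \<union> R) = {}"
    using R \<open>a \<le> b\<close> by (auto simp: L_def I_def M_def)
  have sets: "- (I \<union> R) = L \<union> M" "{b<..} = M \<union> R" "{a<..} = I \<union> (M \<union> R)" "{..b} = L \<union> I" "- R = L \<union> (I \<union> M)"
    using R \<open>a \<le> b\<close> by (auto simp: L_def I_def M_def)
  define i where "i = interaction"
  have comm: "i R L = i L R" "i R I = i I R" "i R M = i M R" "i I L = i L I"
    unfolding i_def by (simp_all add: interaction_commute)
  have r: "i A (B \<union> C) = i A B + i A C" if "A \<in> sets borel" "B \<in> sets borel" "C \<in> sets borel" "B \<inter> C = {}" for A B C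
    unfolding i_def using that by (rule interaction_Un_right)
  have l: "i (A \<union> B) C = i A C + i B C" if "A \<in> sets borel" "B \<in> sets borel" "C \<in> sets borel" "A \<inter> B = {}" for A B C
    unfolding i_def using that by (rule interaction_Un_left)
  have "i (I \<union> R) (L \<union> M) = (i L I + i I M) + (i L R + i M R)"
    by (subst l) (use disj in \<open>auto simp: r comm\<close>)
  moreover have "i L (M \<union> R) = i L M + i L R" by (rule r) (use disj in auto)
  moreover have "i (L \<union> I) R = i L R + i I R" by (rule l) (use disj in auto)
  moreover have "i L (I \<union> (M \<union> R)) = i L I + (i L M + i L R)"
    by (subst r) (use disj in \<open>auto simp: r\<close>)
  moreover have "i (L \<union> I) (M \<union> R) = (i L M + i L R) + (i I M + i I R)"
    by (subst l) (use disj in \<open>auto simp: r\<close>)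
  moreover have "i R (L \<union> (I \<union> M)) = i L R + (i I R + i M R)"
    by (subst r) (use disj in \<open>auto simp: r comm\<close>)
  ultimately show ?thesis
    unfolding perimeter_def I_def[symmetric] L_def[symmetric] sets i_def[symmetric]
    by (simp only: mult_2 add_ac)
qed

lemma arc_interaction_nonneg:
  assumes "-(pi/2) \<le> p" "p < q" "q \<le> pi/2"
  shows "arc_interaction p q \<ge> 0"
proof -
  have "arc_interaction (-(pi/2)) q \<le> arc_interaction p q"
  proof (rule DERIV_nonneg_imp_nondecreasing[OF assms(1)])
    fix s assume s: "-(pi/2) \<le> s" "s \<le> p"
    have "((\<lambda>s. arc_interaction s q) has_real_derivative 2 / pi * (cos s)\<^sup>2 * arc_potential s q * 1
         - 2 / pi * (cos q)\<^sup>2 * arc_potential (- q) (- s) * 0) (at s)"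
      using s assms by (intro DERIV_arc_interaction DERIV_ident DERIV_const) auto
    moreover have "2 / pi * (cos s)\<^sup>2 * arc_potential s q * 1
         - 2 / pi * (cos q)\<^sup>2 * arc_potential (- q) (- s) * 0 \<ge> 0"
      using arc_potential_nonneg[of s q] s assms by simp
    ultimately show "\<exists>y. ((\<lambda>s. arc_interaction s q) has_real_derivative y) (at s) \<and> y \<ge> 0" by blast
  qed
  then show ?thesis using arc_interaction_left[of q] assms by simp
qed

lemma angle_profile_nonneg: "-(pi/2) \<le> p \<Longrightarrow> p \<le> pi/2 \<Longrightarrow> angle_profile p \<ge> 0"
  unfolding angle_profile_def by (intro mult_nonneg_nonneg zero_le_power cos_ge_zero) auto

lemma interaction_arcs_open:
  assumes "-(pi/2) \<le> p" "p < q" "q \<le> pi/2"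
  shows "interaction {..sin p} {sin q<..} = ennreal (arc_interaction p q)"
proof -
  have "interaction {..sin p} {sin q<..} = interaction {..sin p} {sin q..}"
    by (intro interaction_cong_AE eventually_mono[OF AE_semicircle_borel_singleton[of "sin q"]]) auto
  then show ?thesis using interaction_arcs[OF assms] by simp
qed

lemma continuous_on_arc_interaction:
  fixes S :: "real set"
  assumes "continuous_on S p" "continuous_on S q"
    and pq: "\<And>t. t \<in> S \<Longrightarrow> -(pi/2) \<le> p t \<and> p t < q t \<and> q t \<le> pi/2"
  shows "continuous_on S (\<lambda>t. arc_interaction (p t) (q t))"
proof -
  have "\<forall>t\<in>S. sin ((q t - p t) / 2) \<noteq> 0" "\<forall>t\<in>S. cos ((p t + q t) / 2) / sin ((q t - p t) / 2) \<noteq> 0"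
    using half_angle_pos pq by (metis less_irrefl divide_eq_0_iff)+
  moreover have "continuous_on S (\<lambda>t. cos ((p t + q t) / 2))" "continuous_on S (\<lambda>t. sin ((q t - p t) / 2))"
    using assms(1,2) by (auto intro!: continuous_intros)
  ultimately have "continuous_on S (\<lambda>t. log_kernel (p t) (q t))"
    unfolding log_kernel_def by (intro continuous_on_ln continuous_on_divide)
  then show ?thesis
    unfolding arc_interaction_def sin_primitive_def using assms by (intro continuous_intros) auto
qed

section \<open>The energy along the motion of an arc\<close>

context
  fixes R :: "real set" and c m :: real
  assumes R: "R \<in> sets borel" and Rc: "R \<subseteq> {sin c<..}" and c: "-(pi/2) < c" "c \<le> pi/2"
    and m: "0 < m" "m \<le> angle_cdf c"
begin

text \<open>The parameter is the mass to the left of the arc. The arc then keeps its mass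
  \<open>m\<close> by construction, and each end moves, in the angle, at the reciprocal of the
  density, which cancels the density in all derivatives.\<close>

definition "arc_left t = angle_quantile t"
definition "arc_right t = angle_quantile (t + m)"
definition "moving_arc t = {sin (arc_left t)<..sin (arc_right t)} \<union> R"
definition "outer_interaction p = enn2real (interaction {..sin p} R)"
text \<open>The identity \<open>perimeter_arc_Un\<close> solved for the perimeter in real numbers;
  it represents the perimeter as long as that of \<open>R\<close> is finite.\<close>

definition "moving_energy t = enn2real (perimeter R) + (angle_profile (arc_left t) + angle_profile (arc_right t)) / 2
   - 2 * arc_interaction (arc_left t) (arc_right t) - 2 * (outer_interaction (arc_right t) - outer_interaction (arc_left t))"

lemma arc_bounds:
  assumes "0 \<le> t" "t \<le> angle_cdf c - m"
  shows "-(pi/2) \<le> arc_left t" "arc_left t < arc_right t" "arc_right t \<le> c"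
proof -
  have 1: "angle_cdf c \<le> 1" using angle_cdf_mono[of c "pi/2"] c by simp
  show "-(pi/2) \<le> arc_left t"
    using angle_quantile_range[of t] assms m 1 by (simp add: arc_left_def)
  show "arc_left t < arc_right t" unfolding arc_left_def arc_right_def
    using assms m 1 by (intro angle_quantile_strict_mono) auto
  have "angle_quantile (t + m) \<le> angle_quantile (angle_cdf c)"
    using angle_quantile_strict_mono[of "t + m" "angle_cdf c"] assms m 1 by (cases "t + m = angle_cdf c") auto
  then show "arc_right t \<le> c" using angle_quantile_cdf[of c] c by (simp add: arc_right_def)
qed

text \<open>In \<open>perimeter_arc_Un\<close> everything added to the perimeter of the union is
  finite, so an infinite perimeter of \<open>R\<close> must reappear at every position of the
  arc.\<close>

lemma perimeter_moving_arc_infinite: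
  assumes t: "0 \<le> t" "t \<le> angle_cdf c - m" and "perimeter R = \<infinity>"
  shows "perimeter (moving_arc t) = \<infinity>"
proof -
  note b = arc_bounds[OF t]
  have s: "sin (arc_left t) \<le> sin (arc_right t)" "sin (arc_right t) \<le> sin c"
    using b c by (auto intro!: sin_monotone_2pi_le)
  have "perimeter (moving_arc t) + 2 * interaction {..sin (arc_left t)} {sin (arc_right t)<..} + 2 * interaction {..sin (arc_right t)} R = \<infinity>"
    unfolding moving_arc_def using s Rc assms by (subst perimeter_arc_Un[OF R]) auto
  moreover have "interaction {..sin (arc_right t)} R < \<infinity>"
    using b by (intro interaction_finite[OF R Rc c]) auto
  ultimately show ?thesis
    using interaction_arcs_open[of "arc_left t" "arc_right t"] b c 
    by (auto simp: ennreal_add_eq_top ennreal_mult_eq_top_iff)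
qed

lemma perimeter_moving_arc:
  assumes t: "0 \<le> t" "t \<le> angle_cdf c - m" and fin: "perimeter R < \<infinity>"
  shows "perimeter (moving_arc t) = ennreal (moving_energy t)"
proof -
  note b = arc_bounds[OF t]
  define p q where "p = arc_left t" and "q = arc_right t"
  have pq: "-(pi/2) \<le> p" "p < q" "q \<le> c" using b by (auto simp: p_def q_def)
  have s: "sin p \<le> sin q" "sin q \<le> sin c" using pq c by (auto intro!: sin_monotone_2pi_le)
  have h: "interaction {..sin r} R = ennreal (outer_interaction r)" if "r = p \<or> r = q" for r
    using interaction_finite[OF R Rc c, of r] that pq unfolding outer_interaction_def by (auto simp: less_top)
  have h0: "outer_interaction r \<ge> 0" for r unfolding outer_interaction_def by simp
  have K: "interaction {..sin p} {sin q<..} = ennreal (arc_interaction p q)" "arc_interaction p q \<ge> 0"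
    using interaction_arcs_open[of p q] arc_interaction_nonneg[of p q] pq c by auto
  have J: "interaction {..sin r} {sin r<..} = ennreal (angle_profile r / 2)" "angle_profile r / 2 \<ge> 0" if "r = p \<or> r = q" for r
    using interaction_half_lines[of r] angle_profile_nonneg[of r] pq c that by auto
  define PR where "PR = enn2real (perimeter R)"
  have PR: "perimeter R = ennreal PR" "PR \<ge> 0" using fin by (auto simp: PR_def less_top)
  have "perimeter (moving_arc t) + ennreal (2 * arc_interaction p q + 2 * outer_interaction q)
     = perimeter (moving_arc t) + 2 * interaction {..sin p} {sin q<..} + 2 * interaction {..sin q} R"
    using K h h0 by (simp add: ennreal_mult add.assoc)
  also have "\<dots> = interaction {..sin p} {sin p<..} + interaction {..sin q} {sin q<..} + perimeter R + 2 * interaction {..sin p} R"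
    unfolding moving_arc_def p_def[symmetric] q_def[symmetric] using s Rc
    by (intro perimeter_arc_Un R) auto
  also have "\<dots> = ennreal (angle_profile p / 2 + angle_profile q / 2 + PR + 2 * outer_interaction p)"
  proof -
    have "2 * interaction {..sin p} R = ennreal (2 * outer_interaction p)"
      using h[of p] h0[of p] by (simp add: ennreal_mult)
    then show ?thesis using J[of p] J[of q] PR h0[of p] by simp
  qed
  \<comment> \<open>Cancelling in \<open>[0,\<infinity>]\<close> is sound here because the
    subtracted quantity is a finite real.\<close>
  finally have "perimeter (moving_arc t) = ennreal (angle_profile p / 2 + angle_profile q / 2 + PR + 2 * outer_interaction p)
      - ennreal (2 * arc_interaction p q + 2 * outer_interaction q)"
    by (metis ennreal_add_diff_cancel_right ennreal_neq_top)
  also have "\<dots> = ennreal (angle_profile p / 2 + angle_profile q / 2 + PR + 2 * outer_interaction p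
      - (2 * arc_interaction p q + 2 * outer_interaction q))"
    using K h0 by (intro ennreal_minus) auto
  also have "angle_profile p / 2 + angle_profile q / 2 + PR + 2 * outer_interaction p
      - (2 * arc_interaction p q + 2 * outer_interaction q) = moving_energy t"
    unfolding moving_energy_def p_def[symmetric] q_def[symmetric] PR_def by (simp add: field_simps)
  finally show ?thesis .
qed

definition "moving_drift t = 2 * (2 / pi * drift (arc_left t) (arc_right t)
  - (cauchy_transform R (sin (arc_right t)) - cauchy_transform R (sin (arc_left t))))"

definition "moving_drift' t = - 2 * (stiffness (arc_left t) (arc_right t)
  + pi / 2 * (cauchy_transform' R (sin (arc_right t)) / cos (arc_right t) 
            - cauchy_transform' R (sin (arc_left t)) / cos (arc_left t)))"

context
  fixes t :: real
  assumes t: "0 < t" "t < angle_cdf c - m"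
begin

lemma arc_bounds_strict: "-(pi/2) < arc_left t" "arc_left t < arc_right t" "arc_right t < c" "cos (arc_left t) > 0" "cos (arc_right t) > 0"
  "sin (arc_left t) < sin (arc_right t)" "sin (arc_right t) < sin c"
proof -
  have 1: "angle_cdf c \<le> 1" using angle_cdf_mono[of c "pi/2"] c by simp
  show l: "-(pi/2) < arc_left t"
    using angle_quantile_interior[of t] t m 1 by (simp add: arc_left_def)
  show lr: "arc_left t < arc_right t" using arc_bounds t by simp
  have "angle_quantile (t + m) < angle_quantile (angle_cdf c)"
    using t m 1 by (intro angle_quantile_strict_mono) auto
  then show r: "arc_right t < c" using angle_quantile_cdf[of c] c by (simp add: arc_right_def)
  show "cos (arc_left t) > 0" "cos (arc_right t) > 0" using l lr r c by (auto intro!: cos_gt_zero_pi)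
  show "sin (arc_left t) < sin (arc_right t)" "sin (arc_right t) < sin c" using l lr r c by (auto intro!: sin_less)
qed

lemma DERIV_arc:
  "(arc_left has_real_derivative pi / (2 * (cos (arc_left t))\<^sup>2)) (at t)"
  "(arc_right has_real_derivative pi / (2 * (cos (arc_right t))\<^sup>2)) (at t)"
proof -
  have 1: "angle_cdf c \<le> 1" using angle_cdf_mono[of c "pi/2"] c by simp
  show "(arc_left has_real_derivative pi / (2 * (cos (arc_left t))\<^sup>2)) (at t)"
    unfolding arc_left_def[abs_def] using t m 1 by (intro DERIV_angle_quantile) auto
  have "((\<lambda>t. t + m) has_real_derivative 1) (at t)" by (auto intro!: derivative_eq_intros)
  from DERIV_chain2[OF DERIV_angle_quantile this]
  show "(arc_right has_real_derivative pi / (2 * (cos (arc_right t))\<^sup>2)) (at t)"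
    unfolding arc_right_def[abs_def] using t m 1 by simp
qed

text \<open>The densities cancel against the speeds of the ends: each half-line term contributes
  \<open>- 4 * sin\<close> of its angle before halving, and each interaction contributes a plain
  difference of potentials. The explicit terms sum to a multiple of \<open>drift\<close>.\<close>

lemma DERIV_moving_energy: "(moving_energy has_real_derivative moving_drift t) (at t)"
proof -
  define p q where "p = arc_left t" and "q = arc_right t"
  note b = arc_bounds_strict[folded p_def q_def]
  note P = DERIV_arc(1)[folded p_def] and Q = DERIV_arc(2)[folded q_def]
  have ne: "cos p \<noteq> 0" "cos q \<noteq> 0" using b by auto
  have prof: "((\<lambda>t. angle_profile (r t)) has_real_derivative - (4 * sin r0)) (at t)"
    if "(r has_real_derivative pi / (2 * (cos r0)\<^sup>2)) (at t)" "r t = r0" "cos r0 \<noteq> 0" for r r0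
    using DERIV_chain2[OF DERIV_angle_profile that(1)[folded that(2)]] that(2,3) by simp
  have K: "((\<lambda>t. arc_interaction (arc_left t) (arc_right t)) has_real_derivative
      arc_potential p q - arc_potential (- q) (- p)) (at t)"
  proof -
    have "((\<lambda>t. arc_interaction (arc_left t) (arc_right t)) has_real_derivative
      2 / pi * (cos p)\<^sup>2 * arc_potential p q * (pi / (2 * (cos p)\<^sup>2))
         - 2 / pi * (cos q)\<^sup>2 * arc_potential (- q) (- p) * (pi / (2 * (cos q)\<^sup>2))) (at t)"
      using b c by (intro DERIV_arc_interaction P Q) (auto simp: p_def q_def)
    then show ?thesis using ne by simp
  qed
  have outer: "((\<lambda>t. outer_interaction (r t)) has_real_derivative cauchy_transform R (sin r0)) (at t)"
    if "(r has_real_derivative pi / (2 * (cos r0)\<^sup>2)) (at t)" "r t = r0" "cos r0 \<noteq> 0" "-(pi/2) < r0" "r0 < c" for r r0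
  proof -
    have "(outer_interaction has_real_derivative 2 / pi * (cos r0)\<^sup>2 * cauchy_transform R (sin r0)) (at (r t))"
      unfolding outer_interaction_def[abs_def] using DERIV_interaction[OF R Rc c that(4,5)]
      by (simp add: outer_density_def[OF R Rc c] that(2))
    from DERIV_chain2[OF this that(1)] show ?thesis using that by simp
  qed
  have "(moving_energy has_real_derivative 0 + (- (4 * sin p) + - (4 * sin q)) / 2
     - 2 * (arc_potential p q - arc_potential (- q) (- p))
     - 2 * (cauchy_transform R (sin q) - cauchy_transform R (sin p))) (at t)"
    unfolding moving_energy_def[abs_def] using b ne
    by (intro DERIV_add DERIV_diff DERIV_const DERIV_cdivide DERIV_cmult prof K outer P Q) (auto simp: p_def q_def)
  moreover have "0 + (- (4 * sin p) + - (4 * sin q)) / 2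
     - 2 * (arc_potential p q - arc_potential (- q) (- p))
     - 2 * (cauchy_transform R (sin q) - cauchy_transform R (sin p)) = moving_drift t"
    unfolding moving_drift_def arc_potential_def drift_def log_kernel_minus p_def[symmetric] q_def[symmetric]
    by (simp add: field_simps)
  ultimately show ?thesis by simp
qed

lemma DERIV_drift: "((\<lambda>t. drift (arc_left t) (arc_right t)) has_real_derivative 
    - (pi / 2 * stiffness (arc_left t) (arc_right t))) (at t)"
proof -
  define p q where "p = arc_left t" and "q = arc_right t"
  note bb = arc_bounds_strict[folded p_def q_def]
  note P = DERIV_arc(1)[folded p_def] and Q = DERIV_arc(2)[folded q_def]
  define a b cp cq L where "a = sin p" and "b = sin q" and "cp = cos p" and "cq = cos q" and "L = log_kernel p q"
  note defs = a_def[symmetric] b_def[symmetric] cp_def[symmetric] cq_def[symmetric] L_def[symmetric]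
  define p' q' where "p' = pi / (2 * cp\<^sup>2)" and "q' = pi / (2 * cq\<^sup>2)"
  have pos: "cp > 0" "cq > 0" "b - a > 0" using bb by (auto simp: a_def b_def cp_def cq_def)
  have P: "(arc_left has_real_derivative p') (at t)" and Q: "(arc_right has_real_derivative q') (at t)"
    using P Q by (auto simp: p'_def q'_def cp_def cq_def)
  have L': "((\<lambda>t. log_kernel (arc_left t) (arc_right t)) has_real_derivative (cq * p' - cp * q') / (b - a)) (at t)"
    unfolding a_def b_def cp_def cq_def using bb c
    by (intro DERIV_log_kernel P Q) (auto simp: p_def q_def)
  have at: "arc_left t = p" "arc_right t = q" by (simp_all add: p_def q_def)
  note S = DERIV_chain2[OF DERIV_sin P, unfolded at defs] DERIV_chain2[OF DERIV_sin Q, unfolded at defs]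
  note C = DERIV_chain2[OF DERIV_cos P, unfolded at defs] DERIV_chain2[OF DERIV_cos Q, unfolded at defs]
  have "((\<lambda>t. drift (arc_left t) (arc_right t)) has_real_derivative
     (cq * q' * p + p' * b) - (cp * p' * q + q' * a)
     + ((0 + (cq * p' - cp * q') / (b - a)) * (cq - cp) + (- b * q' - - a * p') * (1 + L))) (at t)"
    unfolding drift_def
    by (rule DERIV_cong, rule DERIV_add[OF DERIV_diff[OF DERIV_mult[OF S(2) P] DERIV_mult[OF S(1) Q]]
         DERIV_mult[OF DERIV_add[OF DERIV_const L'] DERIV_diff[OF C(2,1)]]]) (simp add: at defs)
  also have "(cq * q' * p + p' * b) - (cp * p' * q + q' * a)
     + ((0 + (cq * p' - cp * q') / (b - a)) * (cq - cp) + (- b * q' - - a * p') * (1 + L)) = - (pi / 2 * stiffness p q)"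
  proof -
    define X where "X = (cq - cp)\<^sup>2 / (cp * cq * (b - a))"
    have sq: "b\<^sup>2 - a\<^sup>2 = cp\<^sup>2 - cq\<^sup>2" by (simp add: a_def b_def cp_def cq_def cos_squared_eq)
    \<comment> \<open>These are the terms that contain neither the bare angles nor the logarithm.
      The relation \<open>sq\<close> turns \<open>(a + b) * (b - a)\<close> into a difference of
      squared cosines, after which everything is rational in \<open>cp\<close>, \<open>cq\<close>
      and \<open>b - a\<close>.\<close>
    have key: "(a + b) * (1 / cp\<^sup>2 - 1 / cq\<^sup>2) + (cq / cp\<^sup>2 - cp / cq\<^sup>2) / (b - a) * (cq - cp) = - X"
    proof -
      have "(a + b) * (1 / cp\<^sup>2 - 1 / cq\<^sup>2) = (a + b) * (b - a) * (cq\<^sup>2 - cp\<^sup>2) / (cp\<^sup>2 * cq\<^sup>2 * (b - a))"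
        using pos by (simp add: divide_simps)
      also have "(a + b) * (b - a) = cp\<^sup>2 - cq\<^sup>2" using sq by (simp add: algebra_simps power2_eq_square)
      finally have 1: "(a + b) * (1 / cp\<^sup>2 - 1 / cq\<^sup>2) = (cp\<^sup>2 - cq\<^sup>2) * (cq\<^sup>2 - cp\<^sup>2) / (cp\<^sup>2 * cq\<^sup>2 * (b - a))" .
      have 2: "(cq / cp\<^sup>2 - cp / cq\<^sup>2) / (b - a) * (cq - cp) = (cq ^ 3 - cp ^ 3) * (cq - cp) / (cp\<^sup>2 * cq\<^sup>2 * (b - a))"
        using pos by (simp add: divide_simps power2_eq_square power3_eq_cube)
      have "(cp\<^sup>2 - cq\<^sup>2) * (cq\<^sup>2 - cp\<^sup>2) + (cq ^ 3 - cp ^ 3) * (cq - cp) = - ((cq - cp)\<^sup>2 * (cp * cq))"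
        by (simp add: algebra_simps power2_eq_square power3_eq_cube)
      then have "(a + b) * (1 / cp\<^sup>2 - 1 / cq\<^sup>2) + (cq / cp\<^sup>2 - cp / cq\<^sup>2) / (b - a) * (cq - cp)
         = - ((cq - cp)\<^sup>2 * (cp * cq)) / (cp\<^sup>2 * cq\<^sup>2 * (b - a))"
        unfolding 1 2 add_divide_distrib[symmetric] by simp
      also have "\<dots> = - X" unfolding X_def using pos by (simp add: power2_eq_square)
      finally show ?thesis .
    qed
    have p': "p' = pi / 2 * (1 / cp\<^sup>2)" "q' = pi / 2 * (1 / cq\<^sup>2)" by (simp_all add: p'_def q'_def)
    have "(cq * q' * p + p' * b) - (cp * p' * q + q' * a)
     + ((0 + (cq * p' - cp * q') / (b - a)) * (cq - cp) + (- b * q' - - a * p') * (1 + L))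
     = pi / 2 * ((p * (cq / cq\<^sup>2) - q * (cp / cp\<^sup>2)) + ((a + b) * (1 / cp\<^sup>2 - 1 / cq\<^sup>2) + (cq / cp\<^sup>2 - cp / cq\<^sup>2) / (b - a) * (cq - cp))
        - L * (b / cq\<^sup>2 - a / cp\<^sup>2))"
    proof -
      have gen: "(cq * (k * v) * p + (k * u) * b) - (cp * (k * u) * q + (k * v) * a)
         + ((0 + (cq * (k * u) - cp * (k * v)) * d) * (cq - cp) + (- b * (k * v) - - a * (k * u)) * (1 + L))
         = k * ((p * (cq * v) - q * (cp * u)) + ((a + b) * (u - v) + (cq * u - cp * v) * d * (cq - cp)) - L * (b * v - a * u))"
        for k u v d by (simp add: algebra_simps)
      show ?thesis unfolding p' using gen[of "pi/2" "1 / cq\<^sup>2" "1 / cp\<^sup>2" "1 / (b - a)"] by simp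
    qed
    also have "\<dots> = - (pi / 2 * stiffness p q)"
      unfolding key stiffness_def defs X_def[symmetric] using pos by (simp add: power2_eq_square field_simps)
    finally show ?thesis .
  qed
  finally show ?thesis by (simp only: at)
qed

lemma DERIV_moving_drift: "(moving_drift has_real_derivative moving_drift' t) (at t)"
proof -
  note b = arc_bounds_strict
  have tr: "((\<lambda>t. cauchy_transform R (sin (r t))) has_real_derivative pi / 2 * (cauchy_transform' R (sin (r t)) / cos (r t))) (at t)"
    if r: "(r has_real_derivative pi / (2 * (cos (r t))\<^sup>2)) (at t)" and "cos (r t) > 0" "sin (r t) < sin c" for r
  proof -
    have "((\<lambda>t. sin (r t)) has_real_derivative cos (r t) * (pi / (2 * (cos (r t))\<^sup>2))) (at t)"
      by (rule DERIV_chain2[OF DERIV_sin r])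
    from DERIV_chain2[OF DERIV_cauchy_transform[OF R Rc that(3)] this]
    show ?thesis using that(2) by (simp add: power2_eq_square mult_ac)
  qed
  have "(moving_drift has_real_derivative 2 * (2 / pi * (- (pi / 2 * stiffness (arc_left t) (arc_right t)))
     - (pi / 2 * (cauchy_transform' R (sin (arc_right t)) / cos (arc_right t))
      - pi / 2 * (cauchy_transform' R (sin (arc_left t)) / cos (arc_left t))))) (at t)"
    unfolding moving_drift_def[abs_def] using b
    by (intro DERIV_cmult DERIV_diff DERIV_drift tr DERIV_arc) auto
  then show ?thesis unfolding moving_drift'_def by (simp add: algebra_simps)
qed

text \<open>At a critical position the arc is at a strict maximum of the energy along the motion,
  whatever lies to its right.\<close>

lemma moving_drift'_neg:
  assumes "moving_drift t = 0"
  shows "moving_drift' t < 0"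
proof -
  define p q where "p = arc_left t" and "q = arc_right t"
  note b = arc_bounds_strict[folded p_def q_def]
  define F G where "F = cauchy_transform R" and "G = cauchy_transform' R"
  have G: "G (sin p) \<ge> 0" "G (sin p) \<le> G (sin q)" "(sin q - sin p) * G (sin p) \<le> F (sin q) - F (sin p)"
    unfolding F_def G_def using b
    by (auto intro!: cauchy_transform'_nonneg[OF R Rc] cauchy_transform'_mono[OF R Rc] cauchy_transform_diff_ge[OF R Rc])
  have crit: "F (sin q) - F (sin p) = 2 / pi * drift p q"
    using assms by (simp add: moving_drift_def F_def p_def q_def)
  have Gq: "G (sin p) / cos q \<le> G (sin q) / cos q" using G b by (intro divide_right_mono) auto
  have "stiffness p q + pi / 2 * (G (sin q) / cos q - G (sin p) / cos p) > 0"
  proof (cases "cos p < cos q")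
    case False
    \<comment> \<open>When the right end has the smaller cosine, the outer set also pushes in the
      favourable direction, since its transform has increasing slope.\<close>
    then have "G (sin p) / cos p \<le> G (sin p) / cos q" using b G by (intro divide_left_mono) auto
    then have "pi / 2 * (G (sin q) / cos q - G (sin p) / cos p) \<ge> 0" using Gq by (intro mult_nonneg_nonneg) auto
    moreover have "stiffness p q > 0" using b c by (intro stiffness_pos) auto
    ultimately show ?thesis by linarith
  next
    case True
    then have k: "1 / cos p - 1 / cos q \<ge> 0" using b by (simp add: frac_le)
    \<comment> \<open>The contribution of the outer set may now have the wrong sign. Its size is at
      most a multiple of \<open>G (sin p)\<close>, convexity bounds this by the difference quotient
      of \<open>F\<close>, and criticality replaces the quotient by \<open>drift\<close>.\<close>
    have "pi / 2 * (G (sin p) / cos p - G (sin q) / cos q) \<le> pi / 2 * (G (sin p) / cos p - G (sin p) / cos q)"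
      using Gq by (intro mult_left_mono) auto
    also have "\<dots> = pi / 2 * (1 / cos p - 1 / cos q) * G (sin p)" by (simp add: algebra_simps)
    also have "\<dots> \<le> pi / 2 * (1 / cos p - 1 / cos q) * ((F (sin q) - F (sin p)) / (sin q - sin p))"
      using G k b by (intro mult_left_mono) (auto simp: pos_le_divide_eq mult.commute)
    also have "\<dots> = (1 / cos p - 1 / cos q) / (sin q - sin p) * drift p q"
      unfolding crit by simp
    also have "\<dots> < stiffness p q" using b c True by (intro stiffness_gt_drift) auto
    finally show ?thesis by (simp add: right_diff_distrib)
  qed
  then show ?thesis unfolding moving_drift'_def F_def G_def p_def q_def by (rule mult_neg_pos[rotated]) simp
qed

end

lemma continuous_moving_energy: "continuous_on {0..angle_cdf c - m} moving_energy"
proof -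
  have 1: "angle_cdf c \<le> 1" using angle_cdf_mono[of c "pi/2"] c by simp
  have l: "continuous_on {0..angle_cdf c - m} arc_left" unfolding arc_left_def[abs_def]
    using m 1 by (intro continuous_on_subset[OF continuous_angle_quantile]) auto
  have r: "continuous_on {0..angle_cdf c - m} arc_right" unfolding arc_right_def[abs_def]
    using m 1 by (intro continuous_on_compose2[OF continuous_angle_quantile] continuous_intros) auto
  have b: "-(pi/2) \<le> arc_left t \<and> arc_left t < arc_right t \<and> arc_right t \<le> c" if "t \<in> {0..angle_cdf c - m}" for t
    using arc_bounds[of t] that by auto
  have h: "continuous_on {-(pi/2)..c} outer_interaction"
    unfolding outer_interaction_def[abs_def] by (rule continuous_interaction[OF R Rc c])
  have "continuous_on {0..angle_cdf c - m} (\<lambda>t. outer_interaction (arc_left t))"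
    by (rule continuous_on_compose2[OF h l]) (use b in \<open>force intro: less_imp_le\<close>)
  moreover have "continuous_on {0..angle_cdf c - m} (\<lambda>t. outer_interaction (arc_right t))"
    by (rule continuous_on_compose2[OF h r]) (use b in \<open>force intro: less_imp_le\<close>)
  moreover have "continuous_on {0..angle_cdf c - m} (\<lambda>t. arc_interaction (arc_left t) (arc_right t))"
    by (rule continuous_on_arc_interaction[OF l r]) (use b c in force)
  ultimately show ?thesis
    unfolding moving_energy_def[abs_def] angle_profile_def using l r by (intro continuous_intros) auto
qed

lemma perimeter_moving_arc_ge:
  assumes t: "0 \<le> t" "t \<le> angle_cdf c - m"
  shows "min (perimeter (moving_arc 0)) (perimeter (moving_arc (angle_cdf c - m))) \<le> perimeter (moving_arc t)"
proof (cases "perimeter R = \<infinity>")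
  case True
  then show ?thesis using perimeter_moving_arc_infinite[OF t] by simp
next
  case False
  then have fin: "perimeter R < \<infinity>" by (simp add: less_top)
  have "min (moving_energy 0) (moving_energy (angle_cdf c - m)) \<le> moving_energy t"
    by (rule no_interior_min[OF continuous_moving_energy DERIV_moving_energy DERIV_moving_drift moving_drift'_neg t])
  then have "moving_energy 0 \<le> moving_energy t \<or> moving_energy (angle_cdf c - m) \<le> moving_energy t" by auto
  then show ?thesis using t m
    by (auto simp: perimeter_moving_arc[OF _ _ fin] min_le_iff_disj intro: ennreal_leI)
qed

end

section \<open>Finite unions of intervals\<close>

definition profile :: "real \<Rightarrow> real" where
  "profile u = angle_profile (angle_quantile u)"

definition isoperimetric :: "real set \<Rightarrow> bool" where
  "isoperimetric X \<longleftrightarrow> ennreal (profile (measure semicircle_borel X)) \<le> 2 * perimeter X"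

lemma measure_semicircle_borel_UNIV: "measure semicircle_borel UNIV = 1"
  by (simp add: measure_def emeasure_semicircle_borel_UNIV)

lemma measure_semicircle_borel_range: "measure semicircle_borel X \<in> {0..1}"
  using semicircle_borel.bounded_measure[of X] by (simp add: measure_semicircle_borel_UNIV)

lemma profile_minus: "u \<in> {0..1} \<Longrightarrow> profile (1 - u) = profile u"
proof -
  assume u: "u \<in> {0..1}"
  have "angle_cdf (- angle_quantile u) = 1 - u"
    using angle_cdf_quantile[OF u] by (simp add: angle_cdf_def divide_simps) (simp add: algebra_simps)
  then have "angle_quantile (1 - u) = - angle_quantile u"
    using angle_quantile_cdf[of "- angle_quantile u"] angle_quantile_range[OF u] by auto
  then show ?thesis by (simp add: profile_def angle_profile_def)
qed

lemma isoperimetric_Compl: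
  assumes X: "X \<in> sets borel" and "isoperimetric X"
  shows "isoperimetric (- X)"
proof -
  have "measure semicircle_borel (- X) = 1 - measure semicircle_borel X"
    using semicircle_borel.finite_measure_compl[of X] X
    by (simp add: measure_semicircle_borel_UNIV Compl_eq_Diff_UNIV)
  then show ?thesis using assms profile_minus[OF measure_semicircle_borel_range]
    by (simp add: isoperimetric_def perimeter_Compl)
qed

lemma isoperimetric_cong_AE:
  assumes "A \<in> sets borel" "A' \<in> sets borel" "AE x in semicircle_borel. x \<in> A \<longleftrightarrow> x \<in> A'"
    and "isoperimetric A"
  shows "isoperimetric A'"
proof -
  have "measure semicircle_borel A = measure semicircle_borel A'"
    by (rule measure_eq_AE) (use assms in auto)
  then show ?thesis using assms(4) perimeter_cong_AE[OF assms(1-3)] by (simp add: isoperimetric_def)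
qed

lemma measure_semicircle_borel_Ioc:
  assumes "-(pi/2) \<le> p" "p \<le> q" "q \<le> pi/2"
  shows "measure semicircle_borel {sin p<..sin q} = angle_cdf q - angle_cdf p"
proof -
  have "emeasure semicircle_borel {sin p<..sin q} = emeasure semicircle_borel {sin p..sin q}"
    by (intro emeasure_eq_AE eventually_mono[OF AE_semicircle_borel_singleton[of "sin p"]]) auto
  then show ?thesis using emeasure_semicircle_borel_Icc[OF assms] angle_cdf_mono[OF assms]
    by (simp add: measure_def)
qed

lemma measure_semicircle_borel_atMost:
  assumes "-(pi/2) \<le> p" "p \<le> pi/2"
  shows "measure semicircle_borel {..sin p} = angle_cdf p"
proof -
  have "measure semicircle_borel {..sin p} = measure semicircle_borel {sin (-(pi/2))<..sin p}"
    by (intro measure_eq_AE eventually_mono[OF AE_semicircle_borel]) auto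
  then show ?thesis using measure_semicircle_borel_Ioc[of "-(pi/2)" p] assms by simp
qed

lemma perimeter_half_line:
  assumes "-(pi/2) \<le> p" "p \<le> pi/2"
  shows "2 * perimeter {..sin p} = ennreal (angle_profile p)"
proof -
  have "- {..sin p} = {sin p<..}" by auto
  then have "2 * perimeter {..sin p} = ennreal 2 * ennreal (angle_profile p / 2)"
    using interaction_half_lines[OF assms] by (simp add: perimeter_def)
  also have "\<dots> = ennreal (angle_profile p)"
    using angle_profile_nonneg[OF assms] by (subst ennreal_mult[symmetric]) auto
  finally show ?thesis .
qed

lemma isoperimetric_half_line:
  assumes "-(pi/2) \<le> p" "p \<le> pi/2"
  shows "isoperimetric {..sin p}"
  unfolding isoperimetric_def using assms
  by (simp add: perimeter_half_line measure_semicircle_borel_atMost profile_def angle_quantile_cdf)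

text \<open>For an increasing list, the points that have an odd number of list entries to their left.\<close>

fun alternating_set :: "real list \<Rightarrow> real set" where
  "alternating_set [] = {}"
| "alternating_set (c # cs) = {c<..} - alternating_set cs"

lemma alternating_set_borel [simp, measurable]: "alternating_set cs \<in> sets borel"
  by (induction cs) auto

text \<open>All positions of the arc have the same total mass, hence the same bound, and one of the
  two extreme positions has no larger perimeter. The hypotheses range over \<open>b\<close> and
  \<open>a\<close> because the extreme positions depend on the mass. On the left the arc starts at
  -1, so up to a null set it is a half-line; on the right it ends at \<open>sin c\<close>.\<close>

lemma isoperimetric_move:
  assumes R: "R \<in> sets borel" "R \<subseteq> {sin c<..}" and c: "c \<le> pi/2"
    and pq: "-(pi/2) < p" "p < q" "q \<le> c"
    and left: "\<And>b. -(pi/2) < b \<Longrightarrow> b < q \<Longrightarrow> isoperimetric ({..sin b} \<union> R)"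
    and right: "\<And>a. p \<le> a \<Longrightarrow> a < c \<Longrightarrow> isoperimetric ({sin a<..sin c} \<union> R)"
  shows "isoperimetric ({sin p<..sin q} \<union> R)"
proof -
  define m where "m = angle_cdf q - angle_cdf p"
  define t where "t = angle_cdf p"
  have qc: "angle_cdf q \<le> angle_cdf c" "angle_cdf c \<le> 1"
    using angle_cdf_mono[of q c] angle_cdf_mono[of c "pi/2"] pq c by auto
  have m: "0 < m" using angle_cdf_strict_mono[of p q] pq c by (simp add: m_def)
  have t0: "0 < t" using angle_cdf_strict_mono[of "-(pi/2)" p] pq c by (simp add: t_def)
  have tm: "t + m = angle_cdf q" by (simp add: t_def m_def)
  have mc: "m \<le> angle_cdf c" and t: "0 \<le> t" "t \<le> angle_cdf c - m" using tm qc t0 by auto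
  have c': "-(pi/2) < c" using pq by simp
  let ?T = "angle_cdf c - m"
  define A where "A s = {sin (angle_quantile s)<..sin (angle_quantile (s + m))} \<union> R" for s
  have A_eq: "moving_arc R m = A" 
    by (simp add: fun_eq_iff A_def moving_arc_def[OF R c' c m mc] arc_left_def[OF R c' c m mc] arc_right_def[OF R c' c m mc])
  have At: "A t = {sin p<..sin q} \<union> R"
  proof -
    have "angle_quantile t = p" "angle_quantile (t + m) = q"
      unfolding tm unfolding t_def using pq c by (auto intro!: angle_quantile_cdf)
    then show ?thesis by (simp only: A_def)
  qed
  have bounds: "-(pi/2) \<le> angle_quantile s" "angle_quantile s < angle_quantile (s + m)" "angle_quantile (s + m) \<le> c"
    if "0 \<le> s" "s \<le> ?T" for s
    using arc_bounds[OF R c' c m mc that] by (simp_all add: arc_left_def[OF R c' c m mc] arc_right_def[OF R c' c m mc])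
  have meas: "measure semicircle_borel (A s) = m + measure semicircle_borel R" if s: "0 \<le> s" "s \<le> ?T" for s
  proof -
    have "sin (angle_quantile (s + m)) \<le> sin c"
      using bounds[OF s] c by (intro sin_monotone_2pi_le) auto
    then have "measure semicircle_borel (A s) = measure semicircle_borel {sin (angle_quantile s)<..sin (angle_quantile (s + m))} + measure semicircle_borel R"
      unfolding A_def using R by (intro semicircle_borel.finite_measure_Union) auto
    then show ?thesis using bounds[OF s] c s m qc
      by (simp add: measure_semicircle_borel_Ioc angle_cdf_quantile)
  qed
  have A0: "isoperimetric (A 0)"
  proof -
    have b: "-(pi/2) < angle_quantile m" "angle_quantile m < q"
      using angle_quantile_strict_mono[of 0 m] angle_quantile_strict_mono[of m "t + m"] tm m t0 qc pq c angle_quantile_cdf[of q]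
      by auto
    have "A 0 = {-1<..sin (angle_quantile m)} \<union> R" by (simp add: A_def)
    moreover have "isoperimetric ({-1<..sin (angle_quantile m)} \<union> R)"
      by (rule isoperimetric_cong_AE[OF _ _ _ left[OF b]])
         (use R in \<open>auto intro!: eventually_mono[OF AE_semicircle_borel]\<close>)
    ultimately show ?thesis by simp
  qed
  have AT: "isoperimetric (A ?T)"
  proof -
    have "angle_quantile (angle_cdf c) = c" using c c' by (intro angle_quantile_cdf) auto
    moreover have "p \<le> angle_quantile ?T"
      using angle_quantile_strict_mono[of t ?T] angle_quantile_cdf[of p] t m qc pq c
      by (cases "t = ?T") (auto simp: t_def)
    moreover have "angle_quantile ?T < c"
      using bounds(2)[of ?T] t calculation by auto
    ultimately show ?thesis unfolding A_def using right[of "angle_quantile ?T"] by simp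
  qed
  have "min (perimeter (A 0)) (perimeter (A ?T)) \<le> perimeter (A t)"
    using perimeter_moving_arc_ge[OF R c' c m mc t] by (simp add: A_eq)
  then have "2 * min (perimeter (A 0)) (perimeter (A ?T)) \<le> 2 * perimeter (A t)" by (intro mult_left_mono) auto
  moreover have "ennreal (profile (m + measure semicircle_borel R)) \<le> 2 * min (perimeter (A 0)) (perimeter (A ?T))"
    using A0 AT t meas[of 0] meas[of ?T] mc by (auto simp: isoperimetric_def min_def)
  ultimately have "isoperimetric (A t)" unfolding isoperimetric_def meas[OF t] by (rule order_trans[rotated])
  then show ?thesis by (simp add: At)
qed

theorem isoperimetric_alternating_set:
  assumes "sorted_wrt (<) cs" "set cs \<subseteq> {-1<..<1}"
  shows "isoperimetric (alternating_set cs)"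
  using assms
proof (induction "length cs" arbitrary: cs rule: less_induct)
  case less
  have arc: "\<exists>p. -(pi/2) < p \<and> p < pi/2 \<and> sin p = x" if "x \<in> {-1<..<1}" for x :: real
    using that arcsin_lt_bounded[of x] by (intro exI[of _ "arcsin x"]) auto
  have range: "-1 < sin x" "sin x < 1" if "-(pi/2) < x" "x < pi/2" for x :: real
    using sin_less[of "-(pi/2)" x] sin_less[of x "pi/2"] that by auto
  consider "cs = []" | c where "cs = [c]" | c d ds where "cs = c # d # ds"
    by (metis list.exhaust)
  then show ?case
  proof cases
    case 1
    then show ?thesis by (simp add: isoperimetric_def profile_def angle_profile_def)
  next
    case 2
    then obtain p where "-(pi/2) < p" "p < pi/2" "sin p = c" using arc[of c] less.prems by auto
    then have "isoperimetric (- {..c})" using isoperimetric_half_line[of p] by (intro isoperimetric_Compl) auto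
    moreover have "- {..c} = alternating_set cs" using 2 by auto
    ultimately show ?thesis by simp
  next
    case 3
    define R where "R = alternating_set ds"
    \<comment> \<open>If no further interval follows, the arc may move up to the right end 1 of the
      support.\<close>
    define e where "e = (case ds of [] \<Rightarrow> 1 | e # es \<Rightarrow> e)"
    have ord: "c < d" "d < e" "-1 < c" "e \<le> 1" and sd: "sorted_wrt (<) ds" "\<forall>x\<in>set ds. d < x"
      using less.prems 3 by (auto simp: e_def split: list.splits)
    have R: "R \<in> sets borel" "R \<subseteq> {e<..}"
      unfolding R_def by (auto simp: e_def split: list.splits)
    obtain p where p: "-(pi/2) < p" "p < pi/2" "sin p = c" using arc[of c] less.prems 3 by auto
    obtain q where q: "-(pi/2) < q" "q < pi/2" "sin q = d" using arc[of d] less.prems 3 by auto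
    define r where "r = arcsin e"
    have r: "-(pi/2) < r" "r \<le> pi/2" "sin r = e"
      using ord arcsin_bounded[of e] arcsin_less_mono[of "-1" e] by (auto simp: r_def)
    have "\<not> q \<le> p" using sin_monotone_2pi_le[of q p] ord p q by auto
    moreover have "\<not> r \<le> q" using sin_monotone_2pi_le[of r q] ord q r by auto
    ultimately have pq: "p < q" "q < r" by auto
    have "isoperimetric ({sin p<..sin q} \<union> R)"
    proof (rule isoperimetric_move[where c = r])
      fix b assume b: "-(pi/2) < b" "b < q"
      have bd: "sin b < d" using b q sin_less[of b q] by simp
      have "sorted_wrt (<) (sin b # ds)" using sd bd by auto
      moreover have "set (sin b # ds) \<subseteq> {-1<..<1}" using less.prems 3 range[of b] b q by auto
      ultimately have "isoperimetric (alternating_set (sin b # ds))"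
        by (intro less.hyps) (auto simp: 3)
      then have "isoperimetric (- alternating_set (sin b # ds))" by (intro isoperimetric_Compl) auto
      \<comment> \<open>A half-line followed by \<open>R\<close> is the complement of an alternating
        set, so the left extreme has one switching point less.\<close>
      moreover have "- alternating_set (sin b # ds) = {..sin b} \<union> R" by (auto simp: R_def)
      ultimately show "isoperimetric ({..sin b} \<union> R)" by simp
    next
      fix a assume a: "p \<le> a" "a < r"
      have a1: "-1 < sin a" "sin a < 1" using range[of a] a p r by auto
      have ae: "sin a < e" using sin_less[of a r] a p r by simp
      show "isoperimetric ({sin a<..sin r} \<union> R)"
      proof (cases ds)
        case Nil
        have "isoperimetric (alternating_set [sin a])"
          using a1 by (intro less.hyps) (auto simp: 3)
        then show ?thesis using Nil R unfolding r(3)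
          by (rule_tac isoperimetric_cong_AE[rotated 3])
             (auto simp: R_def e_def intro!: eventually_mono[OF AE_semicircle_borel])
      next
        \<comment> \<open>At the right extreme the arc merges with the leading interval of
          \<open>R\<close>: both its right end and \<open>e\<close> cease to be switching points,
          and \<open>sin a # es\<close> is shorter by two.\<close>
        case (Cons e' es)
        then have [simp]: "e' = e" by (simp add: e_def)
        have es: "alternating_set es \<subseteq> {e<..}"
          using sd Cons by (cases es) auto
        have "isoperimetric (alternating_set (sin a # es))"
        proof (intro less.hyps)
          show "sorted_wrt (<) (sin a # es)" using sd Cons ae by force
          show "set (sin a # es) \<subseteq> {-1<..<1}" using less.prems 3 Cons a1 by auto
        qed (simp add: 3 Cons)
        moreover have "alternating_set (sin a # es) = {sin a<..sin r} \<union> R"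
          using es ae r by (auto simp: R_def Cons)
        ultimately show ?thesis by simp
      qed
    qed (use R r p q pq in auto)
    moreover have "{sin p<..sin q} \<union> R = alternating_set cs"
      using R ord p q by (auto simp: R_def 3)
    ultimately show ?thesis by simp
  qed
qed

section \<open>Superlevel sets as alternating sets\<close>

lemma alternating_set_subset: "sorted_wrt (<) (l # cs) \<Longrightarrow> alternating_set cs \<subseteq> {l<..}"
  by (cases cs) auto

text \<open>A point of \<open>zs\<close> is kept exactly when membership in \<open>Y\<close> flips
  across it. The flag \<open>b\<close> records membership in the gap directly to the right of
  \<open>l\<close>, where an alternating set with larger switching points is empty; keeping a
  further point therefore negates the flag.\<close>

lemma alternating_set_of_locally_constant:
  assumes "sorted_wrt (<) (l # zs)" "set (l # zs) \<subseteq> {..<1}"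
    and "\<And>x y. l < x \<Longrightarrow> x < y \<Longrightarrow> y < 1 \<Longrightarrow> {x..y} \<inter> set zs = {} \<Longrightarrow> x \<in> Y \<longleftrightarrow> y \<in> Y"
  shows "\<exists>cs b. sorted_wrt (<) (l # cs) \<and> set cs \<subseteq> {..<1} \<and>
     (\<forall>x. l < x \<longrightarrow> x < 1 \<longrightarrow> x \<notin> set zs \<longrightarrow> (x \<in> Y \<longleftrightarrow> (x \<in> alternating_set cs) \<noteq> b))"
  using assms
proof (induction zs arbitrary: l)
  case Nil
  have gap: "x \<in> Y \<longleftrightarrow> (l + 1) / 2 \<in> Y" if "l < x" "x < 1" for x
  proof (cases x "(l + 1) / 2" rule: linorder_cases)
    case less
    then show ?thesis using Nil.prems(2) that by (intro Nil.prems(3)) (auto simp: field_simps)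
  next
    case greater
    then show ?thesis using Nil.prems(2) that by (intro Nil.prems(3)[symmetric]) (auto simp: field_simps)
  next
    case equal
    then show ?thesis by (simp only:)
  qed
  show ?case
  proof (intro exI[of _ "[]"] exI[of _ "(l + 1) / 2 \<in> Y"] conjI allI impI)
    fix x assume "l < x" "x < 1"
    from gap[OF this] show "x \<in> Y \<longleftrightarrow> (x \<in> alternating_set []) \<noteq> ((l + 1) / 2 \<in> Y)"
      by simp
  qed auto
next
  case (Cons z zs)
  have "\<exists>cs b. sorted_wrt (<) (z # cs) \<and> set cs \<subseteq> {..<1} \<and>
     (\<forall>x. z < x \<longrightarrow> x < 1 \<longrightarrow> x \<notin> set zs \<longrightarrow> (x \<in> Y \<longleftrightarrow> (x \<in> alternating_set cs) \<noteq> b))"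
  proof (rule Cons.IH)
    fix x y assume "z < x" "x < y" "y < 1" "{x..y} \<inter> set zs = {}"
    then show "x \<in> Y \<longleftrightarrow> y \<in> Y" using Cons.prems(1) by (intro Cons.prems(3)) auto
  qed (use Cons.prems in auto)
  then obtain cs b' where cs: "sorted_wrt (<) (z # cs)" "set cs \<subseteq> {..<1}"
     "\<And>x. z < x \<Longrightarrow> x < 1 \<Longrightarrow> x \<notin> set zs \<Longrightarrow> x \<in> Y \<longleftrightarrow> (x \<in> alternating_set cs) \<noteq> b'"
    by blast
  have lz: "l < z" "z < 1" using Cons.prems by auto
  have zs: "set zs \<subseteq> {z<..}" using Cons.prems by auto
  have gap: "x \<in> Y \<longleftrightarrow> (l + z) / 2 \<in> Y" if "l < x" "x < z" for x
  proof (cases x "(l + z) / 2" rule: linorder_cases)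
    case less
    then show ?thesis using lz that zs by (intro Cons.prems(3)) (force simp: field_simps)+
  next
    case greater
    then show ?thesis using lz that zs by (intro Cons.prems(3)[symmetric]) (force simp: field_simps)+
  next
    case equal
    then show ?thesis by (simp only:)
  qed
  have sub: "alternating_set cs \<subseteq> {z<..}" by (rule alternating_set_subset[OF cs(1)])
  show ?case
  proof (cases "((l + z) / 2 \<in> Y) = b'")
    case True
    have "x \<in> Y \<longleftrightarrow> (x \<in> alternating_set cs) \<noteq> b'" if "l < x" "x < 1" "x \<notin> set (z # zs)" for x
    proof (cases "x < z")
      case True
      moreover have "x \<notin> alternating_set cs" using sub \<open>x < z\<close> by auto
      ultimately show ?thesis using gap[of x] that \<open>((l + z) / 2 \<in> Y) = b'\<close> by blast
    next
      case False
      then show ?thesis using cs(3)[of x] that by auto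
    qed
    moreover have "sorted_wrt (<) (l # cs)" using cs(1) lz by auto
    ultimately show ?thesis using cs(2) by blast
  next
    case False
    have "x \<in> Y \<longleftrightarrow> (x \<in> alternating_set (z # cs)) \<noteq> (\<not> b')" if "l < x" "x < 1" "x \<notin> set (z # zs)" for x
    proof (cases "x < z")
      case True
      moreover have "x \<notin> alternating_set (z # cs)" using \<open>x < z\<close> by auto
      ultimately show ?thesis using gap[of x] that False by blast
    next
      case False
      then show ?thesis using cs(3)[of x] that by auto
    qed
    moreover have "sorted_wrt (<) (l # z # cs)" using cs(1) lz by auto
    moreover have "set (z # cs) \<subseteq> {..<1}" using cs(2) lz by auto
    ultimately show ?thesis by blast
  qed
qed

text \<open>By the intermediate value theorem membership in the superlevel set can change only at a
  solution of \<open>g x = t\<close>, so up to finitely many points the set or its complement is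
  alternating.\<close>

lemma isoperimetric_level_set:
  fixes g :: "real \<Rightarrow> real"
  assumes g: "continuous_on {-1..1} g" and [measurable]: "g \<in> borel_measurable borel"
    and fin: "finite {x \<in> {-1<..<1}. g x = t}"
  shows "isoperimetric {x. t < g x}"
proof -
  define Z where "Z = {x \<in> {-1<..<1}. g x = t}"
  define zs where "zs = sorted_list_of_set Z"
  have Z: "set zs = Z" using fin by (simp add: zs_def Z_def)
  have "\<exists>cs b. sorted_wrt (<) (-1 # cs) \<and> set cs \<subseteq> {..<1} \<and>
     (\<forall>x. -1 < x \<longrightarrow> x < 1 \<longrightarrow> x \<notin> set zs \<longrightarrow> (x \<in> {x. t < g x} \<longleftrightarrow> (x \<in> alternating_set cs) \<noteq> b))"
  proof (rule alternating_set_of_locally_constant)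
    show "sorted_wrt (<) (-1 # zs)" using Z by (auto simp: zs_def Z_def)
    show "set (-1 # zs) \<subseteq> {..<1}" using Z by (auto simp: Z_def)
    fix x y assume xy: "-1 < x" "x < y" "y < 1" "{x..y} \<inter> set zs = {}"
    then have ne: "g s \<noteq> t" if "x \<le> s" "s \<le> y" for s using that Z by (auto simp: Z_def)
    have c: "continuous_on {x..y} g" using xy by (intro continuous_on_subset[OF g]) auto
    show "x \<in> {x. t < g x} \<longleftrightarrow> y \<in> {x. t < g x}"
      using IVT'[OF _ _ _ c, of t] IVT2'[OF _ _ _ c, of t] xy ne
      by (metis less_imp_le linorder_not_less mem_Collect_eq)
  qed
  then obtain cs b where cs: "sorted_wrt (<) (-1 # cs)" "set cs \<subseteq> {..<1}"
     "\<And>x. -1 < x \<Longrightarrow> x < 1 \<Longrightarrow> x \<notin> Z \<Longrightarrow> x \<in> {x. t < g x} \<longleftrightarrow> (x \<in> alternating_set cs) \<noteq> b"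
    unfolding Z by blast
  define A where "A = (if b then - alternating_set cs else alternating_set cs)"
  have "isoperimetric (alternating_set cs)"
    using cs by (intro isoperimetric_alternating_set) auto
  then have "isoperimetric A" by (auto simp: A_def isoperimetric_Compl)
  moreover have "AE x in semicircle_borel. \<forall>z\<in>Z. x \<noteq> z"
    using AE_semicircle_borel_singleton by (subst AE_finite_all) (use fin in \<open>auto simp: Z_def\<close>)
  then have "AE x in semicircle_borel. x \<in> A \<longleftrightarrow> x \<in> {x. t < g x}"
    using AE_semicircle_borel
  proof eventually_elim
    case (elim x)
    then show ?case using cs(3)[of x] by (auto simp: A_def)
  qed
  ultimately show ?thesis
    by (rule_tac isoperimetric_cong_AE[rotated 3]) (auto simp: A_def)
qed

section \<open>The coarea formula and averaging\<close>

definition energy :: "(real \<Rightarrow> real) \<Rightarrow> ennreal" where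
  "energy f = (\<integral>\<^sup>+x. \<integral>\<^sup>+y. ennreal (\<bar>f x - f y\<bar> / \<bar>x - y\<bar>) \<partial>semicircle_borel \<partial>semicircle_borel)"

lemma energy_indicator:
  assumes [measurable]: "X \<in> sets borel"
  shows "energy (indicator X) = 2 * perimeter X"
proof -
  have "energy (indicator X) = (\<integral>\<^sup>+x. (\<integral>\<^sup>+y. ennreal (1 / \<bar>x - y\<bar>) * indicator (-X) y \<partial>semicircle_borel) * indicator X x
     + (\<integral>\<^sup>+y. ennreal (1 / \<bar>x - y\<bar>) * indicator X y \<partial>semicircle_borel) * indicator (-X) x \<partial>semicircle_borel)"
    unfolding energy_def
  proof (intro nn_integral_cong)
    fix x
    show "(\<integral>\<^sup>+y. ennreal (\<bar>indicator X x - indicator X y\<bar> / \<bar>x - y\<bar>) \<partial>semicircle_borel) =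
       (\<integral>\<^sup>+y. ennreal (1 / \<bar>x - y\<bar>) * indicator (-X) y \<partial>semicircle_borel) * indicator X x
     + (\<integral>\<^sup>+y. ennreal (1 / \<bar>x - y\<bar>) * indicator X y \<partial>semicircle_borel) * indicator (-X) x"
      by (cases "x \<in> X") (auto intro!: nn_integral_cong simp: indicator_def)
  qed
  also have "\<dots> = interaction X (- X) + interaction (- X) X"
    by (subst nn_integral_add) (auto simp: interaction_eq)
  also have "\<dots> = 2 * perimeter X"
    using interaction_commute[of X "-X"] by (simp add: perimeter_def mult_2)
  finally show ?thesis .
qed

lemma nn_integral_abs_indicator_diff:
  fixes u v :: real
  shows "(\<integral>\<^sup>+t. ennreal \<bar>indicator {t. t < u} t - indicator {t. t < v} t\<bar> \<partial>lborel) = ennreal \<bar>u - v\<bar>"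
proof -
  have "(\<integral>\<^sup>+t. ennreal \<bar>indicator {t. t < u} t - indicator {t. t < v} t\<bar> \<partial>lborel)
     = (\<integral>\<^sup>+t. indicator {min u v..<max u v} t \<partial>lborel)"
    by (intro nn_integral_cong) (auto simp: indicator_def min_def max_def)
  also have "\<dots> = ennreal \<bar>u - v\<bar>" by (simp add: min_def max_def)
  finally show ?thesis .
qed

interpretation lborel_semicircle: pair_sigma_finite semicircle_borel "lborel :: real measure"
  by unfold_locales

text \<open>The distance of two reals is the measure of the thresholds that separate them, applied
  under the double integral. The threshold runs over the whole line, so \<open>f\<close> may take
  both signs.\<close>

lemma coarea:
  assumes [measurable]: "f \<in> borel_measurable borel"
  shows "energy f = (\<integral>\<^sup>+t. 2 * perimeter {x. t < f x} \<partial>lborel)"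
proof -
  let ?I = "\<lambda>t x. indicator {t. t < f x} t :: real"
  have "energy f = (\<integral>\<^sup>+x. \<integral>\<^sup>+y. \<integral>\<^sup>+t. ennreal (\<bar>?I t x - ?I t y\<bar> / \<bar>x - y\<bar>) \<partial>lborel \<partial>semicircle_borel \<partial>semicircle_borel)"
    unfolding energy_def
  proof (intro nn_integral_cong)
    fix x y
    have "(\<integral>\<^sup>+t. ennreal (\<bar>?I t x - ?I t y\<bar> / \<bar>x - y\<bar>) \<partial>lborel) = (\<integral>\<^sup>+t. ennreal \<bar>?I t x - ?I t y\<bar> * ennreal (1 / \<bar>x - y\<bar>) \<partial>lborel)"
      by (intro nn_integral_cong) (simp add: ennreal_mult[symmetric])
    also have "\<dots> = ennreal \<bar>f x - f y\<bar> * ennreal (1 / \<bar>x - y\<bar>)"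
      by (subst nn_integral_multc) (simp_all add: nn_integral_abs_indicator_diff)
    also have "\<dots> = ennreal (\<bar>f x - f y\<bar> / \<bar>x - y\<bar>)" by (simp add: ennreal_mult[symmetric])
    finally show "ennreal (\<bar>f x - f y\<bar> / \<bar>x - y\<bar>) = (\<integral>\<^sup>+t. ennreal (\<bar>?I t x - ?I t y\<bar> / \<bar>x - y\<bar>) \<partial>lborel)" ..
  qed
  also have "\<dots> = (\<integral>\<^sup>+x. \<integral>\<^sup>+t. \<integral>\<^sup>+y. ennreal (\<bar>?I t x - ?I t y\<bar> / \<bar>x - y\<bar>) \<partial>semicircle_borel \<partial>lborel \<partial>semicircle_borel)"
    by (intro nn_integral_cong lborel_semicircle.Fubini'[symmetric]) simp
  also have "\<dots> = (\<integral>\<^sup>+t. \<integral>\<^sup>+x. \<integral>\<^sup>+y. ennreal (\<bar>?I t x - ?I t y\<bar> / \<bar>x - y\<bar>) \<partial>semicircle_borel \<partial>semicircle_borel \<partial>lborel)"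
    by (intro lborel_semicircle.Fubini'[symmetric]) simp
  also have "\<dots> = (\<integral>\<^sup>+t. energy (indicator {x. t < f x}) \<partial>lborel)"
    unfolding energy_def by (intro nn_integral_cong) (simp add: indicator_def)
  also have "\<dots> = (\<integral>\<^sup>+t. 2 * perimeter {x. t < f x} \<partial>lborel)"
    by (intro nn_integral_cong energy_indicator) simp
  finally show ?thesis .
qed

section \<open>The inequality for functions, with an L1 error\<close>

definition L1_dist :: "(real \<Rightarrow> real) \<Rightarrow> (real \<Rightarrow> real) \<Rightarrow> ennreal" where
  "L1_dist f g = (\<integral>\<^sup>+x. ennreal \<bar>f x - g x\<bar> \<partial>semicircle_borel)"

lemma L1_dist_triangle:
  assumes [measurable]: "f \<in> borel_measurable borel" "g \<in> borel_measurable borel" "h \<in> borel_measurable borel"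
  shows "L1_dist f h \<le> L1_dist f g + L1_dist g h"
proof -
  have "L1_dist f h \<le> (\<integral>\<^sup>+x. ennreal \<bar>f x - g x\<bar> + ennreal \<bar>g x - h x\<bar> \<partial>semicircle_borel)"
    unfolding L1_dist_def by (intro nn_integral_mono) (simp add: ennreal_plus[symmetric] del: ennreal_plus)
  then show ?thesis unfolding L1_dist_def by (subst (asm) nn_integral_add) auto
qed

text \<open>At \<open>f = indicator X\<close> the error vanishes and the inequality for
  \<open>X\<close> results. Since \<open>X\<close> is independent of \<open>f\<close>, the triangle
  inequality for the L1 distance carries the property to limits along which the energy does not
  increase.\<close>

definition near_isoperimetric :: "(real \<Rightarrow> real) \<Rightarrow> bool" where
  "near_isoperimetric f \<longleftrightarrow> (\<forall>X\<in>sets borel.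
     ennreal (profile (measure semicircle_borel X)) \<le> energy f + 4 * L1_dist f (indicator X))"

lemma profile_lipschitz: "u \<in> {0..1} \<Longrightarrow> v \<in> {0..1} \<Longrightarrow> \<bar>profile u - profile v\<bar> \<le> 4 * \<bar>u - v\<bar>"
  unfolding profile_def by (rule angle_profile_lipschitz)

lemma profile_nonneg: "u \<in> {0..1} \<Longrightarrow> profile u \<ge> 0"
  unfolding profile_def using angle_quantile_range[of u] by (intro angle_profile_nonneg) auto

text \<open>Each superlevel set at height \<open>t\<close> in \<open>(0,1)\<close> is compared with
  \<open>X\<close>: the profile changes by at most four times the mass of their symmetric
  difference. Integration over \<open>t\<close> gives the energy by the coarea formula and at most
  four times the L1 distance.\<close>

lemma near_isoperimetric_of_level_sets:
  assumes [measurable]: "f \<in> borel_measurable borel" and iso: "\<And>t. isoperimetric {x. t < f x}"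
  shows "near_isoperimetric f"
  unfolding near_isoperimetric_def
proof
  fix X :: "real set" assume [measurable]: "X \<in> sets borel"
  let ?\<sigma> = "measure semicircle_borel"
  \<comment> \<open>For \<open>0 < t < 1\<close> the set where \<open>t < indicator X x\<close> is
    \<open>X\<close>. Thus the integral of \<open>?D\<close> in \<open>x\<close> is the mass of a
    symmetric difference, and its integral in \<open>t\<close> is the distance of \<open>f x\<close>
    from the indicator.\<close>
  let ?D = "\<lambda>t x. ennreal \<bar>indicator {t. t < f x} t - indicator {t. t < (indicator X x :: real)} t :: real\<bar>"
  have lvl: "ennreal (profile (?\<sigma> X)) \<le> 2 * perimeter {x. t < f x} + 4 * (\<integral>\<^sup>+x. ?D t x \<partial>semicircle_borel)"
    if t: "t \<in> {0<..<1}" for t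
  proof -
    let ?L = "{x. t < f x}"
    have "profile (?\<sigma> X) \<le> profile (?\<sigma> ?L) + 4 * \<bar>?\<sigma> X - ?\<sigma> ?L\<bar>"
      using profile_lipschitz[OF measure_semicircle_borel_range measure_semicircle_borel_range, of X ?L] by auto
    also have "\<bar>?\<sigma> X - ?\<sigma> ?L\<bar> \<le> ?\<sigma> (?L - X \<union> (X - ?L))"
    proof -
      have "?\<sigma> X \<le> ?\<sigma> (?L \<union> (?L - X \<union> (X - ?L)))" "?\<sigma> ?L \<le> ?\<sigma> (X \<union> (?L - X \<union> (X - ?L)))"
        by (intro semicircle_borel.finite_measure_mono; auto)+
      then show ?thesis
        using measure_Un_le[of ?L semicircle_borel "?L - X \<union> (X - ?L)"] measure_Un_le[of X semicircle_borel "?L - X \<union> (X - ?L)"]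
        by (auto simp: abs_le_iff)
    qed
    finally have "ennreal (profile (?\<sigma> X)) \<le> ennreal (profile (?\<sigma> ?L) + 4 * ?\<sigma> (?L - X \<union> (X - ?L)))"
      by (intro ennreal_leI) auto
    also have "\<dots> = ennreal (profile (?\<sigma> ?L)) + 4 * emeasure semicircle_borel (?L - X \<union> (X - ?L))"
      using profile_nonneg[OF measure_semicircle_borel_range]
      by (simp add: ennreal_mult semicircle_borel.emeasure_eq_measure)
    also have "emeasure semicircle_borel (?L - X \<union> (X - ?L)) = (\<integral>\<^sup>+x. indicator (?L - X \<union> (X - ?L)) x \<partial>semicircle_borel)"
      by simp
    also have "\<dots> = (\<integral>\<^sup>+x. ?D t x \<partial>semicircle_borel)"
      using t by (intro nn_integral_cong) (auto simp: indicator_def)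
    also have "ennreal (profile (?\<sigma> ?L)) \<le> 2 * perimeter ?L" using iso[of t] by (simp add: isoperimetric_def)
    finally show ?thesis by (simp add: add_right_mono)
  qed
  have [measurable]: "(\<lambda>t. perimeter {x. t < f x}) \<in> borel_measurable borel"
  proof -
    have "(\<lambda>t. \<integral>\<^sup>+x. (\<integral>\<^sup>+y. ennreal (1 / \<bar>x - y\<bar>) * indicator {y. \<not> t < f y} y \<partial>semicircle_borel) * indicator {x. t < f x} x \<partial>semicircle_borel)
      \<in> borel_measurable borel"
      unfolding indicator_def by measurable
    moreover have "perimeter {x. t < f x} = (\<integral>\<^sup>+x. (\<integral>\<^sup>+y. ennreal (1 / \<bar>x - y\<bar>) * indicator {y. \<not> t < f y} y \<partial>semicircle_borel) * indicator {x. t < f x} x \<partial>semicircle_borel)" for t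
      unfolding perimeter_def Collect_neg_eq[symmetric] by (rule interaction_eq) auto
    ultimately show ?thesis by simp
  qed
  have "ennreal (profile (?\<sigma> X)) = (\<integral>\<^sup>+t. ennreal (profile (?\<sigma> X)) * indicator {0<..<1::real} t \<partial>lborel)"
    by (simp add: nn_integral_cmult_indicator)
  also have "\<dots> \<le> (\<integral>\<^sup>+t. 2 * perimeter {x. t < f x} + 4 * (\<integral>\<^sup>+x. ?D t x \<partial>semicircle_borel) \<partial>lborel)"
    using lvl by (intro nn_integral_mono) (auto simp: indicator_def)
  also have "\<dots> = energy f + 4 * (\<integral>\<^sup>+t. \<integral>\<^sup>+x. ?D t x \<partial>semicircle_borel \<partial>lborel)"
    by (subst nn_integral_add) (simp_all add: coarea nn_integral_cmult)
  also have "(\<integral>\<^sup>+t. \<integral>\<^sup>+x. ?D t x \<partial>semicircle_borel \<partial>lborel) = (\<integral>\<^sup>+x. \<integral>\<^sup>+t. ?D t x \<partial>lborel \<partial>semicircle_borel)"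
    by (intro lborel_semicircle.Fubini') simp
  also have "\<dots> = L1_dist f (indicator X)"
    unfolding L1_dist_def nn_integral_abs_indicator_diff ..
  finally show "ennreal (profile (?\<sigma> X)) \<le> energy f + 4 * L1_dist f (indicator X)" .
qed

lemma near_isoperimetric_poly: "near_isoperimetric (poly p)"
proof (rule near_isoperimetric_of_level_sets)
  show m: "poly p \<in> borel_measurable borel" by (intro borel_measurable_continuous_onI continuous_intros)
  fix t
  show "isoperimetric {x. t < poly p x}"
  proof (cases "p = [:t:]")
    \<comment> \<open>The constant equal to the threshold has infinitely many solutions, but its
      strict superlevel set is empty.\<close>
    case True
    then show ?thesis by (simp add: isoperimetric_def profile_def angle_profile_def)
  next
    case False
    then have "finite {x. poly (p - [:t:]) x = 0}" by (intro poly_roots_finite) simp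
    then have "finite {x \<in> {-1<..<1}. poly p x = t}" by (rule rev_finite_subset) auto
    then show ?thesis using m by (intro isoperimetric_level_set continuous_intros) auto
  qed
qed

section \<open>Averages over affine contractions\<close>

definition average :: "real \<Rightarrow> (real \<Rightarrow> real) \<Rightarrow> real \<Rightarrow> real" where
  "average r f x = (\<integral>s. f ((1 - r) * x + r * s) * (indicator {-1..1} s / 2) \<partial>lborel)"

lemma average_measurable [measurable]:
  assumes [measurable]: "f \<in> borel_measurable borel"
  shows "average r f \<in> borel_measurable borel"
  unfolding average_def[abs_def] by measurable

text \<open>Squaring reduces this to
  \<open>l\<^sup>2 * (1 - x\<^sup>2) \<le> 1 - (d + l * x)\<^sup>2\<close> for
  \<open>l = 1 - r\<close>. The difference of the two sides is
  \<open>1 - d\<^sup>2 - l\<^sup>2 - 2 * d * l * x\<close>, which is at least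
  \<open>1 - (\<bar>d\<bar> + l)\<^sup>2\<close> and hence nonnegative.\<close>

lemma semicircle_density_affine_ge:
  assumes "0 < r" "r < 1" "\<bar>d\<bar> \<le> r"
  shows "(1 - r) * semicircle_density x \<le> semicircle_density (d + (1 - r) * x)"
proof (cases "x \<in> {-1..1}")
  case True
  define l where "l = 1 - r"
  have l: "0 < l" "l < 1" "\<bar>d\<bar> \<le> 1 - l" using assms by (auto simp: l_def)
  have "\<bar>l * x\<bar> \<le> l * 1" using True l unfolding abs_mult by (intro mult_mono) auto
  then have rng: "d + l * x \<in> {-1..1}" using l by auto
  have "l\<^sup>2 * (1 - x\<^sup>2) \<le> 1 - (d + l * x)\<^sup>2"
  proof -
    have "2 * d * (l * x) \<le> 2 * \<bar>d\<bar> * l"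
    proof -
      have "d * (l * x) \<le> \<bar>d * (l * x)\<bar>" by simp
      also have "\<dots> = \<bar>d\<bar> * \<bar>l * x\<bar>" by (rule abs_mult)
      also have "\<dots> \<le> \<bar>d\<bar> * l" using \<open>\<bar>l * x\<bar> \<le> l * 1\<close> by (intro mult_left_mono) auto
      finally show ?thesis by simp
    qed
    moreover have "(\<bar>d\<bar> + l)\<^sup>2 \<le> 1\<^sup>2" using l by (intro power_mono) auto
    ultimately show ?thesis by (simp add: power2_eq_square algebra_simps)
  qed
  then have "sqrt (l\<^sup>2 * (1 - x\<^sup>2)) \<le> sqrt (1 - (d + l * x)\<^sup>2)" by (rule real_sqrt_le_mono)
  then have "l * sqrt (1 - x\<^sup>2) \<le> sqrt (1 - (d + l * x)\<^sup>2)" using l by (simp add: real_sqrt_mult)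
  then have "2 / pi * (l * sqrt (1 - x\<^sup>2)) \<le> 2 / pi * sqrt (1 - (d + l * x)\<^sup>2)"
    by (intro mult_left_mono) auto
  then show ?thesis using True rng unfolding semicircle_density_def l_def by (simp add: mult_ac)
next
  case False
  then show ?thesis using semicircle_density_nonneg by (simp add: semicircle_density_def[of x])
qed

text \<open>This is why averages are taken over affine maps of \<open>[-1,1]\<close> into itself: translations do not
  compare the semicircle density with itself near the end points.\<close>

lemma energy_affine_le:
  assumes [measurable]: "f \<in> borel_measurable borel" and r: "0 < r" "r < 1" "\<bar>d\<bar> \<le> r"
  shows "ennreal ((1 - r) ^ 3) * energy (\<lambda>x. f (d + (1 - r) * x)) \<le> energy f"
proof -
  define l where "l = 1 - r"
  have l: "0 < l" using r by (simp add: l_def)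
  define T where "T x = d + l * x" for x
  have [measurable]: "T \<in> borel_measurable borel" unfolding T_def[abs_def] by measurable
  let ?\<rho> = "\<lambda>x. ennreal (semicircle_density x)"
  have \<rho>: "ennreal l * ?\<rho> x \<le> ?\<rho> (T x)" for x
    using semicircle_density_affine_ge[OF r, of x] l semicircle_density_nonneg
    by (simp add: ennreal_mult[symmetric] T_def l_def)
  have E: "energy h = (\<integral>\<^sup>+x. ?\<rho> x * (\<integral>\<^sup>+y. ?\<rho> y * ennreal (\<bar>h x - h y\<bar> / \<bar>x - y\<bar>) \<partial>lborel) \<partial>lborel)"
    if [measurable]: "h \<in> borel_measurable borel" for h
    unfolding energy_def
    by (subst nn_integral_semicircle_borel_density, simp, intro nn_integral_cong arg_cong2[where f = "(*)"] refl nn_integral_semicircle_borel_density) simp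
  let ?k = "\<lambda>x y. ennreal (\<bar>f (T x) - f (T y)\<bar> / \<bar>x - y\<bar>)"
  have inner: "ennreal l * (\<integral>\<^sup>+y. ?\<rho> y * ?k x y \<partial>lborel) \<le> (\<integral>\<^sup>+y. ?\<rho> y * ennreal (\<bar>f (T x) - f y\<bar> / \<bar>T x - y\<bar>) \<partial>lborel)" for x
  proof -
    have "ennreal l * (\<integral>\<^sup>+y. ?\<rho> y * ?k x y \<partial>lborel) = (\<integral>\<^sup>+y. ennreal l * (?\<rho> y * ?k x y) \<partial>lborel)"
      by (rule nn_integral_cmult[symmetric]) simp
    also have "\<dots> \<le> (\<integral>\<^sup>+y. ennreal l * (?\<rho> (T y) * ennreal (\<bar>f (T x) - f (T y)\<bar> / \<bar>T x - T y\<bar>)) \<partial>lborel)"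
    proof (intro nn_integral_mono)
      fix y
      have "\<bar>T x - T y\<bar> = l * \<bar>x - y\<bar>" using l by (simp add: T_def right_diff_distrib[symmetric] abs_mult)
      then have "\<bar>f (T x) - f (T y)\<bar> / \<bar>x - y\<bar> = l * (\<bar>f (T x) - f (T y)\<bar> / \<bar>T x - T y\<bar>)" using l by simp
      then have "?k x y = ennreal l * ennreal (\<bar>f (T x) - f (T y)\<bar> / \<bar>T x - T y\<bar>)"
        using l by (simp add: ennreal_mult[symmetric])
      then have "ennreal l * (?\<rho> y * ?k x y) = ennreal l * ((ennreal l * ?\<rho> y) * ennreal (\<bar>f (T x) - f (T y)\<bar> / \<bar>T x - T y\<bar>))"
        by (simp only: mult_ac)
      also have "\<dots> \<le> ennreal l * (?\<rho> (T y) * ennreal (\<bar>f (T x) - f (T y)\<bar> / \<bar>T x - T y\<bar>))"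
        using \<rho> by (intro mult_left_mono mult_right_mono) auto
      finally show "ennreal l * (?\<rho> y * ?k x y) \<le> \<dots>" .
    qed
    also have "\<dots> = ennreal l * (\<integral>\<^sup>+y. ?\<rho> (T y) * ennreal (\<bar>f (T x) - f (T y)\<bar> / \<bar>T x - T y\<bar>) \<partial>lborel)"
      by (rule nn_integral_cmult) simp
    also have "\<dots> = (\<integral>\<^sup>+y. ?\<rho> y * ennreal (\<bar>f (T x) - f y\<bar> / \<bar>T x - y\<bar>) \<partial>lborel)"
      using nn_integral_real_affine[of "\<lambda>y. ?\<rho> y * ennreal (\<bar>f (T x) - f y\<bar> / \<bar>T x - y\<bar>)" l d] l
      by (simp add: T_def)
    finally show ?thesis .
  qed
  \<comment> \<open>The exponent 3 counts two comparisons of densities and two Jacobians, less one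
    because the kernel \<open>1 / \<bar>x - y\<bar>\<close> gains a factor \<open>l\<close> under
    \<open>T\<close>.\<close>
  have "ennreal (l ^ 3) * energy (\<lambda>x. f (T x)) = (ennreal l * ennreal l * ennreal l) * (\<integral>\<^sup>+x. ?\<rho> x * (\<integral>\<^sup>+y. ?\<rho> y * ?k x y \<partial>lborel) \<partial>lborel)"
    using l by (simp add: E ennreal_mult[symmetric] power3_eq_cube)
  also have "\<dots> = (\<integral>\<^sup>+x. (ennreal l * ennreal l * ennreal l) * (?\<rho> x * (\<integral>\<^sup>+y. ?\<rho> y * ?k x y \<partial>lborel)) \<partial>lborel)"
    by (rule nn_integral_cmult[symmetric]) simp
  also have "\<dots> \<le> (\<integral>\<^sup>+x. ennreal l * (?\<rho> (T x) * (\<integral>\<^sup>+y. ?\<rho> y * ennreal (\<bar>f (T x) - f y\<bar> / \<bar>T x - y\<bar>) \<partial>lborel)) \<partial>lborel)"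
  proof (intro nn_integral_mono)
    fix x
    have "(ennreal l * ennreal l * ennreal l) * (?\<rho> x * (\<integral>\<^sup>+y. ?\<rho> y * ?k x y \<partial>lborel))
       = ennreal l * ((ennreal l * ?\<rho> x) * (ennreal l * (\<integral>\<^sup>+y. ?\<rho> y * ?k x y \<partial>lborel)))"
      by (simp only: mult_ac)
    also have "\<dots> \<le> ennreal l * (?\<rho> (T x) * (\<integral>\<^sup>+y. ?\<rho> y * ennreal (\<bar>f (T x) - f y\<bar> / \<bar>T x - y\<bar>) \<partial>lborel))"
      using \<rho> inner by (intro mult_mono order_refl) auto
    finally show "(ennreal l * ennreal l * ennreal l) * (?\<rho> x * (\<integral>\<^sup>+y. ?\<rho> y * ?k x y \<partial>lborel)) \<le> \<dots>" .
  qed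
  also have "\<dots> = ennreal l * (\<integral>\<^sup>+x. ?\<rho> (T x) * (\<integral>\<^sup>+y. ?\<rho> y * ennreal (\<bar>f (T x) - f y\<bar> / \<bar>T x - y\<bar>) \<partial>lborel) \<partial>lborel)"
    by (rule nn_integral_cmult) simp
  also have "\<dots> = energy f"
    using nn_integral_real_affine[of "\<lambda>x. ?\<rho> x * (\<integral>\<^sup>+y. ?\<rho> y * ennreal (\<bar>f x - f y\<bar> / \<bar>x - y\<bar>) \<partial>lborel)" l d] l
    by (simp add: T_def E)
  finally show ?thesis by (simp add: T_def l_def)
qed

context
  fixes f :: "real \<Rightarrow> real" and B :: real
  assumes f [measurable]: "f \<in> borel_measurable borel" and B: "\<And>x. \<bar>f x\<bar> \<le> B"
begin

lemma integrable_average: "integrable lborel (\<lambda>s. f (c + r * s) * (indicator {-1..1} s / 2))"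
proof (rule Bochner_Integration.integrable_bound)
  show "integrable lborel (\<lambda>s::real. B * indicator {-1..1} s)"
    by (intro integrable_mult_right integrable_real_indicator) auto
  show "AE s in lborel. norm (f (c + r * s) * (indicator {-1..1} s / 2)) \<le> norm (B * indicator {-1..1} s)"
  proof (intro AE_I2)
    fix s
    have "\<bar>f (c + r * s)\<bar> \<le> \<bar>B\<bar>" using B[of "c + r * s"] by linarith
    then have "\<bar>f (c + r * s)\<bar> \<le> \<bar>B\<bar> * 2" by linarith
    then show "norm (f (c + r * s) * (indicator {-1..1} s / 2)) \<le> norm (B * indicator {-1..1} s)"
      unfolding indicator_def by simp
  qed
qed simp

lemma average_bounded: "\<bar>average r f x\<bar> \<le> B"
proof -
  have "norm (average r f x) \<le> (\<integral>s. B * (indicator {-1..1} s / 2) \<partial>(lborel :: real measure))"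
    unfolding average_def
  proof (rule Bochner_Integration.integral_norm_bound_integral)
    show "integrable lborel (\<lambda>s::real. B * (indicator {-1..1} s / 2))"
      by (intro integrable_mult_right integrable_divide integrable_real_indicator) auto
    show "norm (f ((1 - r) * x + r * s) * (indicator {-1..1} s / 2)) \<le> B * (indicator {-1..1} s / 2)" for s
      using B[of "(1 - r) * x + r * s"] by (simp add: indicator_def)
  qed (rule integrable_average)
  then show ?thesis by simp
qed

text \<open>The energy is convex, being an integral of absolute differences, so the energy of the
  mean is at most the mean of the energies of the affine copies, each of which is bounded by
  \<open>energy_affine_le\<close>.\<close>

lemma energy_average_le:
  assumes r: "0 < r" "r < 1"
  shows "ennreal ((1 - r) ^ 3) * energy (average r f) \<le> energy f"
proof -
  let ?w = "\<lambda>s::real. ennreal (indicator {-1..1} s / 2)"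
  let ?F = "\<lambda>s x. f (r * s + (1 - r) * x)"
  have diff: "ennreal (\<bar>average r f x - average r f y\<bar> / \<bar>x - y\<bar>) 
     \<le> (\<integral>\<^sup>+s. ?w s * ennreal (\<bar>?F s x - ?F s y\<bar> / \<bar>x - y\<bar>) \<partial>lborel)" for x y
  proof -
    have "average r f x - average r f y 
      = (\<integral>s. f ((1 - r) * x + r * s) * (indicator {-1..1} s / 2) - f ((1 - r) * y + r * s) * (indicator {-1..1} s / 2) \<partial>lborel)"
      unfolding average_def by (rule Bochner_Integration.integral_diff[symmetric]; rule integrable_average)
    then have "ennreal (norm (average r f x - average r f y))
      \<le> (\<integral>\<^sup>+s. ennreal (norm (f ((1 - r) * x + r * s) * (indicator {-1..1} s / 2) - f ((1 - r) * y + r * s) * (indicator {-1..1} s / 2))) \<partial>lborel)"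
      by (simp only:) (intro integral_norm_bound_ennreal Bochner_Integration.integrable_diff integrable_average)
    also have "\<dots> = (\<integral>\<^sup>+s. ?w s * ennreal \<bar>?F s x - ?F s y\<bar> \<partial>lborel)"
      by (intro nn_integral_cong) (simp add: indicator_def ennreal_mult[symmetric] diff_divide_distrib[symmetric] add.commute)
    finally have "ennreal \<bar>average r f x - average r f y\<bar> * ennreal (1 / \<bar>x - y\<bar>)
       \<le> (\<integral>\<^sup>+s. ?w s * ennreal \<bar>?F s x - ?F s y\<bar> \<partial>lborel) * ennreal (1 / \<bar>x - y\<bar>)"
      by (intro mult_right_mono) auto
    also have "\<dots> = (\<integral>\<^sup>+s. ?w s * ennreal \<bar>?F s x - ?F s y\<bar> * ennreal (1 / \<bar>x - y\<bar>) \<partial>lborel)"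
      by (rule nn_integral_multc[symmetric]) simp
    also have "\<dots> = (\<integral>\<^sup>+s. ?w s * ennreal (\<bar>?F s x - ?F s y\<bar> / \<bar>x - y\<bar>) \<partial>lborel)"
      by (intro nn_integral_cong) (simp add: mult.assoc ennreal_mult[symmetric])
    finally show ?thesis by (simp add: ennreal_mult[symmetric])
  qed
  have "energy (average r f) \<le> (\<integral>\<^sup>+x. \<integral>\<^sup>+y. \<integral>\<^sup>+s. ?w s * ennreal (\<bar>?F s x - ?F s y\<bar> / \<bar>x - y\<bar>) \<partial>lborel \<partial>semicircle_borel \<partial>semicircle_borel)"
    unfolding energy_def by (intro nn_integral_mono diff)
  also have "\<dots> = (\<integral>\<^sup>+x. \<integral>\<^sup>+s. \<integral>\<^sup>+y. ?w s * ennreal (\<bar>?F s x - ?F s y\<bar> / \<bar>x - y\<bar>) \<partial>semicircle_borel \<partial>lborel \<partial>semicircle_borel)"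
    by (intro nn_integral_cong lborel_semicircle.Fubini'[symmetric]) simp
  also have "\<dots> = (\<integral>\<^sup>+s. \<integral>\<^sup>+x. \<integral>\<^sup>+y. ?w s * ennreal (\<bar>?F s x - ?F s y\<bar> / \<bar>x - y\<bar>) \<partial>semicircle_borel \<partial>semicircle_borel \<partial>lborel)"
    by (intro lborel_semicircle.Fubini'[symmetric]) simp
  also have "\<dots> = (\<integral>\<^sup>+s. ?w s * energy (?F s) \<partial>lborel)"
    unfolding energy_def by (simp add: nn_integral_cmult)
  finally have "ennreal ((1 - r) ^ 3) * energy (average r f) \<le> ennreal ((1 - r) ^ 3) * (\<integral>\<^sup>+s. ?w s * energy (?F s) \<partial>lborel)"
    by (intro mult_left_mono) auto
  also have "\<dots> = (\<integral>\<^sup>+s. ennreal ((1 - r) ^ 3) * (?w s * energy (?F s)) \<partial>lborel)"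
    unfolding energy_def by (rule nn_integral_cmult[symmetric]) simp
  also have "\<dots> \<le> (\<integral>\<^sup>+s. ?w s * energy f \<partial>lborel)"
  proof (intro nn_integral_mono)
    fix s :: real
    show "ennreal ((1 - r) ^ 3) * (?w s * energy (?F s)) \<le> ?w s * energy f"
    proof (cases "s \<in> {-1..1}")
      case True
      then have "\<bar>r * s\<bar> \<le> r * 1" using r unfolding abs_mult by (intro mult_mono) auto
      then have "ennreal ((1 - r) ^ 3) * energy (?F s) \<le> energy f"
        using energy_affine_le[OF f r, of "r * s"] by simp
      then have "?w s * (ennreal ((1 - r) ^ 3) * energy (?F s)) \<le> ?w s * energy f" by (intro mult_left_mono) auto
      then show ?thesis by (simp only: mult_ac)
    qed simp
  qed
  also have "\<dots> = (\<integral>\<^sup>+s. ?w s \<partial>lborel) * energy f" by (rule nn_integral_multc) simp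
  also have "(\<integral>\<^sup>+s. ?w s \<partial>lborel) = (\<integral>\<^sup>+s. ennreal (1/2) * indicator {-1..1::real} s \<partial>lborel)"
    by (intro nn_integral_cong) (simp add: indicator_def)
  also have "\<dots> = ennreal (1/2) * ennreal 2" by (subst nn_integral_cmult_indicator) simp_all
  also have "\<dots> = ennreal (1/2 * 2)" by (rule ennreal_mult[symmetric]) auto
  also have "\<dots> = 1" by simp
  finally show ?thesis by simp
qed

lemma set_integrable_bounded: "set_integrable lborel {a..b} f"
  unfolding set_integrable_def
proof (rule Bochner_Integration.integrable_bound)
  show "integrable lborel (\<lambda>s::real. B * indicator {a..b} s)"
    by (intro integrable_mult_right integrable_real_indicator) (auto simp: emeasure_lborel_Icc_eq)
  show "AE s in lborel. norm (indicator {a..b} s *\<^sub>R f s) \<le> norm (B * indicator {a..b} s)"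
  proof (intro AE_I2)
    fix s show "norm (indicator {a..b} s *\<^sub>R f s) \<le> norm (B * indicator {a..b} s)"
      using B[of s] by (auto simp: indicator_def)
  qed
qed simp

lemma integrable_on_bounded: "f integrable_on {a..b}"
  using set_integrable_bounded by (rule set_borel_integral_eq_integral)

lemma average_eq_integral:
  assumes "0 < r"
  shows "average r f x = integral {(1 - r) * x - r..(1 - r) * x + r} f / (2 * r)"
proof -
  define c where "c = (1 - r) * x"
  have "integral {c - r..c + r} f = (\<integral>z. indicator {c - r..c + r} z * f z \<partial>lborel)"
    using set_borel_integral_eq_integral(2)[OF set_integrable_bounded, of "c - r" "c + r"] by (simp add: set_lebesgue_integral_def)
  also have "\<dots> = \<bar>r\<bar> *\<^sub>R (\<integral>s. indicator {c - r..c + r} (c + r * s) * f (c + r * s) \<partial>lborel)"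
    using assms by (intro lborel_integral_real_affine) auto
  also have "(\<lambda>s. indicator {c - r..c + r} (c + r * s) * f (c + r * s)) = (\<lambda>s. 2 * (f (c + r * s) * (indicator {-1..1} s / 2)))"
  proof
    fix s
    have "c + r * s \<in> {c - r..c + r} \<longleftrightarrow> s \<in> {-1..1}"
      using assms mult_le_cancel_left_pos[of r s 1] mult_le_cancel_left_pos[of r "-1" s] by auto
    then show "indicator {c - r..c + r} (c + r * s) * f (c + r * s) = 2 * (f (c + r * s) * (indicator {-1..1} s / 2))"
      by (simp add: indicator_def)
  qed
  also have "(\<integral>s. 2 * (f (c + r * s) * (indicator {-1..1} s / 2)) \<partial>lborel) = 2 * average r f x"
    unfolding average_def c_def by (rule integral_mult_right_zero)
  finally show ?thesis using assms by (simp add: c_def)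
qed

text \<open>The interval of averaging contains \<open>x\<close> but is not centred at it: it reaches
  \<open>r * (1 - x)\<close> to the right and \<open>r * (1 + x)\<close> to the left. One-sided
  Lebesgue differentiation is therefore used for \<open>f\<close> and, after reflection, for the
  left side.\<close>

lemma average_tendsto_AE:
  "AE x in lborel. -1 < x \<longrightarrow> x < 1 \<longrightarrow> ((\<lambda>r. average r f x) \<longlongrightarrow> f x) (at_right 0)"
proof -
  have int: "h integrable_on {a..b}" if "h = f \<or> h = (\<lambda>x. f (- x))" for h and a b :: real
    using that integrable_on_bounded[of a b] integrable_on_bounded[of "-b" "-a"]
      Henstock_Kurzweil_Integration.integrable_reflect_real[where f = f and a = "-b" and b = "-a"] by auto
  obtain N where N: "negligible N" "\<And>x e. x \<notin> N \<Longrightarrow> 0 < e \<Longrightarrow>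
     \<exists>d>0. \<forall>h. 0 < h \<and> h < d \<longrightarrow> \<bar>integral {x..x + h} f / h - f x\<bar> < e"
    using integrable_ccontinuous_explicit[of f] int by (auto simp: divide_inverse mult.commute)
  obtain M where M: "negligible M" "\<And>x e. x \<notin> M \<Longrightarrow> 0 < e \<Longrightarrow>
     \<exists>d>0. \<forall>h. 0 < h \<and> h < d \<longrightarrow> \<bar>integral {x..x + h} (\<lambda>x. f (- x)) / h - f (- x)\<bar> < e"
    using integrable_ccontinuous_explicit[of "\<lambda>x. f (- x)"] int by (auto simp: divide_inverse mult.commute)
  have "negligible (uminus ` M)"
    using M(1) by (intro negligible_differentiable_image_negligible) (auto simp: differentiable_on_def intro!: derivative_intros)
  then have "negligible (N \<union> uminus ` M)" using N by (intro negligible_Un)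
  then have "AE x in lebesgue. x \<notin> N \<union> uminus ` M"
    unfolding negligible_iff_null_sets by (rule AE_not_in)
  then have "AE x in lborel. x \<notin> N \<union> uminus ` M" by (simp only: AE_completion_iff)
  then show ?thesis
  proof eventually_elim
    case (elim x)
    have xM: "- x \<notin> M" using elim by force
    have "((\<lambda>r. average r f x) \<longlongrightarrow> f x) (at_right 0)" if x: "-1 < x" "x < 1"
    proof (rule tendstoI)
      fix e :: real assume e: "0 < e"
      obtain d where d: "d > 0" "\<And>h. 0 < h \<Longrightarrow> h < d \<Longrightarrow> \<bar>integral {x..x + h} f / h - f x\<bar> < e"
        using N(2)[of x e] elim e by auto
      obtain d' where d': "d' > 0" "\<And>h. 0 < h \<Longrightarrow> h < d' \<Longrightarrow> \<bar>integral {-x..-x + h} (\<lambda>x. f (- x)) / h - f x\<bar> < e"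
        using M(2)[OF xM e] by auto
      have "dist (average r f x) (f x) < e" if r: "0 < r" "r < min d d' / 2" for r
      proof -
        \<comment> \<open>The two lengths add up to \<open>2 * r\<close>, which explains the bound
          on \<open>r\<close>: each of them alone is then below its own threshold.\<close>
        define h1 h2 where "h1 = r * (1 - x)" and "h2 = r * (1 + x)"
        have h: "h1 > 0" "h2 > 0" "h1 + h2 = 2 * r"
          using r x by (simp_all add: h1_def h2_def) (simp_all add: algebra_simps)
        have "2 * r < d" "2 * r < d'" using r by simp_all
        then have hd: "h1 < d" "h2 < d'" using h by linarith+
        have "integral {x - h2..x + h1} f = integral {x - h2..x} f + integral {x..x + h1} f"
          using h int by (intro Henstock_Kurzweil_Integration.integral_combine[symmetric]) auto
        also have "integral {x - h2..x} f = integral {-x..-x + h2} (\<lambda>x. f (- x))"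
          using Henstock_Kurzweil_Integration.integral_reflect_real[of x "x - h2" f] by (simp add: add.commute)
        finally have I: "integral {x - h2..x + h1} f = integral {-x..-x + h2} (\<lambda>x. f (- x)) + integral {x..x + h1} f" .
        have "\<bar>integral {x..x + h1} f - f x * h1\<bar> < e * h1"
          using d(2)[OF h(1) hd(1)] h by (simp add: abs_less_iff field_simps)
        moreover have "\<bar>integral {-x..-x + h2} (\<lambda>x. f (- x)) - f x * h2\<bar> < e * h2"
          using d'(2)[OF h(2) hd(2)] h by (simp add: abs_less_iff field_simps)
        ultimately have "\<bar>integral {x - h2..x + h1} f - f x * (h1 + h2)\<bar> < e * (h1 + h2)"
          unfolding I distrib_left by linarith
        moreover have "(1 - r) * x - r = x - h2" "(1 - r) * x + r = x + h1"
          by (simp_all add: h1_def h2_def algebra_simps)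
        then have "average r f x * (h1 + h2) = integral {x - h2..x + h1} f"
          unfolding h(3) using r by (simp add: average_eq_integral)
        ultimately have "\<bar>(average r f x - f x) * (h1 + h2)\<bar> < e * (h1 + h2)" by (simp add: left_diff_distrib)
        then show ?thesis using h by (simp add: dist_norm abs_mult)
      qed
      moreover have "0 < min d d' / 2" using d d' by simp
      ultimately show "\<forall>\<^sub>F r in at_right 0. dist (average r f x) (f x) < e"
        unfolding eventually_at_right_field by blast
    qed
    then show ?case by simp
  qed
qed

text \<open>Almost everywhere convergence is dominated by the common bound \<open>B\<close>. The
  shift by 2 keeps every radius strictly below 1, where the factor \<open>(1 - r) ^ 3\<close> of the
  energy bound is positive.\<close>

lemma average_tendsto_L1:
  "(\<lambda>n. L1_dist f (average (1 / real (n + 2)) f)) \<longlonglongrightarrow> 0"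
proof -
  have r: "filterlim (\<lambda>n. 1 / real (n + 2)) (at_right 0) sequentially"
  proof -
    have "(\<lambda>n. inverse (real (n + 2))) \<longlonglongrightarrow> 0"
      using LIMSEQ_ignore_initial_segment[OF lim_inverse_n, of 2] by simp
    then show ?thesis unfolding filterlim_at by (auto simp: divide_inverse)
  qed
  have "AE x in semicircle_borel. -1 < x \<longrightarrow> x < 1 \<longrightarrow> ((\<lambda>r. average r f x) \<longlongrightarrow> f x) (at_right 0)"
    unfolding semicircle_borel_def using average_tendsto_AE by (subst AE_density) (auto elim!: eventually_mono)
  then have "AE x in semicircle_borel. (\<lambda>n. average (1 / real (n + 2)) f x) \<longlonglongrightarrow> f x"
    using AE_semicircle_borel
  proof eventually_elim
    case (elim x)
    then show ?case by (intro filterlim_compose[OF _ r]) auto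
  qed
  then have "(\<lambda>n. (\<integral>\<^sup>+x. ennreal (norm (f x - average (1 / real (n + 2)) f x)) \<partial>semicircle_borel)) \<longlonglongrightarrow> 0"
    using average_bounded emeasure_semicircle_borel_UNIV
    by (intro nn_integral_dominated_convergence_norm[where w = "\<lambda>_. B"]) (auto simp: less_top[symmetric])
  then show ?thesis by (simp add: L1_dist_def)
qed

text \<open>For finite energy the energies of the averages exceed that of \<open>f\<close> at most
  by the factor \<open>1 / (1 - r) ^ 3\<close>, which tends to 1, while the L1 error tends to that
  of \<open>f\<close>. Infinite energy leaves nothing to show.\<close>

lemma near_isoperimetric_of_averages:
  assumes "\<And>n. near_isoperimetric (average (1 / real (n + 2)) f)"
  shows "near_isoperimetric f"
  unfolding near_isoperimetric_def
proof
  fix X :: "real set" assume X [measurable]: "X \<in> sets borel"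
  let ?A = "\<lambda>n. average (1 / real (n + 2)) f"
  let ?p = "ennreal (profile (measure semicircle_borel X))"
  show "?p \<le> energy f + 4 * L1_dist f (indicator X)"
  proof (cases "energy f = \<infinity>")
    case False
    define e where "e = enn2real (energy f)"
    have e: "energy f = ennreal e" "e \<ge> 0" using False by (auto simp: e_def less_top)
    define l where "l n = 1 - 1 / real (n + 2)" for n
    have l: "0 < l n" for n by (simp add: l_def field_simps)
    have "?p \<le> ennreal (e / l n ^ 3) + 4 * (L1_dist f (?A n) + L1_dist f (indicator X))" for n
    proof -
      have "ennreal (l n ^ 3) * energy (?A n) \<le> ennreal e"
        unfolding e(1)[symmetric] l_def by (rule energy_average_le) auto
      then have "ennreal (1 / l n ^ 3) * (ennreal (l n ^ 3) * energy (?A n)) \<le> ennreal (1 / l n ^ 3) * ennreal e"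
        by (intro mult_left_mono) auto
      moreover have "ennreal (1 / l n ^ 3) * (ennreal (l n ^ 3) * energy (?A n)) = energy (?A n)"
        using l[of n] by (simp add: mult.assoc[symmetric] ennreal_mult[symmetric])
      moreover have "ennreal (1 / l n ^ 3) * ennreal e = ennreal (e / l n ^ 3)"
        using l[of n] e by (simp add: ennreal_mult[symmetric])
      ultimately have en: "energy (?A n) \<le> ennreal (e / l n ^ 3)" by simp
      have "L1_dist (?A n) f = L1_dist f (?A n)" by (simp add: L1_dist_def abs_minus_commute)
      then have "L1_dist (?A n) (indicator X) \<le> L1_dist f (?A n) + L1_dist f (indicator X)"
        using L1_dist_triangle[of "?A n" f "indicator X"] by simp
      moreover have "?p \<le> energy (?A n) + 4 * L1_dist (?A n) (indicator X)"
        using assms[of n] X by (simp only: near_isoperimetric_def)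
      ultimately show ?thesis using en
        by (elim order_trans) (intro add_mono mult_left_mono; simp)
    qed
    moreover have "(\<lambda>n. ennreal (e / l n ^ 3) + 4 * (L1_dist f (?A n) + L1_dist f (indicator X)))
       \<longlonglongrightarrow> ennreal (e / 1 ^ 3) + 4 * (0 + L1_dist f (indicator X))"
    proof (intro tendsto_add ennreal_tendsto_cmult tendsto_ennrealI tendsto_divide tendsto_power average_tendsto_L1 tendsto_const)
      have "(\<lambda>n. inverse (real (n + 2))) \<longlonglongrightarrow> 0"
        using LIMSEQ_ignore_initial_segment[OF lim_inverse_n, of 2] by simp
      then have "(\<lambda>n. 1 - inverse (real (n + 2))) \<longlonglongrightarrow> 1 - 0" by (intro tendsto_diff tendsto_const)
      then show "l \<longlonglongrightarrow> 1" by (simp add: l_def[abs_def] divide_inverse)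
    qed auto
    ultimately have "?p \<le> ennreal (e / 1 ^ 3) + 4 * (0 + L1_dist f (indicator X))"
      by (intro LIMSEQ_le_const) auto
    then show ?thesis by (simp add: e)
  qed simp
qed

text \<open>The average is a difference of one primitive at two affine images of \<open>x\<close>
  that stay in \<open>[-1,1]\<close>. This makes it continuous for bounded \<open>f\<close> and
  continuously differentiable for continuous \<open>f\<close>.\<close>

lemma average_integral_difference:
  assumes r: "0 < r" "r < 1" and x: "x \<in> {-1..1}"
  shows "average r f x = (integral {-1..(1 - r) * x + r} f - integral {-1..(1 - r) * x - r} f) / (2 * r)"
    and "(1 - r) * x + r \<in> {-1..1}" "(1 - r) * x - r \<in> {-1..1}"
proof -
  have "\<bar>(1 - r) * x\<bar> \<le> (1 - r) * 1" using r x unfolding abs_mult by (intro mult_mono) auto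
  then show rng: "(1 - r) * x + r \<in> {-1..1}" "(1 - r) * x - r \<in> {-1..1}" using r by auto
  have "integral {-1..(1 - r) * x + r} f = integral {-1..(1 - r) * x - r} f + integral {(1 - r) * x - r..(1 - r) * x + r} f"
    using rng r integrable_on_bounded by (intro Henstock_Kurzweil_Integration.integral_combine[symmetric]) auto
  then show "average r f x = (integral {-1..(1 - r) * x + r} f - integral {-1..(1 - r) * x - r} f) / (2 * r)"
    using r by (simp add: average_eq_integral)
qed

lemma continuous_average:
  assumes r: "0 < r" "r < 1"
  shows "continuous_on {-1..1} (average r f)"
proof -
  have c: "continuous_on {-1..1} (\<lambda>u. integral {-1..u} f)"
    by (rule indefinite_integral_continuous_1[OF integrable_on_bounded])
  have "continuous_on {-1..1} (\<lambda>x. integral {-1..(1 - r) * x + r} f)" "continuous_on {-1..1} (\<lambda>x. integral {-1..(1 - r) * x - r} f)"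
    using average_integral_difference(2,3)[OF r]
    by (intro continuous_on_compose2[OF c] continuous_intros; force)+
  then have "continuous_on {-1..1} (\<lambda>x. (integral {-1..(1 - r) * x + r} f - integral {-1..(1 - r) * x - r} f) / (2 * r))"
    using r by (intro continuous_intros) auto
  then show ?thesis
    by (rule continuous_on_eq) (simp add: average_integral_difference(1)[OF r])
qed

lemma DERIV_average:
  assumes r: "0 < r" "r < 1" and cont: "continuous_on {-1..1} f" and x: "x \<in> {-1..1}"
  shows "(average r f has_real_derivative 
     (f ((1 - r) * x + r) * (1 - r) - f ((1 - r) * x - r) * (1 - r)) / (2 * r)) (at x within {-1..1})"
proof -
  have D: "((\<lambda>x. integral {-1..u x} f) has_real_derivative f (u x) * (1 - r)) (at x within {-1..1})"
    if u: "u = (\<lambda>x. (1 - r) * x + r) \<or> u = (\<lambda>x. (1 - r) * x - r)" for u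
  proof -
    have rng: "u y \<in> {-1..1}" if "y \<in> {-1..1}" for y
      using u average_integral_difference(2,3)[OF r that] by auto
    have "((\<lambda>v. integral {-1..v} f) has_real_derivative f (u x)) (at (u x) within u ` {-1..1})"
      by (rule has_field_derivative_subset[OF integral_has_real_derivative[OF cont rng[OF x]]]) (use rng in blast)
    moreover have "((\<lambda>x. (1 - r) * x + k) has_real_derivative (1 - r)) (at x within {-1..1})" for k
      using DERIV_add[OF DERIV_cmult[OF DERIV_ident, of "1 - r"] DERIV_const[of k]] by simp
    from this[of r] this[of "- r"] u have "(u has_real_derivative (1 - r)) (at x within {-1..1})"
      by (elim disjE) simp_all
    ultimately have "((\<lambda>v. integral {-1..v} f) \<circ> u has_real_derivative f (u x) * (1 - r)) (at x within {-1..1})"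
      by (rule DERIV_image_chain)
    then show ?thesis by (simp only: o_def)
  qed
  have "((\<lambda>x. (integral {-1..(1 - r) * x + r} f - integral {-1..(1 - r) * x - r} f) / (2 * r)) has_real_derivative 
     (f ((1 - r) * x + r) * (1 - r) - f ((1 - r) * x - r) * (1 - r)) / (2 * r)) (at x within {-1..1})"
    by (intro DERIV_cdivide DERIV_diff D) auto
  then show ?thesis
    by (rule has_field_derivative_transform_within[OF _ zero_less_one x]) (simp add: average_integral_difference(1)[OF r])
qed

end

text \<open>The polynomial is obtained by approximating the derivative uniformly and integrating.
  The difference to \<open>f\<close> is then Lipschitz with a small constant \<open>e\<close>, so
  its difference quotients, which are what the energy integrates, are at most \<open>e\<close>;
  closeness of the values alone would not bound them.\<close>

lemma near_isoperimetric_C1: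
  assumes f [measurable]: "f \<in> borel_measurable borel"
    and D: "\<And>x. x \<in> {-1..1} \<Longrightarrow> (f has_real_derivative f' x) (at x within {-1..1})"
    and c: "continuous_on {-1..1} f'"
  shows "near_isoperimetric f"
  unfolding near_isoperimetric_def
proof
  fix X :: "real set" assume X [measurable]: "X \<in> sets borel"
  let ?p = "ennreal (profile (measure semicircle_borel X))"
  show "?p \<le> energy f + 4 * L1_dist f (indicator X)"
  proof (rule ennreal_le_epsilon)
    fix e0 :: real assume "0 < e0"
    \<comment> \<open>The energy costs \<open>e\<close> and the L1 distance \<open>2 * e\<close>,
      which is weighted by 4: altogether \<open>9 * e\<close>.\<close>
    define e where "e = e0 / 9"
    have e: "0 < e" using \<open>0 < e0\<close> by (simp add: e_def)
    obtain q where q: "real_polynomial_function q" "\<And>x. x \<in> {-1..1} \<Longrightarrow> \<bar>f' x - q x\<bar> < e"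
      using Stone_Weierstrass_real_polynomial_function[OF _ c e] by auto
    obtain a n where a: "q = (\<lambda>x. \<Sum>i\<le>n. a i * x ^ i)"
      using q(1) unfolding real_polynomial_function_iff_sum by blast
    define P0 where "P0 = (\<Sum>i\<le>n. monom (a i / real (Suc i)) (Suc i))"
    \<comment> \<open>The constant term makes \<open>P\<close> agree with \<open>f\<close> at -1, so
      that the Lipschitz bound also controls the values, by \<open>e\<close> times the length
      2.\<close>
    define P where "P = [: f (-1) - poly P0 (-1) :] + P0"
    have P0: "(poly P0 has_real_derivative q x) (at x)" for x
    proof -
      have "poly P0 = (\<lambda>x. \<Sum>i\<le>n. a i / real (Suc i) * x ^ Suc i)"
        by (rule ext) (simp only: P0_def poly_sum poly_monom)
      moreover have "((\<lambda>x. \<Sum>i\<le>n. a i / real (Suc i) * x ^ Suc i) has_real_derivative (\<Sum>i\<le>n. a i * x ^ i)) (at x)"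
      proof (rule DERIV_sum)
        fix i
        show "((\<lambda>x. a i / real (Suc i) * x ^ Suc i) has_real_derivative a i * x ^ i) (at x)"
          using DERIV_cmult[OF DERIV_pow[of "Suc i" x], of "a i / real (Suc i)"] by simp
      qed
      ultimately show ?thesis by (simp only: a)
    qed
    have Pm: "poly P (-1) = f (-1)" by (simp add: P_def)
    have PD: "((\<lambda>x. poly P x - f x) has_real_derivative q x - f' x) (at x within {-1..1})" if "x \<in> {-1..1}" for x
    proof -
      have "poly P = (\<lambda>x. (f (-1) - poly P0 (-1)) + poly P0 x)" by (rule ext) (simp add: P_def)
      then have "(poly P has_real_derivative 0 + q x) (at x)"
        by (simp only:) (intro DERIV_add P0 DERIV_const)
      then have "(poly P has_real_derivative q x) (at x within {-1..1})"
        by (simp add: has_field_derivative_at_within)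
      then show ?thesis using D[OF that] by (rule DERIV_diff)
    qed
    have lip: "\<bar>(poly P x - f x) - (poly P y - f y)\<bar> \<le> e * \<bar>x - y\<bar>" if "x \<in> {-1..1}" "y \<in> {-1..1}" for x y
    proof -
      have "norm ((poly P x - f x) - (poly P y - f y)) \<le> e * norm (x - y)"
        by (rule field_differentiable_bound[OF _ PD]) (use q(2) that in \<open>force simp: abs_minus_commute intro: less_imp_le\<close>)+
      then show ?thesis by simp
    qed
    have rng: "AE x in semicircle_borel. x \<in> {-1..1}"
      by (rule eventually_mono[OF AE_semicircle_borel]) auto
    have E: "energy (poly P) \<le> energy f + ennreal e"
    proof -
      have [measurable]: "poly P \<in> borel_measurable borel"
        by (intro borel_measurable_continuous_onI continuous_intros)
      have "energy (poly P) \<le> (\<integral>\<^sup>+x. \<integral>\<^sup>+y. ennreal (\<bar>f x - f y\<bar> / \<bar>x - y\<bar>) + ennreal e \<partial>semicircle_borel \<partial>semicircle_borel)"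
        unfolding energy_def
      proof (intro nn_integral_mono_AE eventually_mono[OF rng])
        fix x y :: real assume xy: "x \<in> {-1..1}" "y \<in> {-1..1}"
        have "\<bar>poly P x - poly P y\<bar> \<le> \<bar>f x - f y\<bar> + e * \<bar>x - y\<bar>" using lip[OF xy] by linarith
        then have "\<bar>poly P x - poly P y\<bar> / \<bar>x - y\<bar> \<le> (\<bar>f x - f y\<bar> + e * \<bar>x - y\<bar>) / \<bar>x - y\<bar>"
          by (intro divide_right_mono) auto
        also have "\<dots> \<le> \<bar>f x - f y\<bar> / \<bar>x - y\<bar> + e"
          using e by (cases "x = y") (auto simp: add_divide_distrib)
        finally show "ennreal (\<bar>poly P x - poly P y\<bar> / \<bar>x - y\<bar>) \<le> ennreal (\<bar>f x - f y\<bar> / \<bar>x - y\<bar>) + ennreal e"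
          using e by (simp add: ennreal_plus[symmetric] del: ennreal_plus)
      qed
      also have "\<dots> = energy f + ennreal e"
        unfolding energy_def using emeasure_semicircle_borel_UNIV by (simp add: nn_integral_add)
      finally show ?thesis .
    qed
    have L: "L1_dist (poly P) f \<le> ennreal (2 * e)"
    proof -
      have "L1_dist (poly P) f \<le> (\<integral>\<^sup>+x. ennreal (2 * e) \<partial>semicircle_borel)"
        unfolding L1_dist_def
      proof (intro nn_integral_mono_AE eventually_mono[OF rng] ennreal_leI)
        fix x :: real assume x: "x \<in> {-1..1}"
        have "\<bar>poly P x - f x\<bar> \<le> e * \<bar>x - -1\<bar>" using lip[OF x, of "-1"] Pm by simp
        also have "\<dots> \<le> e * 2" using x e by (intro mult_left_mono) auto
        finally show "\<bar>poly P x - f x\<bar> \<le> 2 * e" by simp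
      qed
      then show ?thesis using emeasure_semicircle_borel_UNIV by simp
    qed
    have m: "poly P \<in> borel_measurable borel" by (intro borel_measurable_continuous_onI continuous_intros)
    have "?p \<le> energy (poly P) + 4 * L1_dist (poly P) (indicator X)"
      using near_isoperimetric_poly[of P] X by (simp only: near_isoperimetric_def)
    also have "\<dots> \<le> (energy f + ennreal e) + 4 * (ennreal (2 * e) + L1_dist f (indicator X))"
      using E L L1_dist_triangle[OF m f borel_measurable_indicator[OF X]]
      by (intro add_mono mult_left_mono) (auto intro: order_trans add_right_mono)
    also have "\<dots> = energy f + 4 * L1_dist f (indicator X) + (ennreal e + 4 * ennreal (2 * e))"
      by (simp add: distrib_left add_ac)
    also have "ennreal e + 4 * ennreal (2 * e) = ennreal e0"
    proof -
      have "4 * ennreal (2 * e) = ennreal (8 * e)" using e by (simp add: ennreal_mult)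
      then show ?thesis using e by (simp add: ennreal_plus[symmetric] e_def del: ennreal_plus)
    qed
    finally show "?p \<le> energy f + 4 * L1_dist f (indicator X) + ennreal e0" .
  qed
qed

text \<open>Two averages in succession: the inner one, \<open>g\<close>, is continuous, the outer
  one is continuously differentiable, and the property returns through both limits because averages
  keep the bound \<open>B\<close>.\<close>

lemma near_isoperimetric_bounded:
  assumes f [measurable]: "f \<in> borel_measurable borel" and B: "\<And>x. \<bar>f x\<bar> \<le> B"
  shows "near_isoperimetric f"
proof (rule near_isoperimetric_of_averages[OF assms])
  fix n
  define g where "g = average (1 / real (n + 2)) f"
  have g [measurable]: "g \<in> borel_measurable borel" by (simp add: g_def)
  have gB: "\<bar>g x\<bar> \<le> B" for x unfolding g_def by (rule average_bounded[OF f B])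
  have gc: "continuous_on {-1..1} g" unfolding g_def by (rule continuous_average[OF f B]) auto
  have "near_isoperimetric g"
  proof (rule near_isoperimetric_of_averages[OF g gB])
    fix m
    define r where "r = 1 / real (m + 2)"
    have r: "0 < r" "r < 1" by (auto simp: r_def)
    have "near_isoperimetric (average r g)"
    proof (rule near_isoperimetric_C1[OF _ DERIV_average[OF g gB r gc]])
      show "continuous_on {-1..1} (\<lambda>x. (g ((1 - r) * x + r) * (1 - r) - g ((1 - r) * x - r) * (1 - r)) / (2 * r))"
      proof -
        have "continuous_on {-1..1} (\<lambda>x. g ((1 - r) * x + r))" "continuous_on {-1..1} (\<lambda>x. g ((1 - r) * x - r))"
          using average_integral_difference(2,3)[OF g gB r]
          by (intro continuous_on_compose2[OF gc] continuous_intros; force)+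
        then show ?thesis using r by (intro continuous_intros) auto
      qed
    qed auto
    then show "near_isoperimetric (average (1 / real (m + 2)) g)" by (simp add: r_def)
  qed
  then show "near_isoperimetric (average (1 / real (n + 2)) f)" by (simp add: g_def)
qed

theorem isoperimetric_borel:
  assumes X [measurable]: "X \<in> sets borel"
  shows "isoperimetric X"
proof -
  have "near_isoperimetric (indicator X)"
    by (rule near_isoperimetric_bounded[where B = 1]) (auto simp: indicator_def)
  then have "ennreal (profile (measure semicircle_borel X)) \<le> energy (indicator X) + 4 * L1_dist (indicator X) (indicator X)"
    using X by (simp only: near_isoperimetric_def)
  then show ?thesis using energy_indicator[OF X] by (simp add: isoperimetric_def L1_dist_def)
qed

section \<open>Lebesgue-measurable sets\<close>

lemma AE_semicircle_range: "AE x in semicircle. x \<in> {-1..1}"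
  unfolding semicircle_def
  by (subst AE_density) (auto intro!: borel_imp_lebesgue_measurable simp: indicator_def)

lemma AE_semicircle_of_lborel: "AE x in lborel. P x \<Longrightarrow> AE x in semicircle. P x"
  unfolding semicircle_eq_density
  by (subst AE_density) (auto intro!: borel_imp_lebesgue_measurable AE_completion elim!: eventually_mono)

lemma lebesgue_set_borel_version:
  assumes "X \<in> sets lebesgue"
  obtains S where "S \<in> sets borel" "AE x in semicircle. x \<in> X \<longleftrightarrow> x \<in> S"
proof -
  obtain S N N' where *: "X = S \<union> N" "N \<subseteq> N'" "N' \<in> null_sets lborel" "S \<in> sets lborel"
    using assms by (rule sets_completionE)
  have "AE x in lborel. x \<notin> N'" using *(3) by (rule AE_not_in)
  then have "AE x in semicircle. x \<in> X \<longleftrightarrow> x \<in> S"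
    using * by (intro AE_semicircle_of_lborel) (auto elim!: eventually_mono)
  with * that show thesis by auto
qed

text \<open>The inner integral is unchanged for every \<open>x\<close>, so the exceptional set
  enters one variable at a time and both integrals pass from the Lebesgue to the Borel version of
  the law.\<close>

lemma cut_energy_eq_perimeter:
  assumes S [measurable]: "S \<in> sets borel" and ae: "AE x in semicircle. x \<in> X \<longleftrightarrow> x \<in> S"
  shows "cut_energy X = perimeter S"
proof -
  let ?k = "\<lambda>x y. ennreal (1 / \<bar>x - y\<bar>)"
  have inner: "(\<integral>\<^sup>+y. ?k x y * indicator ({-1..1} - X) y \<partial>semicircle) = (\<integral>\<^sup>+y. ?k x y * indicator (- S) y \<partial>semicircle_borel)" for x
  proof -
    have "(\<integral>\<^sup>+y. ?k x y * indicator ({-1..1} - X) y \<partial>semicircle) = (\<integral>\<^sup>+y. ?k x y * indicator (- S) y \<partial>semicircle)"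
    proof (rule nn_integral_cong_AE)
      show "AE y in semicircle. ?k x y * indicator ({-1..1} - X) y = ?k x y * indicator (- S) y"
        using ae AE_semicircle_range by eventually_elim (simp add: indicator_def)
    qed
    also have "\<dots> = (\<integral>\<^sup>+y. ?k x y * indicator (- S) y \<partial>semicircle_borel)"
      by (rule nn_integral_semicircle) simp
    finally show ?thesis .
  qed
  have "cut_energy X = (\<integral>\<^sup>+x. (\<integral>\<^sup>+y. ?k x y * indicator (- S) y \<partial>semicircle_borel) * indicator X x \<partial>semicircle)"
    unfolding cut_energy_def inner ..
  also have "\<dots> = (\<integral>\<^sup>+x. (\<integral>\<^sup>+y. ?k x y * indicator (- S) y \<partial>semicircle_borel) * indicator S x \<partial>semicircle)"
  proof (rule nn_integral_cong_AE)
    show "AE x in semicircle. (\<integral>\<^sup>+y. ?k x y * indicator (- S) y \<partial>semicircle_borel) * indicator X x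
      = (\<integral>\<^sup>+y. ?k x y * indicator (- S) y \<partial>semicircle_borel) * indicator S x"
      using ae by eventually_elim (simp add: indicator_def)
  qed
  also have "\<dots> = (\<integral>\<^sup>+x. (\<integral>\<^sup>+y. ?k x y * indicator (- S) y \<partial>semicircle_borel) * indicator S x \<partial>semicircle_borel)"
    by (rule nn_integral_semicircle) simp
  also have "\<dots> = perimeter S" unfolding perimeter_def by (rule interaction_eq[symmetric]) auto
  finally show ?thesis .
qed

lemma measure_semicircle_eq:
  assumes X: "X \<in> sets lebesgue" and S: "S \<in> sets borel" and ae: "AE x in semicircle. x \<in> X \<longleftrightarrow> x \<in> S"
  shows "measure semicircle X = measure semicircle_borel S"
proof -
  have "emeasure semicircle X = (\<integral>\<^sup>+x. indicator X x \<partial>semicircle)"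
    using X by (simp add: semicircle_eq_density)
  also have "\<dots> = (\<integral>\<^sup>+x. indicator S x \<partial>semicircle)"
  proof (rule nn_integral_cong_AE)
    show "AE x in semicircle. indicator X x = (indicator S x :: ennreal)"
      using ae by eventually_elim (simp add: indicator_def)
  qed
  also have "\<dots> = emeasure semicircle_borel S" using S by (simp add: nn_integral_semicircle)
  finally show ?thesis by (simp add: measure_def)
qed

section \<open>The quantile and the free profile in angular form\<close>

lemma AE_semicircle_Icc_atMost: "AE x in semicircle. x \<in> {-1..a} \<longleftrightarrow> x \<in> {..a}"
  using AE_semicircle_range by eventually_elim auto

lemma measure_semicircle_Icc:
  assumes "-(pi/2) \<le> p" "p \<le> pi/2"
  shows "measure semicircle {-1..sin p} = angle_cdf p"
  using measure_semicircle_eq[OF _ _ AE_semicircle_Icc_atMost] measure_semicircle_borel_atMost[OF assms] by simp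

lemma semicircle_quantile_eq:
  assumes "u \<in> {0..1}"
  shows "semicircle_quantile u = sin (angle_quantile u)"
  unfolding semicircle_quantile_def
proof (rule the_equality)
  have r: "-(pi/2) \<le> angle_quantile u" "angle_quantile u \<le> pi/2" using angle_quantile_range[OF assms] by auto
  show "sin (angle_quantile u) \<in> {-1..1} \<and> measure semicircle {-1..sin (angle_quantile u)} = u"
    using measure_semicircle_Icc[OF r] angle_cdf_quantile[OF assms] by simp
  fix a assume a: "a \<in> {-1..1} \<and> measure semicircle {-1..a} = u"
  define p where "p = arcsin a"
  have p: "-(pi/2) \<le> p" "p \<le> pi/2" "sin p = a" using a arcsin_bounded[of a] by (auto simp: p_def)
  then have "angle_cdf p = u" using a measure_semicircle_Icc[of p] by simp
  then have "angle_quantile u = p" using angle_quantile_cdf[of p] p by auto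
  then show "a = sin (angle_quantile u)" using p by simp
qed

lemma free_profile_eq:
  assumes "u \<in> {0..1}"
  shows "free_profile u = profile u"
proof -
  define c where "c = cos (angle_quantile u)"
  have "c \<ge> 0" unfolding c_def using angle_quantile_range[OF assms] by (intro cos_ge_zero) auto
  have "(c\<^sup>2) powr (3 / 2) = c ^ 3"
  proof (cases "c = 0")
    case False
    with \<open>c \<ge> 0\<close> have "c > 0" by simp
    then have "(c\<^sup>2) powr (3 / 2) = (c powr 2) powr (3 / 2)" by simp
    also have "\<dots> = c powr 3" by (simp only: powr_powr) simp
    also have "\<dots> = c ^ 3" using \<open>c > 0\<close> by simp
    finally show ?thesis .
  qed simp
  moreover have "1 - (sin (angle_quantile u))\<^sup>2 = c\<^sup>2" by (simp add: c_def cos_squared_eq)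
  ultimately show ?thesis
    by (simp add: free_profile_def semicircle_quantile_eq[OF assms] profile_def angle_profile_def c_def)
qed

theorem theorem2:
  fixes X :: "real set"
  assumes "X \<in> sets lebesgue" and "X \<subseteq> {-1..1}"
  shows "2 * cut_energy X \<ge> ennreal (free_profile (measure semicircle X)) \<and>
         ennreal (free_profile (measure semicircle X)) =
           2 * cut_energy {-1..semicircle_quantile (measure semicircle X)}"
proof -
  obtain S where S: "S \<in> sets borel" "AE x in semicircle. x \<in> X \<longleftrightarrow> x \<in> S"
    using assms(1) by (rule lebesgue_set_borel_version)
  define u where "u = measure semicircle_borel S"
  have u: "measure semicircle X = u" "u \<in> {0..1}"
    unfolding u_def using measure_semicircle_eq[OF assms(1) S] measure_semicircle_borel_range[of S] by auto
  have "ennreal (profile u) \<le> 2 * cut_energy X"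
    using isoperimetric_borel[OF S(1)] cut_energy_eq_perimeter[OF S] by (simp add: isoperimetric_def u_def)
  moreover have "2 * cut_energy {-1..sin (angle_quantile u)} = ennreal (profile u)"
    using angle_quantile_range[OF u(2)] cut_energy_eq_perimeter[OF _ AE_semicircle_Icc_atMost]
    by (simp add: perimeter_half_line profile_def)
  ultimately show ?thesis
    by (simp add: u(1) free_profile_eq[OF u(2)] semicircle_quantile_eq[OF u(2)])
qed

end
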